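(* Let $(X,x)$ be a based bigraph, i.e. $X$ is a bigraph and $x: K_2 \to X$ is a bigraph homomorphism, and regard $x$ as the point $(\{x(0)\},\{x(1)\})$ of the box complex $B_{/K_2}(X)$. Then the clique complex $C(\Omega_{/K_2}(X,x))$ is homotopy equivalent to the based loop space $\Omega(|B_{/K_2}(X)|, x)$. Moreover, there is an isomorphism of groups $$\pi_1(|B_{/K_2}(X)|, x) \cong \pi_1^2(X, x(0)),$$ where on the right $X$ is regarded as a graph.
   Context: A graph $G$ is a set $V(G)$ with a symmetric subset $E(G)\subset V(G)\times V(G)$ (loops allowed, no multiple edges); a graph homomorphism is a map of vertex sets with $(f\times f)(E(G))\subset E(H)$. $K_2$ is the graph with vertices $\{0,1\}$ and edges $(0,1),(1,0)$. A bigraph is a graph $X$ with a graph homomorphism $\varepsilon_X: X \to K_2$ (a 2-coloring); $V_i(X)=\varepsilon_X^{-1}(i)$. A bigraph homomorphism is a graph homomorphism commuting with the 2-colorings; $K_2$ is a bigraph via the identity coloring. For a graph $G$, $C(G)$ denotes the poset of finite nonempty subsets $\sigma\subset V(G)$ with $\sigma\times\sigma\subset E(G)$, ordered by inclusion (the face poset of the clique complex of the maximal reflexive subgraph); posets are regarded as spaces via the geometric realization $|\cdot|$ of their order complexes. The box complex $B_{/K_2}(X)$ is the poset of pairs $(\sigma,\tau)$ with $\sigma\subset V_0(X)$, $\tau\subset V_1(X)$ finite nonempty and $\sigma\times\tau\subset E(X)$, ordered by componentwise inclusion. Let $L_{-\infty,\infty}$ be the bigraph with vertex set $\mathbb{Z}$,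 edges $\{(a,b): |a-b|=1\}$, coloring $a\mapsto a \bmod 2$. The graph $\Omega_{/K_2}(X,x)$ has as vertices the bigraph homomorphisms $\gamma: L_{-\infty,\infty}\to X$ such that $\gamma(2k)=x(0)$ and $\gamma(2k+1)=x(1)$ for all integers $k$ with $|k|$ sufficiently large; two vertices $\gamma,\gamma'$ are adjacent iff $(\gamma\times\gamma')(E(L_{-\infty,\infty}))\subset E(X)$, i.e. $(\gamma(a),\gamma'(b))\in E(X)$ whenever $|a-b|=1$. The 2-fundamental group: for a graph $G$ and a vertex $v$, let $L_n$ be the graph with vertices $0,\dots,n$ and edges $(i,j)$ with $|i-j|=1$; a loop of length $n$ at $v$ is a graph homomorphism $\gamma: L_n\to G$ with $\gamma(0)=\gamma(n)=v$. Let $\simeq$ be the equivalence relation on loops at $v$ generated by: (1) $l(\gamma')=l(\gamma)+2$ and there is $x\in\{0,\dots,l(\gamma)\}$ with $\gamma(i)=\gamma'(i)$ for $i\le x$ and $\gamma'(i+2)=\gamma(i)$ for $i\ge x$; (2) $\gamma,\gamma'$ have the same length $n$ and $(\gamma(i),\gamma'(j))\in E(G)$ whenever $|i-j|=1$. Then $\pi_1^2(G,v)$ is the set of equivalence classes, a group under concatenation of loops. *)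

theory Defs
  imports "HOL-Analysis.Analysis" "HOL-Algebra.Group"
begin

section \<open>Graphs and bigraphs\<close>

text \<open>A graph is a vertex set V with a symmetric edge relation E on V (loops allowed).\<close>
definition is_graph :: "'v set \<Rightarrow> ('v \<times> 'v) set \<Rightarrow> bool" where
  "is_graph V E \<longleftrightarrow> E \<subseteq> V \<times> V \<and> (\<forall>a b. (a, b) \<in> E \<longrightarrow> (b, a) \<in> E)"

text \<open>K2 has vertices 0,1 and edges (0,1),(1,0). A bigraph is a graph with a graph
  homomorphism c to K2.\<close>
definition is_bigraph :: "'v set \<Rightarrow> ('v \<times> 'v) set \<Rightarrow> ('v \<Rightarrow> nat) \<Rightarrow> bool" where
  "is_bigraph V E c \<longleftrightarrow> is_graph V E \<and> c ` V \<subseteq> {0, 1} \<and>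
     (\<forall>a b. (a, b) \<in> E \<longrightarrow> (c a, c b) \<in> {(0, 1), (1, 0)})"

text \<open>A base point x : K2 \<rightarrow> X (bigraph homomorphism), given by x(0) = x0 and x(1) = x1.\<close>
definition is_based_bigraph :: "'v set \<Rightarrow> ('v \<times> 'v) set \<Rightarrow> ('v \<Rightarrow> nat) \<Rightarrow> 'v \<Rightarrow> 'v \<Rightarrow> bool" where
  "is_based_bigraph V E c x0 x1 \<longleftrightarrow> is_bigraph V E c \<and> x0 \<in> V \<and> x1 \<in> V \<and>
     c x0 = 0 \<and> c x1 = 1 \<and> (x0, x1) \<in> E \<and> (x1, x0) \<in> E"

section \<open>Posets C(G) and the box complex\<close>

definition clique_poset :: "'v set \<Rightarrow> ('v \<times> 'v) set \<Rightarrow> 'v set set" where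
  "clique_poset V E = {\<sigma>. finite \<sigma> \<and> \<sigma> \<noteq> {} \<and> \<sigma> \<subseteq> V \<and> \<sigma> \<times> \<sigma> \<subseteq> E}"

definition box_complex :: "'v set \<Rightarrow> ('v \<times> 'v) set \<Rightarrow> ('v \<Rightarrow> nat) \<Rightarrow> ('v set \<times> 'v set) set" where
  "box_complex V E c = {(\<sigma>, \<tau>). finite \<sigma> \<and> \<sigma> \<noteq> {} \<and> \<sigma> \<subseteq> {v \<in> V. c v = 0} \<and>
       finite \<tau> \<and> \<tau> \<noteq> {} \<and> \<tau> \<subseteq> {v \<in> V. c v = 1} \<and> \<sigma> \<times> \<tau> \<subseteq> E}"

definition box_le :: "('v set \<times> 'v set) \<Rightarrow> ('v set \<times> 'v set) \<Rightarrow> bool" where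
  "box_le p q \<longleftrightarrow> fst p \<subseteq> fst q \<and> snd p \<subseteq> snd q"

section \<open>The graph Omega_{/K2}(X,x)\<close>

definition omega_vertices :: "'v set \<Rightarrow> ('v \<times> 'v) set \<Rightarrow> ('v \<Rightarrow> nat) \<Rightarrow> 'v \<Rightarrow> 'v \<Rightarrow> (int \<Rightarrow> 'v) set" where
  "omega_vertices V E c x0 x1 = {\<gamma>. (\<forall>a. \<gamma> a \<in> V) \<and> (\<forall>a. c (\<gamma> a) = nat (a mod 2)) \<and>
      (\<forall>a b. \<bar>a - b\<bar> = 1 \<longrightarrow> (\<gamma> a, \<gamma> b) \<in> E) \<and>
      (\<exists>N. \<forall>k. N \<le> \<bar>k\<bar> \<longrightarrow> \<gamma> (2 * k) = x0 \<and> \<gamma> (2 * k + 1) = x1)}"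

definition omega_edges :: "'v set \<Rightarrow> ('v \<times> 'v) set \<Rightarrow> ('v \<Rightarrow> nat) \<Rightarrow> 'v \<Rightarrow> 'v \<Rightarrow> ((int \<Rightarrow> 'v) \<times> (int \<Rightarrow> 'v)) set" where
  "omega_edges V E c x0 x1 = {(\<gamma>, \<gamma>'). \<gamma> \<in> omega_vertices V E c x0 x1 \<and> \<gamma>' \<in> omega_vertices V E c x0 x1 \<and>
      (\<forall>a b. \<bar>a - b\<bar> = 1 \<longrightarrow> (\<gamma> a, \<gamma>' b) \<in> E)}"

section \<open>Geometric realization of the order complex of a poset\<close>

definition chains_of :: "'a set \<Rightarrow> ('a \<Rightarrow> 'a \<Rightarrow> bool) \<Rightarrow> 'a set set" where
  "chains_of P leq = {S. finite S \<and> S \<noteq> {} \<and> S \<subseteq> P \<and> (\<forall>a\<in>S. \<forall>b\<in>S. leq a b \<or> leq b a)}"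

definition simplex_of :: "'a set \<Rightarrow> ('a \<Rightarrow> real) set" where
  "simplex_of S = {\<alpha>. (\<forall>a. 0 \<le> \<alpha> a) \<and> (\<forall>a. a \<notin> S \<longrightarrow> \<alpha> a = 0) \<and> sum \<alpha> S = 1}"

definition realization_carrier :: "'a set \<Rightarrow> ('a \<Rightarrow> 'a \<Rightarrow> bool) \<Rightarrow> ('a \<Rightarrow> real) set" where
  "realization_carrier P leq = \<Union> (simplex_of ` chains_of P leq)"

text \<open>Weak (coherent) topology: U is open iff its trace on every closed simplex is open
  in the Euclidean topology of that simplex.\<close>
definition realization :: "'a set \<Rightarrow> ('a \<Rightarrow> 'a \<Rightarrow> bool) \<Rightarrow> ('a \<Rightarrow> real) topology" where
  "realization P leq = topology (\<lambda>U. U \<subseteq> realization_carrier P leq \<and>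
      (\<forall>S \<in> chains_of P leq. openin (subtopology (powertop_real UNIV) (simplex_of S)) (U \<inter> simplex_of S)))"

definition vertex_pt :: "'a \<Rightarrow> ('a \<Rightarrow> real)" where
  "vertex_pt v = (\<lambda>a. if a = v then 1 else 0)"

section \<open>Based loop space with the compact-open topology\<close>

definition based_loops :: "'b topology \<Rightarrow> 'b \<Rightarrow> (real \<Rightarrow> 'b) set" where
  "based_loops T p = {\<gamma>. continuous_map (top_of_set {0..1}) T \<gamma> \<and> \<gamma> 0 = p \<and> \<gamma> 1 = p \<and>
      (\<forall>t. t \<notin> {0..1} \<longrightarrow> \<gamma> t = p)}"

definition loop_space :: "'b topology \<Rightarrow> 'b \<Rightarrow> (real \<Rightarrow> 'b) topology" where
  "loop_space T p = topology_generated_by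
     {{\<gamma> \<in> based_loops T p. \<gamma> ` K \<subseteq> U} | K U. compactin (top_of_set {0..1}) K \<and> openin T U}"

section \<open>Fundamental group\<close>

definition loops_at :: "'b topology \<Rightarrow> 'b \<Rightarrow> (real \<Rightarrow> 'b) set" where
  "loops_at T p = {\<gamma>. pathin T \<gamma> \<and> \<gamma> 0 = p \<and> \<gamma> 1 = p}"

definition loop_homotopic :: "'b topology \<Rightarrow> 'b \<Rightarrow> (real \<Rightarrow> 'b) \<Rightarrow> (real \<Rightarrow> 'b) \<Rightarrow> bool" where
  "loop_homotopic T p \<gamma> \<delta> \<longleftrightarrow> homotopic_with (\<lambda>h. h 0 = p \<and> h 1 = p) (top_of_set {0..1}) T \<gamma> \<delta>"

definition join_loops :: "(real \<Rightarrow> 'b) \<Rightarrow> (real \<Rightarrow> 'b) \<Rightarrow> real \<Rightarrow> 'b" where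
  "join_loops \<gamma> \<delta> t = (if t \<le> 1/2 then \<gamma> (2 * t) else \<delta> (2 * t - 1))"

definition loop_class :: "'b topology \<Rightarrow> 'b \<Rightarrow> (real \<Rightarrow> 'b) \<Rightarrow> (real \<Rightarrow> 'b) set" where
  "loop_class T p \<gamma> = {\<delta> \<in> loops_at T p. loop_homotopic T p \<gamma> \<delta>}"

definition fundamental_group :: "'b topology \<Rightarrow> 'b \<Rightarrow> (real \<Rightarrow> 'b) set monoid" where
  "fundamental_group T p =
     \<lparr>carrier = loop_class T p ` loops_at T p,
      mult = (\<lambda>A B. {\<epsilon> \<in> loops_at T p. \<exists>\<gamma>\<in>A. \<exists>\<delta>\<in>B. loop_homotopic T p (join_loops \<gamma> \<delta>) \<epsilon>}),
      one = loop_class T p (\<lambda>_. p)\<rparr>"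

section \<open>The 2-fundamental group of a graph\<close>

text \<open>A loop of length n at v is represented by the list [\<gamma>(0), ..., \<gamma>(n)].\<close>
definition loop2 :: "'v set \<Rightarrow> ('v \<times> 'v) set \<Rightarrow> 'v \<Rightarrow> 'v list \<Rightarrow> bool" where
  "loop2 V E v xs \<longleftrightarrow> xs \<noteq> [] \<and> set xs \<subseteq> V \<and> xs ! 0 = v \<and> xs ! (length xs - 1) = v \<and>
     (\<forall>i. i + 1 < length xs \<longrightarrow> (xs ! i, xs ! (i + 1)) \<in> E)"

definition loop2_step1 :: "'v set \<Rightarrow> ('v \<times> 'v) set \<Rightarrow> 'v \<Rightarrow> ('v list \<times> 'v list) set" where
  "loop2_step1 V E v = {(g, g'). loop2 V E v g \<and> loop2 V E v g' \<and>
      length g' - 1 = (length g - 1) + 2 \<and>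
      (\<exists>x \<le> length g - 1. (\<forall>i \<le> x. g ! i = g' ! i) \<and>
          (\<forall>i. x \<le> i \<and> i \<le> length g - 1 \<longrightarrow> g' ! (i + 2) = g ! i))}"

definition loop2_step2 :: "'v set \<Rightarrow> ('v \<times> 'v) set \<Rightarrow> 'v \<Rightarrow> ('v list \<times> 'v list) set" where
  "loop2_step2 V E v = {(g, g'). loop2 V E v g \<and> loop2 V E v g' \<and> length g = length g' \<and>
      (\<forall>i j. i \<le> length g - 1 \<and> j \<le> length g - 1 \<and> (i = j + 1 \<or> j = i + 1) \<longrightarrow> (g ! i, g' ! j) \<in> E)}"

text \<open>The equivalence relation generated by the two moves.\<close>
definition loop2_equiv :: "'v set \<Rightarrow> ('v \<times> 'v) set \<Rightarrow> 'v \<Rightarrow> ('v list \<times> 'v list) set" where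
  "loop2_equiv V E v =
     (let R = loop2_step1 V E v \<union> loop2_step2 V E v in (R \<union> R\<inverse>)\<^sup>*)"

definition pi1_2 :: "'v set \<Rightarrow> ('v \<times> 'v) set \<Rightarrow> 'v \<Rightarrow> 'v list set monoid" where
  "pi1_2 V E v =
     \<lparr>carrier = {loop2_equiv V E v `` {g} | g. loop2 V E v g},
      mult = (\<lambda>A B. {h. \<exists>g\<in>A. \<exists>g'\<in>B. (g @ tl g', h) \<in> loop2_equiv V E v}),
      one = loop2_equiv V E v `` {[v]}\<rparr>"

end

(* A point of the order complex of a poset of finite sets is determined by its distribution
   function u(v) = total weight of the members containing v, a function with maximum 1 whose
   superlevel sets are members of the poset. In these coordinates both complexes become spaces of
   max-normalised functions, on which "max" and "min" replace sums and products: supports are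
   controlled without any renormalisation.

   A point u of C(Omega) has max-marginals p_k on the vertices of colour k mod 2, and
   s |-> max_k kap(s - k) p_k is a loop in the box complex, where kap is a bump wide enough that both
   colours are always present at height 1 and narrow enough that at most three consecutive indices
   overlap. Conversely, cut a loop w into short windows, at a scale depending continuously on w, and
   let q_k be a truncation of the infimum of w over the k-th window; then min_k q_k(gamma(k)) is a
   point of C(Omega). The truncation makes the supports locally finite, hence the maps continuous for
   the weak topologies. The result depends on the window system only up to homotopy, because any two
   admissible systems are joined by sweeping through them, and for the natural windows of the loop
   attached to u one recovers u. This gives the homotopy equivalence; on path components it gives
   the bijection between homotopy classes of loops and components of Omega, that is, classes of loops
   in the graph. *)
theory Submission
  imports Defs

begin

section \<open>The weak topology on finitely supported functions\<close>

text \<open>What shapes the proof is the weak topology. It is finer than the product topology, and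
  the available test for maps into it asks for locally common finite supports besides continuous
  coordinates. An infimum over a window can fail this: arbitrarily near a loop, small weights may
  appear at infinitely many vertices. Hence weights up to 1/4 are erased, and weights from 1/2 on
  are raised to 1 to keep the maximum. Maps out of a weak topology are tested on finite parts; with
  a further factor this works if that factor is locally compact, which suffices for homotopy
  parameters in [0,1]. The loop space has no such description; there the compact-open topology
  enters through sup-norm neighbourhoods. Max-normalised paths are followed by \<open>trop\<close>,
  which holds one of the two points at full height at every moment; linear interpolation could lower
  the maximum. The homotopy equivalence alone does not compare products. The bump smears each vertex
  over a length of 3/2 on either side, so the loops of two lists interfere at the junction; extra
  base vertices inserted there separate them.\<close>

abbreviation unit_interval :: "real topology" where
  "unit_interval \<equiv> top_of_set {0..1}"

definition part :: "('w \<Rightarrow> real) set \<Rightarrow> 'w set \<Rightarrow> ('w \<Rightarrow> real) set" where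
  "part Q A = {u \<in> Q. \<forall>v. v \<notin> A \<longrightarrow> u v = 0}"

abbreviation part_top :: "('w \<Rightarrow> real) set \<Rightarrow> 'w set \<Rightarrow> ('w \<Rightarrow> real) topology" where
  "part_top Q A \<equiv> subtopology (powertop_real UNIV) (part Q A)"

text \<open>Indexing by finite vertex sets instead of simplices gives one notion that fits the
  realizations and the max-normalised models alike.\<close>

definition weak_top :: "('w \<Rightarrow> real) set \<Rightarrow> ('w \<Rightarrow> real) topology" where
  "weak_top Q = topology (\<lambda>U. U \<subseteq> Q \<and> (\<forall>A. finite A \<longrightarrow> openin (part_top Q A) (U \<inter> part Q A)))"

lemma topspace_part_top [simp]: "topspace (part_top Q A) = part Q A"
  by (simp add: topspace_subtopology)

lemma istopology_traces:
  "istopology (\<lambda>U. U \<subseteq> Q \<and> (\<forall>i\<in>J. openin (X i) (U \<inter> B i)))"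
proof -
  have "openin (X i) (\<Union>K \<inter> B i)" if "\<forall>U\<in>K. openin (X i) (U \<inter> B i)" for K i
  proof -
    have "\<Union>K \<inter> B i = \<Union>((\<lambda>U. U \<inter> B i) ` K)" by blast
    then show ?thesis using that by (metis (no_types, lifting) imageE openin_Union)
  qed
  moreover have "openin (X i) (S \<inter> T \<inter> B i)"
    if "openin (X i) (S \<inter> B i)" "openin (X i) (T \<inter> B i)" for S T i
  proof -
    have "S \<inter> T \<inter> B i = (S \<inter> B i) \<inter> (T \<inter> B i)" by blast
    then show ?thesis using openin_Int[OF that] by simp
  qed
  ultimately show ?thesis unfolding istopology_def by (simp add: Sup_le_iff le_infI1)
qed

lemma openin_weak_top:
  "openin (weak_top Q) U \<longleftrightarrow> U \<subseteq> Q \<and> (\<forall>A. finite A \<longrightarrow> openin (part_top Q A) (U \<inter> part Q A))"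
proof -
  have "istopology (\<lambda>U. U \<subseteq> Q \<and> (\<forall>A\<in>{A. finite A}. openin (part_top Q A) (U \<inter> part Q A)))"
    by (rule istopology_traces)
  then show ?thesis by (simp add: weak_top_def topology_inverse')
qed

lemma topspace_weak_top [simp]: "topspace (weak_top Q) = Q"
proof
  show "topspace (weak_top Q) \<subseteq> Q"
    using openin_topspace[of "weak_top Q"] unfolding openin_weak_top by blast
  have "part Q A \<subseteq> Q" for A by (auto simp: part_def)
  then have "openin (weak_top Q) Q"
    unfolding openin_weak_top
    by (metis inf.absorb_iff2 openin_topspace order_refl topspace_part_top)
  then show "Q \<subseteq> topspace (weak_top Q)"
    by (simp add: openin_subset)
qed

section \<open>Continuity into and out of weak topologies\<close>

lemma continuous_map_locally:
  assumes "\<And>z. z \<in> topspace Z \<Longrightarrow> \<exists>N. openin Z N \<and> z \<in> N \<and> continuous_map (subtopology Z N) Y f"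
  shows "continuous_map Z Y f"
proof -
  obtain N where N: "\<And>z. z \<in> topspace Z \<Longrightarrow> openin Z (N z) \<and> z \<in> N z \<and> continuous_map (subtopology Z (N z)) Y f"
    using assms by metis
  show ?thesis
  proof (rule pasting_lemma[where I="topspace Z" and T=N and f="\<lambda>_. f"])
    fix x assume "x \<in> topspace Z"
    then show "\<exists>j. j \<in> topspace Z \<and> x \<in> N j \<and> f x = f x" using N by blast
  next
    show "openin Z (N i)" "continuous_map (subtopology Z (N i)) Y f" if "i \<in> topspace Z" for i
      using N[OF that] by auto
  qed simp
qed

text \<open>Continuous coordinates alone are too little, since the weak topology refines the product
  topology. A finite set \<open>A\<close> supporting all values near \<open>z\<close> confines the
  map to \<open>part Q A\<close>, where weakly open sets have open traces.\<close>

lemma continuous_map_into_weak_top: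
  assumes "\<And>z. z \<in> topspace Z \<Longrightarrow> h z \<in> Q"
    and "\<And>z. z \<in> topspace Z \<Longrightarrow> \<exists>N A. openin Z N \<and> z \<in> N \<and> finite A \<and>
           (\<forall>y\<in>N. \<forall>v. v \<notin> A \<longrightarrow> h y v = 0) \<and>
           (\<forall>v\<in>A. continuous_map (subtopology Z N) euclideanreal (\<lambda>y. h y v))"
  shows "continuous_map Z (weak_top Q) h"
proof (rule continuous_map_locally)
  fix z assume z: "z \<in> topspace Z"
  obtain N A where N: "openin Z N" "z \<in> N" "finite A"
      "\<And>y v. y \<in> N \<Longrightarrow> v \<notin> A \<Longrightarrow> h y v = 0"
      "\<And>v. v \<in> A \<Longrightarrow> continuous_map (subtopology Z N) euclideanreal (\<lambda>y. h y v)"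
    using assms(2)[OF z] by blast
  have NZ: "N \<subseteq> topspace Z" using N(1) by (rule openin_subset)
  have "continuous_map (subtopology Z N) euclideanreal (\<lambda>y. h y v)" for v
  proof (cases "v \<in> A")
    case False
    have "continuous_map (subtopology Z N) euclideanreal (\<lambda>y. 0)" by simp
    then show ?thesis by (rule continuous_map_eq) (use N False in auto)
  qed (use N in auto)
  then have "continuous_map (subtopology Z N) (powertop_real UNIV) h"
    by (simp add: continuous_map_componentwise_UNIV)
  then have c: "continuous_map (subtopology Z N) (part_top Q A) h"
    using N NZ assms(1) by (auto simp: continuous_map_in_subtopology part_def)
  have "continuous_map (subtopology Z N) (weak_top Q) h"
    unfolding continuous_map_def
  proof (intro conjI allI impI)
    show "h \<in> topspace (subtopology Z N) \<rightarrow> topspace (weak_top Q)"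
      using assms(1) by auto
    fix U assume "openin (weak_top Q) U"
    then have "openin (part_top Q A) (U \<inter> part Q A)"
      using N(3) by (simp add: openin_weak_top)
    then have "openin (subtopology Z N) {x \<in> topspace (subtopology Z N). h x \<in> U \<inter> part Q A}"
      by (rule openin_continuous_map_preimage[OF c])
    moreover have "h x \<in> part Q A" if "x \<in> topspace (subtopology Z N)" for x
      using that N(4) assms(1) by (auto simp: part_def)
    then have "{x \<in> topspace (subtopology Z N). h x \<in> U \<inter> part Q A} = {x \<in> topspace (subtopology Z N). h x \<in> U}"
      by blast
    ultimately show "openin (subtopology Z N) {x \<in> topspace (subtopology Z N). h x \<in> U}" by simp
  qed
  then show "\<exists>N. openin Z N \<and> z \<in> N \<and> continuous_map (subtopology Z N) (weak_top Q) h"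
    using N by blast
qed

lemma continuous_map_into_weak_top_finite:
  assumes "\<And>z. z \<in> topspace Z \<Longrightarrow> h z \<in> Q" "finite B"
    and "\<And>z v. z \<in> topspace Z \<Longrightarrow> v \<notin> B \<Longrightarrow> h z v = 0"
    and "\<And>v. v \<in> B \<Longrightarrow> continuous_map Z euclideanreal (\<lambda>z. h z v)"
  shows "continuous_map Z (weak_top Q) h"
proof (rule continuous_map_into_weak_top)
  fix z assume z: "z \<in> topspace Z"
  show "\<exists>N A. openin Z N \<and> z \<in> N \<and> finite A \<and> (\<forall>y\<in>N. \<forall>v. v \<notin> A \<longrightarrow> h y v = 0) \<and>
           (\<forall>v\<in>A. continuous_map (subtopology Z N) euclideanreal (\<lambda>y. h y v))"
    using z assms(2-4)
    by (intro exI[of _ "topspace Z"] exI[of _ B]) (simp add: continuous_map_from_subtopology)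
qed (rule assms(1))

text \<open>Testing on finite parts does not pass to products in general; local compactness of the
  other factor repairs this. A compact neighbourhood \<open>K\<close> of \<open>z\<close> is fixed
  first, and the tube lemma on each part shows that the points \<open>u\<close> with
  \<open>h\<close> mapping \<open>K \<times> {u}\<close> into \<open>W\<close> form a weakly open
  set. With \<open>Z\<close> the unit interval, homotopies on weak topologies reduce to finite
  parts.\<close>

lemma continuous_map_weak_top_prod:
  assumes Z: "locally_compact_space Z" "Hausdorff_space Z"
    and fin: "\<And>u. u \<in> Q \<Longrightarrow> finite {v. u v \<noteq> 0}"
    and cont: "\<And>A. finite A \<Longrightarrow> continuous_map (prod_topology Z (part_top Q A)) Y h"
  shows "continuous_map (prod_topology Z (weak_top Q)) Y h"
proof -
  have pt: "h (z, u) \<in> topspace Y" if "z \<in> topspace Z" "u \<in> Q" for z u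
  proof -
    have "u \<in> part Q {v. u v \<noteq> 0}" using that by (auto simp: part_def)
    then show ?thesis using cont[OF fin[OF that(2)]] that by (auto simp: continuous_map_def Pi_iff)
  qed
  have "\<exists>K U. openin Z K \<and> openin (weak_top Q) U \<and> z \<in> K \<and> u \<in> U \<and> K \<times> U \<subseteq> h -` W"
    if zu: "z \<in> topspace Z" "u \<in> Q" and W: "openin Y W" and hW: "h (z, u) \<in> W" for z u W
  proof -
    let ?A = "{v. u v \<noteq> 0}"
    have uA: "u \<in> part Q ?A" using zu by (auto simp: part_def)
    have "continuous_map Z Y (h \<circ> (\<lambda>z. (z, u)))"
      by (rule continuous_map_compose[OF _ cont[OF fin[OF zu(2)]]])
        (use uA in \<open>simp add: continuous_map_pairedI\<close>)
    then have op: "openin Z {y \<in> topspace Z. h (y, u) \<in> W}"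
      using W by (simp add: continuous_map_def)
    have "neighbourhood_base_of (compactin Z) Z"
      using Z locally_compact_space_neighbourhood_base by blast
    then obtain O' K where K: "openin Z O'" "compactin Z K" "z \<in> O'" "O' \<subseteq> K" "K \<subseteq> {y \<in> topspace Z. h (y, u) \<in> W}"
      using op zu hW unfolding neighbourhood_base_of by (metis (mono_tags, lifting) mem_Collect_eq)
    let ?U = "{u \<in> Q. \<forall>y\<in>K. h (y, u) \<in> W}"
    have "openin (part_top Q A) (?U \<inter> part Q A)" if A: "finite A" for A
    proof (subst openin_subopen, intro ballI)
      fix x assume x: "x \<in> ?U \<inter> part Q A"
      have o: "openin (prod_topology Z (part_top Q A)) {p \<in> topspace (prod_topology Z (part_top Q A)). h p \<in> W}"
        using cont[OF A] W by (simp add: continuous_map_def)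
      have xp: "x \<in> topspace (part_top Q A)" using x by simp
      have "K \<times> {x} \<subseteq> {p \<in> topspace (prod_topology Z (part_top Q A)). h p \<in> W}"
        using x K(5) by auto
      from tube_lemma_left[OF o K(2) xp this]
      obtain O1 O2 where O: "openin Z O1" "openin (part_top Q A) O2" "K \<subseteq> O1" "x \<in> O2"
          "O1 \<times> O2 \<subseteq> {p \<in> topspace (prod_topology Z (part_top Q A)). h p \<in> W}"
        by blast
      have "O2 \<subseteq> part Q A" using openin_subset[OF O(2)] by simp
      moreover have "O2 \<subseteq> ?U"
      proof
        fix w assume w: "w \<in> O2"
        then have "w \<in> Q" using \<open>O2 \<subseteq> part Q A\<close> by (auto simp: part_def)
        moreover have "h (y, w) \<in> W" if "y \<in> K" for y using that w O(3,5) by blast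
        ultimately show "w \<in> ?U" by blast
      qed
      ultimately show "\<exists>T. openin (part_top Q A) T \<and> x \<in> T \<and> T \<subseteq> ?U \<inter> part Q A"
        using O by blast
    qed
    then have "openin (weak_top Q) ?U" unfolding openin_weak_top by blast
    then show ?thesis
      using K zu by (intro exI[of _ O'] exI[of _ ?U]) auto
  qed
  note * = this
  show ?thesis
    unfolding continuous_map_def
  proof (intro conjI allI impI)
    show "h \<in> topspace (prod_topology Z (weak_top Q)) \<rightarrow> topspace Y" using pt by auto
    fix W assume W: "openin Y W"
    show "openin (prod_topology Z (weak_top Q)) {x \<in> topspace (prod_topology Z (weak_top Q)). h x \<in> W}"
    proof (subst openin_prod_topology_alt, intro allI impI)
      fix x y assume "(x, y) \<in> {x \<in> topspace (prod_topology Z (weak_top Q)). h x \<in> W}"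
      then have xy: "x \<in> topspace Z" "y \<in> Q" "h (x, y) \<in> W" by auto
      obtain K U where "openin Z K" "openin (weak_top Q) U" "x \<in> K" "y \<in> U" "K \<times> U \<subseteq> h -` W"
        using *[OF xy(1,2) W xy(3)] by blast
      moreover from this have "K \<times> U \<subseteq> {x \<in> topspace (prod_topology Z (weak_top Q)). h x \<in> W}"
        using openin_subset[of Z K] openin_subset[of "weak_top Q" U] by auto
      ultimately show "\<exists>U V. openin Z U \<and> openin (weak_top Q) V \<and> x \<in> U \<and> y \<in> V \<and>
            U \<times> V \<subseteq> {x \<in> topspace (prod_topology Z (weak_top Q)). h x \<in> W}"
        by blast
    qed
  qed
qed

lemma continuous_map_from_weak_top:
  assumes fin: "\<And>u. u \<in> Q \<Longrightarrow> finite {v. u v \<noteq> 0}"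
    and cont: "\<And>A. finite A \<Longrightarrow> continuous_map (part_top Q A) Y h"
  shows "continuous_map (weak_top Q) Y h"
proof -
  \<comment> \<open>A one-point factor turns the product criterion into one for a single
    space.\<close>
  let ?Z = "top_of_set {0::real}"
  have "continuous_map (prod_topology ?Z (weak_top Q)) Y (h \<circ> snd)"
  proof (rule continuous_map_weak_top_prod)
    show "continuous_map (prod_topology ?Z (part_top Q A)) Y (h \<circ> snd)" if "finite A" for A
      by (rule continuous_map_compose[OF continuous_map_snd cont[OF that]])
    show "locally_compact_space ?Z"
      by (rule compact_imp_locally_compact_space) (simp add: compact_space_subtopology)
    show "Hausdorff_space ?Z" by (simp add: Hausdorff_space_subtopology)
  qed (fact fin)
  then have "continuous_map (weak_top Q) Y ((h \<circ> snd) \<circ> (\<lambda>u. (0::real, u)))"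
    by (rule continuous_map_compose[rotated]) (simp add: continuous_map_pairedI)
  then show ?thesis by (simp add: o_def)
qed

lemma continuous_map_part_top_coord: "continuous_map (part_top Q A) euclideanreal (\<lambda>u. u v)"
  using continuous_map_product_projection[of v UNIV "\<lambda>_. euclideanreal"]
  by (simp add: continuous_map_from_subtopology)

lemma continuous_map_weak_top_coord:
  assumes "\<And>u. u \<in> Q \<Longrightarrow> finite {v. u v \<noteq> 0}"
  shows "continuous_map (weak_top Q) euclideanreal (\<lambda>u. u v)"
  using assms continuous_map_part_top_coord by (rule continuous_map_from_weak_top)

lemma continuous_map_part_top_weak_top:
  assumes "finite A"
  shows "continuous_map (part_top Q A) (weak_top Q) (\<lambda>u. u)"
  by (rule continuous_map_into_weak_top_finite[OF _ assms _ continuous_map_part_top_coord])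
    (simp_all add: part_def)

text \<open>On a finite part only coordinates in \<open>A\<close> or in the support of
  \<open>w\<close> can differ, so a possibly infinite family of conditions becomes finite. With
  \<open>w = 0\<close> and \<open>B\<close> the complement of a finite set it bounds all weights
  outside that set at once.\<close>

lemma openin_weak_top_bound:
  assumes fin: "\<And>u. u \<in> Q \<Longrightarrow> finite {v. u v \<noteq> 0}" and w: "finite {v. w v \<noteq> 0}" and e: "0 < e"
  shows "openin (weak_top Q) {u \<in> Q. \<forall>v\<in>B. \<bar>u v - w v\<bar> < e}"
proof -
  have "openin (part_top Q A) ({u \<in> Q. \<forall>v\<in>B. \<bar>u v - w v\<bar> < e} \<inter> part Q A)" if A: "finite A" for A
  proof -
    let ?F = "A \<union> {v. w v \<noteq> 0}"
    have eq: "{u \<in> Q. \<forall>v\<in>B. \<bar>u v - w v\<bar> < e} \<inter> part Q A = part Q A \<inter> (\<Inter>v\<in>?F \<inter> B. {u \<in> topspace (part_top Q A). u v \<in> {w v - e <..< w v + e}})"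
      (is "?L = ?R")
    proof (intro equalityI subsetI)
      fix u assume "u \<in> ?L"
      then show "u \<in> ?R" by (simp add: abs_less_iff algebra_simps)
    next
      fix u assume u: "u \<in> ?R"
      have "\<bar>u v - w v\<bar> < e" if "v \<in> B" for v
      proof (cases "v \<in> ?F")
        case True
        then have "u v \<in> {w v - e <..< w v + e}" using u that by blast
        then show ?thesis by (simp add: abs_less_iff)
      next
        case False
        then show ?thesis using u e by (simp add: part_def)
      qed
      then show "u \<in> ?L" using u by (simp add: part_def)
    qed
    have o: "openin (part_top Q A) {u \<in> topspace (part_top Q A). u v \<in> {w v - e <..< w v + e}}" for v
      using continuous_map_part_top_coord[of Q A v] unfolding continuous_map_def
      by (meson open_greaterThanLessThan open_openin)
    show ?thesis
    proof (cases "?F \<inter> B = {}")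
      case True then show ?thesis unfolding eq True
        using openin_topspace[of "part_top Q A"] by simp
    next
      case False
      then show ?thesis unfolding eq
        using A w o openin_topspace[of "part_top Q A"]
        by (intro openin_Int openin_INT2) auto
    qed
  qed
  then show ?thesis unfolding openin_weak_top by blast
qed

section \<open>Level sets and the realization of a poset of finite sets\<close>

lemma continuous_map_Max:
  assumes "finite K" "\<And>i. i \<in> K \<Longrightarrow> continuous_map Z euclideanreal (h i)"
  shows "continuous_map Z euclideanreal (\<lambda>z. Max (insert b ((\<lambda>i. h i z) ` K)))"
  using assms
proof (induction K)
  case (insert i K)
  have eq: "Max (insert b ((\<lambda>i. h i z) ` insert i K)) = max (h i z) (Max (insert b ((\<lambda>i. h i z) ` K)))" for z
  proof -
    have "insert b ((\<lambda>i. h i z) ` insert i K) = insert (h i z) (insert b ((\<lambda>i. h i z) ` K))" by auto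
    then show ?thesis using insert(1) by (simp del: image_insert)
  qed
  show ?case unfolding eq using insert by (intro continuous_map_real_max) auto
qed simp

lemma continuous_map_Min:
  assumes "finite K" "\<And>i. i \<in> K \<Longrightarrow> continuous_map Z euclideanreal (h i)"
  shows "continuous_map Z euclideanreal (\<lambda>z. Min (insert b ((\<lambda>i. h i z) ` K)))"
  using assms
proof (induction K)
  case (insert i K)
  have eq: "Min (insert b ((\<lambda>i. h i z) ` insert i K)) = min (h i z) (Min (insert b ((\<lambda>i. h i z) ` K)))" for z
  proof -
    have "insert b ((\<lambda>i. h i z) ` insert i K) = insert (h i z) (insert b ((\<lambda>i. h i z) ` K))" by auto
    then show ?thesis using insert(1) by (simp del: image_insert)
  qed
  show ?case unfolding eq using insert by (intro continuous_map_real_min) auto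
qed simp

section \<open>The realization as a weak topology\<close>

lemma openin_realization:
  "openin (realization P leq) U \<longleftrightarrow> U \<subseteq> realization_carrier P leq \<and>
     (\<forall>S \<in> chains_of P leq. openin (subtopology (powertop_real UNIV) (simplex_of S)) (U \<inter> simplex_of S))"
  using istopology_traces[of "realization_carrier P leq" "chains_of P leq" "\<lambda>S. subtopology (powertop_real UNIV) (simplex_of S)" simplex_of]
  by (simp add: realization_def topology_inverse')

lemma closedin_simplex_of: "closedin (powertop_real UNIV) (simplex_of S)"
proof -
  have c: "continuous_on UNIV (\<lambda>\<alpha>::'a \<Rightarrow> real. \<alpha> a)" for a
    by (rule continuous_on_product_coordinates)
  have "closed {\<alpha> :: 'a \<Rightarrow> real. \<forall>a. 0 \<le> \<alpha> a}"
    by (intro closed_Collect_all closed_Collect_le c continuous_on_const)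
  moreover have "closed {\<alpha> :: 'a \<Rightarrow> real. \<forall>a. a \<notin> S \<longrightarrow> \<alpha> a = 0}"
    by (intro closed_Collect_all closed_Collect_imp closed_Collect_eq c continuous_on_const open_Collect_const)
  moreover have "closed {\<alpha> :: 'a \<Rightarrow> real. sum \<alpha> S = 1}"
    by (intro closed_Collect_eq continuous_on_sum c continuous_on_const)
  ultimately have "closed ({\<alpha> :: 'a \<Rightarrow> real. \<forall>a. 0 \<le> \<alpha> a} \<inter> {\<alpha>. \<forall>a. a \<notin> S \<longrightarrow> \<alpha> a = 0} \<inter> {\<alpha>. sum \<alpha> S = 1})"
    by (intro closed_Int)
  also have "{\<alpha> :: 'a \<Rightarrow> real. \<forall>a. 0 \<le> \<alpha> a} \<inter> {\<alpha>. \<forall>a. a \<notin> S \<longrightarrow> \<alpha> a = 0} \<inter> {\<alpha>. sum \<alpha> S = 1} = simplex_of S"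
    by (auto simp: simplex_of_def)
  finally show ?thesis by (simp add: euclidean_product_topology)
qed

text \<open>The points supported in a finite \<open>A\<close> form a union of finitely many closed
  simplices, so a set closed in every simplex is closed in that part. Conversely a simplex lies in
  the part of its own vertices.\<close>

lemma realization_eq_weak_top: "realization P leq = weak_top (realization_carrier P leq)"
proof (rule topology_eq[THEN iffD2], rule allI)
  fix U
  let ?Q = "realization_carrier P leq"
  have "openin (part_top ?Q A) (U \<inter> part ?Q A)"
    if A: "finite A" and U: "U \<subseteq> ?Q"
      and op: "\<And>S. S \<in> chains_of P leq \<Longrightarrow> openin (subtopology (powertop_real UNIV) (simplex_of S)) (U \<inter> simplex_of S)" for A
  proof -
    let ?K = "{S \<in> chains_of P leq. S \<subseteq> A}"
    have "finite ?K" by (rule finite_subset[of _ "Pow A"]) (use A in auto)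
    have part: "part ?Q A = (\<Union>S\<in>?K. simplex_of S)"
    proof (intro equalityI subsetI)
      fix u assume u: "u \<in> part ?Q A"
      then obtain S where S: "S \<in> chains_of P leq" "u \<in> simplex_of S"
        by (auto simp: part_def realization_carrier_def)
      \<comment> \<open>Dropping the vertices outside \<open>A\<close> leaves a chain that still
        carries the whole mass.\<close>
      have "sum u (S \<inter> A) = sum u S"
        using S u by (intro sum.mono_neutral_left) (auto simp: chains_of_def part_def)
      then have "S \<inter> A \<noteq> {}" using S by (auto simp: simplex_of_def)
      then have "S \<inter> A \<in> ?K" using S by (auto simp: chains_of_def)
      moreover have "u \<in> simplex_of (S \<inter> A)"
        using S u \<open>sum u (S \<inter> A) = sum u S\<close> by (auto simp: simplex_of_def part_def)
      ultimately show "u \<in> (\<Union>S\<in>?K. simplex_of S)" by blast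
    next
      fix u assume "u \<in> (\<Union>S\<in>?K. simplex_of S)"
      then show "u \<in> part ?Q A" by (auto simp: part_def realization_carrier_def simplex_of_def)
    qed
    have "closedin (powertop_real UNIV) (simplex_of S - U)" if "S \<in> ?K" for S
    proof -
      have "closedin (subtopology (powertop_real UNIV) (simplex_of S)) (simplex_of S - (U \<inter> simplex_of S))"
        using closedin_diff[OF closedin_topspace op] that by simp
      then show ?thesis
        using closedin_trans_full closedin_simplex_of by (metis Diff_Int2 Diff_Int_distrib Int_commute Diff_cancel Diff_Int Un_empty_right)
    qed
    then have "closedin (powertop_real UNIV) (\<Union>S\<in>?K. simplex_of S - U)"
      using \<open>finite ?K\<close> by (intro closedin_Union) auto
    also have "(\<Union>S\<in>?K. simplex_of S - U) = part ?Q A - U" unfolding part by blast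
    finally have "closedin (part_top ?Q A) (part ?Q A - U)"
      by (metis Diff_subset closedin_subset_topspace)
    then have "openin (part_top ?Q A) (part ?Q A - (part ?Q A - U))"
      using openin_diff[OF openin_topspace] by (metis topspace_part_top)
    then show ?thesis by (simp add: Diff_Diff_Int Int_commute)
  qed
  moreover have "openin (subtopology (powertop_real UNIV) (simplex_of S)) (U \<inter> simplex_of S)"
    if S: "S \<in> chains_of P leq" and op: "\<And>A. finite A \<Longrightarrow> openin (part_top ?Q A) (U \<inter> part ?Q A)" for S
  proof -
    have "finite S" using S by (simp add: chains_of_def)
    then obtain T where T: "openin (powertop_real UNIV) T" "U \<inter> part ?Q S = T \<inter> part ?Q S"
      using op[of S] unfolding openin_subtopology by blast
    have "simplex_of S \<subseteq> part ?Q S"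
      using S by (auto simp: part_def realization_carrier_def simplex_of_def)
    then have "U \<inter> simplex_of S = T \<inter> simplex_of S" using T(2) by blast
    then show ?thesis unfolding openin_subtopology using T(1) by blast
  qed
  ultimately show "openin (realization P leq) U = openin (weak_top ?Q) U"
    unfolding openin_realization openin_weak_top by blast
qed

text \<open>The distribution function of a point of the realization: \<open>u\<close> is determined by its superlevel
  sets, which form a chain, and the coefficient of \<open>a\<close> is the length of the interval of levels
  whose superlevel set is \<open>S a\<close>.\<close>
definition level_model :: "'w set set \<Rightarrow> ('w \<Rightarrow> real) set" where
  "level_model F = {u. (\<forall>v. 0 \<le> u v \<and> u v \<le> 1) \<and> finite {v. u v \<noteq> 0} \<and>
     (\<forall>\<theta>. 0 \<le> \<theta> \<longrightarrow> \<theta> < 1 \<longrightarrow> {v. \<theta> < u v} \<in> F)}"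

locale set_poset =
  fixes P :: "'a set" and leq :: "'a \<Rightarrow> 'a \<Rightarrow> bool" and S :: "'a \<Rightarrow> 'w set"
  assumes finite_S: "a \<in> P \<Longrightarrow> finite (S a)"
    and S_nonempty: "a \<in> P \<Longrightarrow> S a \<noteq> {}"
    and inj_S: "inj_on S P"
    and leq_iff: "a \<in> P \<Longrightarrow> b \<in> P \<Longrightarrow> leq a b \<longleftrightarrow> S a \<subseteq> S b"
begin

abbreviation "L \<equiv> level_model (S ` P)"
abbreviation "R \<equiv> realization_carrier P leq"

section \<open>Barycentric coordinates and distribution functions\<close>

definition coef :: "('w \<Rightarrow> real) \<Rightarrow> 'a \<Rightarrow> real" where
  "coef u a = (if a \<in> P then max 0 (Min (u ` S a) - Max (insert 0 (u ` (- S a)))) else 0)"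

definition height :: "('a \<Rightarrow> real) \<Rightarrow> 'w \<Rightarrow> real" where
  "height y v = (\<Sum>a | a \<in> P \<and> y a \<noteq> 0 \<and> v \<in> S a. y a)"

lemma L_D:
  assumes "u \<in> L"
  shows "0 \<le> u v" "u v \<le> 1" "finite {v. u v \<noteq> 0}" "finite (u ` A)"
    "0 \<le> \<theta> \<Longrightarrow> \<theta> < 1 \<Longrightarrow> \<exists>a\<in>P. {v. \<theta> < u v} = S a"
proof -
  show f: "finite {v. u v \<noteq> 0}" and "0 \<le> u v" "u v \<le> 1"
    using assms by (auto simp: level_model_def)
  have "u ` A \<subseteq> insert 0 (u ` {v. u v \<noteq> 0})" by auto
  then show "finite (u ` A)" using f by (meson finite_imageI finite_insert finite_subset)
  show "0 \<le> \<theta> \<Longrightarrow> \<theta> < 1 \<Longrightarrow> \<exists>a\<in>P. {v. \<theta> < u v} = S a"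
    using assms by (auto simp: level_model_def image_iff)
qed

lemma R_D:
  assumes "y \<in> R"
  obtains C where "finite C" "C \<noteq> {}" "C \<subseteq> P" "\<And>a b. a \<in> C \<Longrightarrow> b \<in> C \<Longrightarrow> S a \<subseteq> S b \<or> S b \<subseteq> S a"
    "\<And>a. 0 \<le> y a" "\<And>a. a \<notin> C \<Longrightarrow> y a = 0" "sum y C = 1"
proof -
  obtain C where C: "C \<in> chains_of P leq" "y \<in> simplex_of C"
    using assms by (auto simp: realization_carrier_def)
  have "S a \<subseteq> S b \<or> S b \<subseteq> S a" if "a \<in> C" "b \<in> C" for a b
    using C(1) that leq_iff[of a b] leq_iff[of b a] unfolding chains_of_def by blast
  then show ?thesis using that[of C] C by (auto simp: chains_of_def simplex_of_def)
qed

lemma ex_min_card: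
  assumes "finite C" "C \<noteq> {}"
  shows "\<exists>m\<in>C. \<forall>b\<in>C. card (S m) \<le> card (S b)"
proof -
  have "Min ((\<lambda>b. card (S b)) ` C) \<in> (\<lambda>b. card (S b)) ` C" using assms by (intro Min_in) auto
  then obtain m where "m \<in> C" "Min ((\<lambda>b. card (S b)) ` C) = card (S m)" by blast
  then show ?thesis using assms by (metis Min_le finite_imageI imageI)
qed

lemma ex_max_card:
  assumes "finite C" "C \<noteq> {}"
  shows "\<exists>m\<in>C. \<forall>b\<in>C. card (S b) \<le> card (S m)"
proof -
  have "Max ((\<lambda>b. card (S b)) ` C) \<in> (\<lambda>b. card (S b)) ` C" using assms by (intro Max_in) auto
  then obtain m where "m \<in> C" "Max ((\<lambda>b. card (S b)) ` C) = card (S m)" by blast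
  then show ?thesis using assms by (metis Max_ge finite_imageI imageI)
qed

lemma finite_support_R: "y \<in> R \<Longrightarrow> finite {a. y a \<noteq> 0}"
  by (erule R_D) (metis (mono_tags, lifting) finite_subset mem_Collect_eq subsetI)

text \<open>A level has superlevel set \<open>S a\<close> exactly when it lies below all values on
  \<open>S a\<close> and not below any value outside. The inserted 0 encodes
  \<open>0 \<le> \<theta>\<close> and covers an empty complement.\<close>

lemma levels_eq:
  assumes u: "u \<in> L" and a: "a \<in> P"
  shows "{\<theta>. 0 \<le> \<theta> \<and> \<theta> < 1 \<and> {v. \<theta> < u v} = S a} = {Max (insert 0 (u ` (- S a))) ..< Min (u ` S a)}"
proof -
  have f: "finite (u ` S a)" "u ` S a \<noteq> {}" "finite (insert 0 (u ` (- S a)))"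
    using L_D(4)[OF u] S_nonempty[OF a] by auto
  have "Max (insert 0 (u ` (- S a))) \<ge> 0" using f by (intro Max_ge) auto
  moreover have "Min (u ` S a) \<le> 1"
    using Min_in[OF f(1,2)] L_D(2)[OF u] by auto
  moreover have "{v. \<theta> < u v} = S a \<longleftrightarrow> (\<forall>v\<in>S a. \<theta> < u v) \<and> (\<forall>v\<in>-S a. u v \<le> \<theta>)" for \<theta>
    by (auto simp: not_le[symmetric])
  moreover have "Max (insert 0 (u ` (- S a))) \<le> \<theta> \<longleftrightarrow> 0 \<le> \<theta> \<and> (\<forall>v\<in>-S a. u v \<le> \<theta>)" for \<theta>
    using f by (subst Max_le_iff) auto
  moreover have "\<theta> < Min (u ` S a) \<longleftrightarrow> (\<forall>v\<in>S a. \<theta> < u v)" for \<theta>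
    using f by (subst Min_gr_iff) auto
  ultimately show ?thesis by (auto; smt (verit))
qed

lemma measure_levels:
  assumes "u \<in> L" "a \<in> P"
  shows "measure lborel {\<theta>. 0 \<le> \<theta> \<and> \<theta> < 1 \<and> {v. \<theta> < u v} = S a} = coef u a"
  using assms by (simp add: levels_eq coef_def measure_lborel_Ico max_def)

lemma coef_nonneg: "0 \<le> coef u a"
  by (simp add: coef_def)

lemma coef_pos_level:
  assumes "u \<in> L" "coef u a \<noteq> 0"
  obtains \<theta> where "a \<in> P" "0 \<le> \<theta>" "\<theta> < 1" "{v. \<theta> < u v} = S a"
proof -
  have a: "a \<in> P" using assms by (auto simp: coef_def split: if_splits)
  then have "{\<theta>. 0 \<le> \<theta> \<and> \<theta> < 1 \<and> {v. \<theta> < u v} = S a} \<noteq> {}"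
    using measure_levels[OF assms(1) a] assms(2) by (metis measure_empty)
  then show ?thesis using that a by blast
qed

lemma coef_support:
  assumes "u \<in> L" "coef u a \<noteq> 0" "v \<in> S a"
  shows "u v \<noteq> 0"
proof -
  obtain \<theta> where "0 \<le> \<theta>" "{v. \<theta> < u v} = S a" by (rule coef_pos_level[OF assms(1,2)])
  then show ?thesis using assms(3) by force
qed

lemma finite_sub: "finite A \<Longrightarrow> finite {a \<in> P. S a \<subseteq> A}"
  by (rule finite_imageD[where f=S]) (auto intro: finite_subset[of _ "Pow A"] inj_on_subset[OF inj_S])

text \<open>Distinct members have disjoint intervals of levels, so summing coefficients amounts to
  measuring a union; this replaces sorting the values of \<open>u\<close>. The case
  \<open>b = 1\<close> gives the total mass, the case \<open>b = u v\<close> gives back the value at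
  \<open>v\<close>.\<close>

lemma sum_measure_levels:
  assumes u: "u \<in> L" and D: "finite D" "D \<subseteq> P" and b: "0 \<le> b"
    and cover: "\<And>\<theta>. 0 \<le> \<theta> \<Longrightarrow> \<theta> < b \<Longrightarrow> \<theta> < 1 \<and> (\<exists>a\<in>D. {v. \<theta> < u v} = S a)"
    and sub: "\<And>a \<theta>. a \<in> D \<Longrightarrow> 0 \<le> \<theta> \<Longrightarrow> \<theta> < 1 \<Longrightarrow> {v. \<theta> < u v} = S a \<Longrightarrow> \<theta> < b"
  shows "(\<Sum>a\<in>D. coef u a) = b"
proof -
  let ?I = "\<lambda>a. {\<theta>. 0 \<le> \<theta> \<and> \<theta> < 1 \<and> {v. \<theta> < u v} = S a}"
  have int: "?I a = {Max (insert 0 (u ` (- S a))) ..< Min (u ` S a)}" if "a \<in> D" for a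
    using levels_eq[OF u] that D by blast
  have "disjoint_family_on ?I D"
    using D inj_S unfolding disjoint_family_on_def inj_on_def by blast
  moreover have "?I a \<in> sets lborel" if "a \<in> D" for a
    by (simp add: int[OF that])
  moreover have "emeasure lborel (?I a) \<noteq> \<infinity>" if "a \<in> D" for a
  proof -
    have "bounded (?I a)" by (rule bounded_subset[of "{0..1}"]) auto
    from emeasure_bounded_finite[OF this] show ?thesis by simp
  qed
  ultimately have "measure lborel (\<Union>a\<in>D. ?I a) = (\<Sum>a\<in>D. measure lborel (?I a))"
    using D(1) by (intro measure_finite_Union) auto
  also have "\<dots> = (\<Sum>a\<in>D. coef u a)"
    using measure_levels[OF u] D by (intro sum.cong) auto
  also have "(\<Union>a\<in>D. ?I a) = {0..<b}"
    using cover sub by (intro equalityI subsetI) auto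
  finally show ?thesis using b by simp
qed

lemma sum_coef:
  assumes u: "u \<in> L"
  shows "(\<Sum>a | a \<in> P \<and> coef u a \<noteq> 0. coef u a) = 1"
    and "height (coef u) v = u v"
    and "finite {a. a \<in> P \<and> coef u a \<noteq> 0}"
proof -
  \<comment> \<open>Superlevel sets at nonnegative levels lie in the support, so only members inside
    the support can have a nonzero coefficient.\<close>
  let ?D = "{a \<in> P. S a \<subseteq> {v. u v \<noteq> 0}}"
  have fin: "finite ?D" using finite_sub L_D(3)[OF u] by blast
  have sub: "{a. a \<in> P \<and> coef u a \<noteq> 0} \<subseteq> ?D" using coef_support[OF u] by auto
  show "finite {a. a \<in> P \<and> coef u a \<noteq> 0}" using fin sub finite_subset by blast
  have inD: "\<exists>a\<in>?D. {v. \<theta> < u v} = S a" if "0 \<le> \<theta>" "\<theta> < 1" for \<theta>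
    using L_D(5)[OF u that] that by force
  have "(\<Sum>a\<in>?D. coef u a) = 1"
    by (rule sum_measure_levels[OF u fin]) (use inD in auto)
  moreover have "(\<Sum>a | a \<in> P \<and> coef u a \<noteq> 0. coef u a) = (\<Sum>a\<in>?D. coef u a)"
    using fin sub by (intro sum.mono_neutral_left) auto
  ultimately show "(\<Sum>a | a \<in> P \<and> coef u a \<noteq> 0. coef u a) = 1" by simp
  have fv: "finite {a \<in> ?D. v \<in> S a}" by (rule finite_subset[OF _ fin]) blast
  have "(\<Sum>a\<in>{a \<in> ?D. v \<in> S a}. coef u a) = u v"
  proof (rule sum_measure_levels[OF u])
    show "\<theta> < 1 \<and> (\<exists>a\<in>{a \<in> ?D. v \<in> S a}. {v. \<theta> < u v} = S a)" if "0 \<le> \<theta>" "\<theta> < u v" for \<theta>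
    proof
      show "\<theta> < 1" using that L_D(2)[OF u, of v] by linarith
      from inD[OF that(1) this] obtain a where a: "a \<in> ?D" "{v. \<theta> < u v} = S a" by (elim bexE)
      have "v \<in> S a" unfolding a(2)[symmetric] using that by simp
      then show "\<exists>a\<in>{a \<in> ?D. v \<in> S a}. {v. \<theta> < u v} = S a" using a by (intro bexI[of _ a]) auto
    qed
  qed (use L_D(1,2)[OF u] fv in auto)
  moreover have "height (coef u) v = (\<Sum>a\<in>{a \<in> ?D. v \<in> S a}. coef u a)"
    unfolding height_def using fv sub by (intro sum.mono_neutral_left) auto
  ultimately show "height (coef u) v = u v" by simp
qed

lemma coef_in_R:
  assumes u: "u \<in> L" shows "coef u \<in> R"
proof -
  let ?C = "{a. a \<in> P \<and> coef u a \<noteq> 0}"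
  have "leq a b \<or> leq b a" if "a \<in> ?C" "b \<in> ?C" for a b
  proof -
    have n: "coef u a \<noteq> 0" "coef u b \<noteq> 0" using that by auto
    obtain \<theta> where "0 \<le> \<theta>" "{v. \<theta> < u v} = S a" by (rule coef_pos_level[OF u n(1)])
    moreover obtain \<eta> where "0 \<le> \<eta>" "{v. \<eta> < u v} = S b" by (rule coef_pos_level[OF u n(2)])
    ultimately have "S a = {v. \<theta> < u v}" "S b = {v. \<eta> < u v}" by auto
    then have "S a \<subseteq> S b \<or> S b \<subseteq> S a"
      by (cases "\<theta> \<le> \<eta>") auto
    then show ?thesis using that leq_iff by blast
  qed
  moreover have "?C \<noteq> {}" using sum_coef(1)[OF u] by (metis sum.empty zero_neq_one)
  ultimately have "?C \<in> chains_of P leq"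
    using sum_coef(3)[OF u] by (auto simp: chains_of_def)
  moreover have "coef u \<in> simplex_of ?C"
    using sum_coef(1)[OF u] by (auto simp: simplex_of_def coef_nonneg) (simp add: coef_def)
  ultimately show ?thesis by (auto simp: realization_carrier_def)
qed

lemma height_eq:
  assumes "finite C" "C \<subseteq> P" "\<And>a. a \<notin> C \<Longrightarrow> y a = 0"
  shows "height y v = (\<Sum>a | a \<in> C \<and> v \<in> S a. y a)"
  unfolding height_def using assms by (intro sum.mono_neutral_left) auto

text \<open>The members of a chain that contain \<open>v\<close> include everything above
  \<open>a\<close> if \<open>v\<close> lies in \<open>S a\<close>; otherwise they all lie strictly
  above \<open>a\<close>.\<close>

lemma height_bounds:
  assumes C: "finite C" "C \<subseteq> P" "\<And>a b. a \<in> C \<Longrightarrow> b \<in> C \<Longrightarrow> S a \<subseteq> S b \<or> S b \<subseteq> S a"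
    "\<And>a. 0 \<le> y a" "\<And>a. a \<notin> C \<Longrightarrow> y a = 0" and a: "a \<in> C"
  shows "v \<in> S a \<Longrightarrow> (\<Sum>b | b \<in> C \<and> S a \<subseteq> S b. y b) \<le> height y v"
    and "v \<notin> S a \<Longrightarrow> height y v \<le> (\<Sum>b | b \<in> C \<and> S a \<subset> S b. y b)"
proof -
  have h: "height y v = (\<Sum>a | a \<in> C \<and> v \<in> S a. y a)" by (rule height_eq[OF C(1,2,5)])
  show "v \<in> S a \<Longrightarrow> (\<Sum>b | b \<in> C \<and> S a \<subseteq> S b. y b) \<le> height y v"
    unfolding h using C by (intro sum_mono2) auto
  show "v \<notin> S a \<Longrightarrow> height y v \<le> (\<Sum>b | b \<in> C \<and> S a \<subset> S b. y b)"
    unfolding h using C a by (intro sum_mono2) auto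
qed

lemma height_in_L:
  assumes "y \<in> R" shows "height y \<in> L"
proof -
  obtain C where C: "finite C" "C \<noteq> {}" "C \<subseteq> P" "\<And>a b. a \<in> C \<Longrightarrow> b \<in> C \<Longrightarrow> S a \<subseteq> S b \<or> S b \<subseteq> S a"
    "\<And>a. 0 \<le> y a" "\<And>a. a \<notin> C \<Longrightarrow> y a = 0" "sum y C = 1" by (rule R_D[OF assms]) blast
  have h: "height y v = (\<Sum>a | a \<in> C \<and> v \<in> S a. y a)" for v by (rule height_eq[OF C(1,3,6)])
  have "0 \<le> height y v" for v unfolding h using C by (intro sum_nonneg) auto
  moreover have "height y v \<le> 1" for v
    unfolding h C(7)[symmetric] using C by (intro sum_mono2) auto
  moreover have "finite {v. height y v \<noteq> 0}"
  proof (rule finite_subset)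
    show "{v. height y v \<noteq> 0} \<subseteq> (\<Union>a\<in>C. S a)"
    proof
      fix v assume "v \<in> {v. height y v \<noteq> 0}"
      then have "(\<Sum>a | a \<in> C \<and> v \<in> S a. y a) \<noteq> 0" by (simp add: h)
      then have "{a. a \<in> C \<and> v \<in> S a} \<noteq> {}" by (metis sum.empty)
      then show "v \<in> (\<Union>a\<in>C. S a)" by blast
    qed
    show "finite (\<Union>a\<in>C. S a)" using C finite_S by blast
  qed
  moreover have "{v. \<theta> < height y v} \<in> S ` P" if th: "0 \<le> \<theta>" "\<theta> < 1" for \<theta>
  proof -
    \<comment> \<open>\<open>?Y a\<close> is the mass at or above \<open>a\<close>. It cannot grow
      along the chain, and the superlevel set at \<open>\<theta>\<close> is the largest member whose
      \<open>?Y\<close> still exceeds \<open>\<theta>\<close>.\<close>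
    let ?Y = "\<lambda>a. \<Sum>b | b \<in> C \<and> S a \<subseteq> S b. y b"
    let ?D = "{a \<in> C. \<theta> < ?Y a}"
    \<comment> \<open>In a chain of finite sets, least cardinality means least element.\<close>
    obtain m where m: "m \<in> C" "\<And>b. b \<in> C \<Longrightarrow> S m \<subseteq> S b"
    proof -
      obtain m where "m \<in> C" "\<forall>b\<in>C. card (S m) \<le> card (S b)"
        using ex_min_card[OF C(1,2)] by blast
      moreover from this have "S m \<subseteq> S b" if "b \<in> C" for b
        using C(3,4) that finite_S by (metis card_seteq in_mono order_refl)
      ultimately show ?thesis using that by blast
    qed
    have "{b. b \<in> C \<and> S m \<subseteq> S b} = C" using m by blast
    then have "m \<in> ?D" using m(1) th C(7) by simp
    have "finite ?D" "?D \<noteq> {}" using C(1) \<open>m \<in> ?D\<close> by (simp, blast)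
    then obtain t where t: "t \<in> ?D" "\<And>b. b \<in> ?D \<Longrightarrow> S b \<subseteq> S t"
    proof -
      obtain t where "t \<in> ?D" "\<forall>b\<in>?D. card (S b) \<le> card (S t)"
        using ex_max_card[OF \<open>finite ?D\<close> \<open>?D \<noteq> {}\<close>] by (elim bexE)
      moreover from this have "S b \<subseteq> S t" if "b \<in> ?D" for b
      proof -
        have tb: "t \<in> C" "b \<in> C" "card (S b) \<le> card (S t)" using that \<open>t \<in> ?D\<close> \<open>\<forall>b\<in>?D. card (S b) \<le> card (S t)\<close> by auto
        then have "finite (S b)" using C(3) finite_S by blast
        then show ?thesis using C(4)[OF tb(1,2)] card_seteq[of "S b" "S t"] tb(3) by auto
      qed
      ultimately show ?thesis using that by blast
    qed
    have "{v. \<theta> < height y v} = S t"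
    proof (intro equalityI subsetI)
      fix v assume "v \<in> S t"
      with t have "?Y t \<le> height y v" by (intro height_bounds(1)[OF C(1,3,4,5,6)]) auto
      then show "v \<in> {v. \<theta> < height y v}" using t by auto
    next
      fix v assume "v \<in> {v. \<theta> < height y v}"
      then have v: "\<theta> < (\<Sum>a | a \<in> C \<and> v \<in> S a. y a)" by (simp add: h)
      then have ne: "{a. a \<in> C \<and> v \<in> S a} \<noteq> {}" using th by (metis sum.empty not_less)
      \<comment> \<open>The members containing \<open>v\<close> are those above the smallest one, so
        the height at \<open>v\<close> equals \<open>?Y n\<close>.\<close>
      obtain n where n: "n \<in> C" "v \<in> S n" "\<And>b. b \<in> C \<Longrightarrow> v \<in> S b \<Longrightarrow> S n \<subseteq> S b"
      proof -
        obtain n where "n \<in> {a. a \<in> C \<and> v \<in> S a}" "\<forall>b\<in>{a. a \<in> C \<and> v \<in> S a}. card (S n) \<le> card (S b)"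
          using ex_min_card[of "{a. a \<in> C \<and> v \<in> S a}"] C(1) ne by auto
        moreover from this have "S n \<subseteq> S b" if "b \<in> C" "v \<in> S b" for b
          proof -
          have tb: "n \<in> C" "v \<in> S n" "card (S n) \<le> card (S b)" using that \<open>n \<in> _\<close> \<open>\<forall>b\<in>_. card (S n) \<le> card (S b)\<close> by auto
          then have "finite (S n)" using C(3) finite_S by blast
          then show ?thesis using C(4)[OF tb(1) that(1)] card_seteq[of "S n" "S b"] tb(3) by auto
        qed
        ultimately show ?thesis using that by blast
      qed
      have "{a. a \<in> C \<and> v \<in> S a} = {b. b \<in> C \<and> S n \<subseteq> S b}" using n by blast
      then have "n \<in> ?D" using v n by simp
      then show "v \<in> S t" using t(2) n(2) by blast
    qed
    then show ?thesis using t C(3) by blast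
  qed
  ultimately show ?thesis by (auto simp: level_model_def)
qed

text \<open>The bounds on heights show that the interval of levels of \<open>a\<close> has length at
  least \<open>y a\<close>. Both families have total 1, so all these inequalities are
  equalities.\<close>

lemma coef_height:
  assumes "y \<in> R" shows "coef (height y) = y"
proof -
  obtain C where C: "finite C" "C \<noteq> {}" "C \<subseteq> P" "\<And>a b. a \<in> C \<Longrightarrow> b \<in> C \<Longrightarrow> S a \<subseteq> S b \<or> S b \<subseteq> S a"
    "\<And>a. 0 \<le> y a" "\<And>a. a \<notin> C \<Longrightarrow> y a = 0" "sum y C = 1" by (rule R_D[OF assms]) blast
  let ?u = "height y"
  have u: "?u \<in> L" by (rule height_in_L[OF assms])
  have ge: "y a \<le> coef ?u a" if a: "a \<in> C" for a
  proof -
    have f: "finite (?u ` S a)" "?u ` S a \<noteq> {}" "finite (insert 0 (?u ` (- S a)))"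
      using L_D(4)[OF u] S_nonempty a C by auto
    let ?A = "\<Sum>b | b \<in> C \<and> S a \<subseteq> S b. y b"
    let ?B = "\<Sum>b | b \<in> C \<and> S a \<subset> S b. y b"
    have "?A \<le> Min (?u ` S a)"
      using f height_bounds(1)[OF C(1,3,4,5,6) a] by (subst Min_ge_iff) auto
    moreover have "0 \<le> ?B" using C by (intro sum_nonneg) auto
    then have "Max (insert 0 (?u ` (- S a))) \<le> ?B"
      using f height_bounds(2)[OF C(1,3,4,5,6) a] by (subst Max_le_iff) auto
    \<comment> \<open>By injectivity \<open>a\<close> is the only member of the chain with the set
      \<open>S a\<close>.\<close>
    moreover have "{b. b \<in> C \<and> S a \<subseteq> S b} = insert a {b. b \<in> C \<and> S a \<subset> S b}"
      using a C(3) inj_S unfolding inj_on_def by blast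
    then have "?A = y a + ?B" using C(1) by (simp add: sum.insert)
    ultimately show ?thesis using a C(3) by (auto simp: coef_def)
  qed
  let ?D = "C \<union> {a. a \<in> P \<and> coef ?u a \<noteq> 0}"
  have D: "finite ?D" "?D \<subseteq> P" using C sum_coef(3)[OF u] by auto
  have "(\<Sum>a\<in>?D. coef ?u a) = 1"
    unfolding sum_coef(1)[OF u, symmetric] using D by (intro sum.mono_neutral_right) auto
  moreover have "(\<Sum>a\<in>?D. y a) = 1"
    unfolding C(7)[symmetric] using D C by (intro sum.mono_neutral_right) auto
  ultimately have s0: "(\<Sum>a\<in>?D. coef ?u a - y a) = 0" by (simp add: sum_subtractf)
  have nn: "0 \<le> coef ?u a - y a" for a
    using ge[of a] coef_nonneg[of ?u a] C(6)[of a] by (cases "a \<in> C") auto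
  have D0: "\<forall>a\<in>?D. coef ?u a - y a = 0"
  proof -
    have "((\<Sum>a\<in>?D. coef ?u a - y a) = 0) = (\<forall>a\<in>?D. coef ?u a - y a = 0)"
      by (rule sum_nonneg_eq_0_iff[OF D(1)]) (rule nn)
    then show ?thesis using s0 by (rule iffD1)
  qed
  show ?thesis
  proof
    fix a
    show "coef ?u a = y a"
    proof (cases "a \<in> ?D")
      case True
      with D0 have "coef ?u a - y a = 0" by (rule bspec)
      then show ?thesis by simp
    next
      case False
      then show ?thesis using C(6)[of a] by (auto simp: coef_def)
    qed
  qed
qed

lemma continuous_map_height: "continuous_map (weak_top R) (weak_top L) height"
proof (rule continuous_map_from_weak_top[OF finite_support_R])
  fix A :: "'a set" assume A: "finite A"
  show "continuous_map (part_top R A) (weak_top L) height"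
  proof (rule continuous_map_into_weak_top_finite)
    show "height z \<in> L" if "z \<in> topspace (part_top R A)" for z
      using that height_in_L by (auto simp: part_def)
    show "finite (\<Union>a\<in>A \<inter> P. S a)" using A finite_S by blast
    have eq: "height y v = (\<Sum>a | a \<in> A \<inter> P \<and> v \<in> S a. y a)" if "y \<in> part R A" for y v
    proof (rule height_eq)
      have "y \<in> R" using that by (simp add: part_def)
      then obtain C where "C \<subseteq> P" "\<And>a. a \<notin> C \<Longrightarrow> y a = 0" by (rule R_D) blast
      then show "y a = 0" if "a \<notin> A \<inter> P" for a
        using \<open>y \<in> part R A\<close> that by (auto simp: part_def)
    qed (use A in auto)
    have "continuous_map (part_top R A) euclideanreal (\<lambda>y. \<Sum>a | a \<in> A \<inter> P \<and> v \<in> S a. y a)" for v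
      using A by (intro continuous_map_sum continuous_map_part_top_coord) auto
    then show "continuous_map (part_top R A) euclideanreal (\<lambda>y. height y v)" for v
      by (rule continuous_map_eq) (simp add: eq)
    fix y v assume y: "y \<in> topspace (part_top R A)" "v \<notin> (\<Union>a\<in>A \<inter> P. S a)"
    then have "height y v = (\<Sum>a | a \<in> A \<inter> P \<and> v \<in> S a. y a)" using eq by simp
    also have "\<dots> = 0" using y(2) by (intro sum.neutral) auto
    finally show "height y v = 0" .
  qed
qed

lemma continuous_map_coef: "continuous_map (weak_top L) (weak_top R) coef"
proof (rule continuous_map_from_weak_top[OF L_D(3)])
  fix A :: "'w set" assume A: "finite A"
  show "continuous_map (part_top L A) (weak_top R) coef"
  proof (rule continuous_map_into_weak_top_finite)
    show "coef z \<in> R" if "z \<in> topspace (part_top L A)" for z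
      using that coef_in_R by (auto simp: part_def)
    show "finite {a \<in> P. S a \<subseteq> A}" by (rule finite_sub[OF A])
    let ?B = "{a \<in> P. S a \<subseteq> A}"
    \<comment> \<open>On one part the extrema run over fixed finite sets: adding 1 is harmless
      because values are at most 1, and outside \<open>A\<close> only the value 0 occurs.\<close>
    have eq: "coef u a = max 0 (Min (insert 1 (u ` S a)) - Max (insert 0 (u ` (A - S a))))"
      if u: "u \<in> part L A" and a: "a \<in> ?B" for u a
    proof -
      have uL: "u \<in> L" using u by (simp add: part_def)
      have "Min (insert 1 (u ` S a)) = Min (u ` S a)"
      proof -
        have f: "finite (u ` S a)" "u ` S a \<noteq> {}" using finite_S S_nonempty a by auto
        have "Min (u ` S a) \<in> u ` S a" using f by (rule Min_in)
        then have "Min (u ` S a) \<le> 1" using L_D(2)[OF uL] by auto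
        then have "min 1 (Min (u ` S a)) = Min (u ` S a)" by (rule min.absorb2)
        then show ?thesis using f by (simp add: Min_insert)
      qed
      moreover have "insert 0 (u ` (- S a)) = insert 0 (u ` (A - S a))"
        using u by (auto simp: part_def)
      ultimately show ?thesis using a by (simp add: coef_def)
    qed
    have "continuous_map (part_top L A) euclideanreal (\<lambda>u. max 0 (Min (insert 1 (u ` S a)) - Max (insert 0 (u ` (A - S a)))))"
      if "a \<in> ?B" for a
      using that A finite_S
      by (intro continuous_map_real_max continuous_map_diff continuous_map_Min continuous_map_Max
          continuous_map_part_top_coord continuous_map_const[THEN iffD2]) auto
    then show "continuous_map (part_top L A) euclideanreal (\<lambda>u. coef u a)" if a: "a \<in> ?B" for a
      by (rule continuous_map_eq[OF _ eq[symmetric]]) (use a in auto)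
    fix u a assume ua: "u \<in> topspace (part_top L A)" "a \<notin> ?B"
    show "coef u a = 0"
    proof (rule ccontr)
      assume n: "coef u a \<noteq> 0"
      have "u \<in> L" using ua by (simp add: part_def)
      then have "a \<in> P" "S a \<subseteq> A"
        using coef_support[OF _ n] coef_pos_level[OF _ n] ua(1) by (auto simp: part_def)
      then show False using ua(2) by blast
    qed
  qed
qed

theorem homeomorphic_maps_level_model:
  "homeomorphic_maps (realization P leq) (weak_top L) height coef"
  unfolding homeomorphic_maps_def realization_eq_weak_top
  using continuous_map_height continuous_map_coef coef_height sum_coef(2) by auto

lemma height_vertex_pt: "a \<in> P \<Longrightarrow> height (vertex_pt a) = (\<lambda>v. if v \<in> S a then 1 else 0)"
proof
  fix v assume a: "a \<in> P"
  have "height (vertex_pt a) v = (\<Sum>b | b \<in> {a} \<and> v \<in> S b. vertex_pt a b)"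
    by (rule height_eq) (use a in \<open>auto simp: vertex_pt_def\<close>)
  also have "\<dots> = (if v \<in> S a then 1 else 0)"
    by (auto simp: vertex_pt_def Collect_conv_if)
  finally show "height (vertex_pt a) v = (if v \<in> S a then 1 else 0)" .
qed

end

section \<open>Loop spaces\<close>

lemma continuous_map_realI:
  assumes "\<And>z e. z \<in> topspace Z \<Longrightarrow> 0 < e \<Longrightarrow>
     \<exists>N. openin Z N \<and> z \<in> N \<and> (\<forall>y\<in>N. \<bar>f y - f z\<bar> < (e::real))"
  shows "continuous_map Z euclideanreal f"
  unfolding continuous_map_def
proof (intro conjI allI impI)
  fix U :: "real set" assume "openin euclideanreal U"
  then have U: "open U" by simp
  show "openin Z {x \<in> topspace Z. f x \<in> U}"
  proof (subst openin_subopen, intro ballI)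
    fix z assume z: "z \<in> {x \<in> topspace Z. f x \<in> U}"
    then obtain e where e: "0 < e" "\<And>y. \<bar>y - f z\<bar> < e \<Longrightarrow> y \<in> U"
      using U unfolding open_dist dist_real_def by blast
    obtain N where N: "openin Z N" "z \<in> N" "\<And>y. y \<in> N \<Longrightarrow> \<bar>f y - f z\<bar> < e"
      using assms[of z e] z e(1) by blast
    have "N \<subseteq> {x \<in> topspace Z. f x \<in> U}"
      using N(3) e(2) openin_subset[OF N(1)] by auto
    then show "\<exists>T. openin Z T \<and> z \<in> T \<and> T \<subseteq> {x \<in> topspace Z. f x \<in> U}" using N by blast
  qed
qed simp

lemma compactin_unit_interval: "compactin unit_interval {0..1}"
  by (simp add: compactin_subtopology)

lemma compact_tube_uniform:
  assumes h: "continuous_map (prod_topology Z unit_interval) euclideanreal h"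
    and z: "z \<in> topspace Z" and e: "0 < (e::real)"
  shows "\<exists>N. openin Z N \<and> z \<in> N \<and> (\<forall>y\<in>N. \<forall>t\<in>{0..1}. \<bar>h (y, t) - h (z, t)\<bar> < e)"
proof -
  let ?P = "prod_topology Z unit_interval"
  let ?d = "\<lambda>p. h p - h (z, snd p)"
  have "continuous_map ?P ?P (\<lambda>p. (z, snd p))"
    using z by (simp add: continuous_map_pairedI continuous_map_snd)
  from continuous_map_compose[OF this h]
  have "continuous_map ?P euclideanreal (\<lambda>p. h (z, snd p))" by (simp add: o_def)
  then have "continuous_map ?P euclideanreal ?d" by (intro continuous_map_diff h)
  moreover have "openin euclideanreal {-e<..<e}" by simp
  ultimately have W: "openin ?P {p \<in> topspace ?P. ?d p \<in> {-e<..<e}}"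
    by (rule openin_continuous_map_preimage)
  have "{z} \<times> {0..1} \<subseteq> {p \<in> topspace ?P. ?d p \<in> {-e<..<e}}" using z e by auto
  from tube_lemma_right[OF W compactin_unit_interval z this]
  obtain N N' where N: "openin Z N" "z \<in> N" "{0..1} \<subseteq> N'" "N \<times> N' \<subseteq> {p \<in> topspace ?P. ?d p \<in> {-e<..<e}}"
    by blast
  have "\<bar>h (y, t) - h (z, t)\<bar> < e" if "y \<in> N" "t \<in> {0..1}" for y t
  proof -
    have "(y, t) \<in> {p \<in> topspace ?P. ?d p \<in> {-e<..<e}}" using that N by blast
    then show ?thesis by (simp add: abs_less_iff)
  qed
  then show ?thesis using N by blast
qed

text \<open>Over a compact interval, nearby parameters give uniformly close functions by the tube
  lemma, and uniform closeness passes to infima.\<close>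

lemma continuous_map_INF_unit_interval:
  assumes h: "continuous_map (prod_topology Z unit_interval) euclideanreal h"
  shows "continuous_map Z euclideanreal (\<lambda>z. INF t\<in>{0..1}. h (z, t))"
proof (rule continuous_map_realI)
  have bdd: "bdd_below ((\<lambda>t. h (z, t)) ` {0..1})" if "z \<in> topspace Z" for z
  proof -
    have "continuous_map unit_interval euclideanreal (h \<circ> (\<lambda>t. (z, t)))"
      by (rule continuous_map_compose[OF _ h]) (use that in \<open>simp add: continuous_map_pairedI\<close>)
    then have "continuous_on {0..1} (\<lambda>t. h (z, t))" by (simp add: o_def)
    then have "compact ((\<lambda>t. h (z, t)) ` {0..1})" by (rule compact_continuous_image) simp
    then show ?thesis by (simp add: compact_imp_bounded bounded_imp_bdd_below)
  qed
  fix z and e :: real assume z: "z \<in> topspace Z" and e: "0 < e"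
  obtain N where N: "openin Z N" "z \<in> N" "\<And>y t. y \<in> N \<Longrightarrow> t \<in> {0..1} \<Longrightarrow> \<bar>h (y, t) - h (z, t)\<bar> < e/2"
    using compact_tube_uniform[OF h z, of "e/2"] e by auto
  have le: "(INF t\<in>{0..1}. h (a, t)) - e/2 \<le> (INF t\<in>{0..1}. h (b, t))"
    if "a \<in> topspace Z" "\<And>t. t \<in> {0..1} \<Longrightarrow> \<bar>h (a, t) - h (b, t)\<bar> < e/2" for a b
  proof (rule cINF_greatest)
    fix t :: real assume t: "t \<in> {0..1}"
    have "(INF t\<in>{0..1}. h (a, t)) \<le> h (a, t)" by (rule cINF_lower[OF bdd[OF that(1)] t])
    then show "(INF t\<in>{0..1}. h (a, t)) - e/2 \<le> h (b, t)" using that(2)[OF t] by linarith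
  qed simp
  have "\<bar>(INF t\<in>{0..1}. h (y, t)) - (INF t\<in>{0..1}. h (z, t))\<bar> < e" if y: "y \<in> N" for y
  proof -
    have "y \<in> topspace Z" using y openin_subset[OF N(1)] by blast
    then show ?thesis
      using le[of y z] le[OF z, of y] N(3)[OF y] e by (auto simp: abs_minus_commute)
  qed
  then show "\<exists>N. openin Z N \<and> z \<in> N \<and> (\<forall>y\<in>N. \<bar>(INF t\<in>{0..1}. h (y, t)) - (INF t\<in>{0..1}. h (z, t))\<bar> < e)"
    using N by blast
qed

section \<open>The compact-open topology on based loops\<close>

lemma topspace_loop_space [simp]: "topspace (loop_space T p) = based_loops T p"
proof -
  have "based_loops T p = {\<gamma> \<in> based_loops T p. \<gamma> ` {} \<subseteq> topspace T}" by simp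
  then have "based_loops T p \<in> {{\<gamma> \<in> based_loops T p. \<gamma> ` K \<subseteq> U} |K U. compactin unit_interval K \<and> openin T U}"
    using compactin_empty openin_topspace by blast
  then show ?thesis unfolding loop_space_def topology_generated_by_topspace by blast
qed

lemma locally_compact_unit_interval: "locally_compact_space unit_interval" "Hausdorff_space unit_interval"
  by (rule compact_imp_locally_compact_space, simp add: compact_space_subtopology)
    (simp add: Hausdorff_space_subtopology)

text \<open>Local compactness of the interval makes evaluation continuous: a compact neighbourhood
  \<open>K\<close> of \<open>t\<close> that the loop carries into \<open>W\<close> gives a subbasic
  open set of loops.\<close>

lemma continuous_map_loop_eval:
  "continuous_map (prod_topology (loop_space T p) unit_interval) T (\<lambda>(\<omega>, t). \<omega> t)"
  unfolding continuous_map_def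
proof (intro conjI allI impI)
  let ?P = "prod_topology (loop_space T p) unit_interval"
  show "(\<lambda>(\<omega>, t). \<omega> t) \<in> topspace ?P \<rightarrow> topspace T"
    using continuous_map_image_subset_topspace by (fastforce simp: based_loops_def)
  fix W assume W: "openin T W"
  show "openin ?P {x \<in> topspace ?P. (case x of (\<omega>, t) \<Rightarrow> \<omega> t) \<in> W}"
  proof (subst openin_prod_topology_alt, intro allI impI)
    fix \<omega> t assume "(\<omega>, t) \<in> {x \<in> topspace ?P. (case x of (\<omega>, t) \<Rightarrow> \<omega> t) \<in> W}"
    then have w: "\<omega> \<in> based_loops T p" "t \<in> {0..1}" "\<omega> t \<in> W" by auto
    then have c: "continuous_map unit_interval T \<omega>" by (simp add: based_loops_def)
    have nb: "neighbourhood_base_of (compactin unit_interval) unit_interval"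
      using locally_compact_unit_interval locally_compact_space_neighbourhood_base by blast
    have op: "openin unit_interval {t \<in> topspace unit_interval. \<omega> t \<in> W}"
      by (rule openin_continuous_map_preimage[OF c W])
    have "t \<in> {t \<in> topspace unit_interval. \<omega> t \<in> W}" using w by simp
    from nb[unfolded neighbourhood_base_of, rule_format, OF conjI[OF op this]] obtain O1 K where K: "openin unit_interval O1" "compactin unit_interval K" "t \<in> O1" "O1 \<subseteq> K"
        "K \<subseteq> {t \<in> topspace unit_interval. \<omega> t \<in> W}"
      by (elim exE conjE)
    let ?U = "{\<gamma> \<in> based_loops T p. \<gamma> ` K \<subseteq> W}"
    have "openin (loop_space T p) ?U"
      unfolding loop_space_def by (rule topology_generated_by_Basis) (use K W in blast)
    moreover have "\<omega> \<in> ?U" using w K by auto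
    moreover have "?U \<times> O1 \<subseteq> {x \<in> topspace ?P. (case x of (\<omega>, t) \<Rightarrow> \<omega> t) \<in> W}"
      using K(4) openin_subset[OF K(1)] by auto
    ultimately show "\<exists>U V. openin (loop_space T p) U \<and> openin unit_interval V \<and> \<omega> \<in> U \<and> t \<in> V \<and>
        U \<times> V \<subseteq> {x \<in> topspace ?P. (case x of (\<omega>, t) \<Rightarrow> \<omega> t) \<in> W}"
      using K by blast
  qed
qed

text \<open>One half of the exponential law, by the tube lemma around \<open>{z} \<times> K\<close>.
  Based loops are total functions on the reals, fixed to \<open>p\<close> outside the interval,
  hence the condition at all such times.\<close>

lemma continuous_map_into_loop_space:
  assumes h: "continuous_map (prod_topology Z unit_interval) T (\<lambda>(z, t). h z t)"
    and b: "\<And>z t. z \<in> topspace Z \<Longrightarrow> t \<le> 0 \<or> 1 \<le> t \<Longrightarrow> h z t = p"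
  shows "continuous_map Z (loop_space T p) h"
proof -
  have hz: "h z \<in> based_loops T p" if z: "z \<in> topspace Z" for z
  proof -
    have "continuous_map unit_interval T ((\<lambda>(z, t). h z t) \<circ> (\<lambda>t. (z, t)))"
      by (rule continuous_map_compose[OF _ h]) (use z in \<open>simp add: continuous_map_pairedI\<close>)
    then show ?thesis using b[OF z] by (auto simp: based_loops_def o_def)
  qed
  show ?thesis
    unfolding loop_space_def continuous_on_generated_topo_iff
  proof (intro conjI allI impI)
    show "h ` topspace Z \<subseteq> \<Union> {{\<gamma> \<in> based_loops T p. \<gamma> ` K \<subseteq> U} |K U. compactin unit_interval K \<and> openin T U}"
      using hz topspace_loop_space[of T p] unfolding loop_space_def topology_generated_by_topspace by auto
    fix B assume "B \<in> {{\<gamma> \<in> based_loops T p. \<gamma> ` K \<subseteq> U} |K U. compactin unit_interval K \<and> openin T U}"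
    then obtain K U where B: "B = {\<gamma> \<in> based_loops T p. \<gamma> ` K \<subseteq> U}" and K: "compactin unit_interval K" and U: "openin T U"
      by blast
    show "openin Z (h -` B \<inter> topspace Z)"
    proof (subst openin_subopen, intro ballI)
      fix z assume z: "z \<in> h -` B \<inter> topspace Z"
      let ?P = "prod_topology Z unit_interval"
      have W: "openin ?P {x \<in> topspace ?P. (case x of (z, t) \<Rightarrow> h z t) \<in> U}"
        by (rule openin_continuous_map_preimage[OF h U])
      have zZ: "z \<in> topspace Z" using z by blast
      have "{z} \<times> K \<subseteq> {x \<in> topspace ?P. (case x of (z, t) \<Rightarrow> h z t) \<in> U}"
        using z B compactin_subset_topspace[OF K] by auto
      from tube_lemma_right[OF W K zZ this]
      obtain N M where N: "openin Z N" "z \<in> N" "K \<subseteq> M" "N \<times> M \<subseteq> {x \<in> topspace ?P. (case x of (z, t) \<Rightarrow> h z t) \<in> U}"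
        by blast
      have "N \<subseteq> h -` B \<inter> topspace Z"
      proof
        fix y assume y: "y \<in> N"
        then have "y \<in> topspace Z" using openin_subset[OF N(1)] by blast
        moreover have "h y t \<in> U" if "t \<in> K" for t
        proof -
          have "(y, t) \<in> N \<times> M" using N(3) y that by blast
          from subsetD[OF N(4) this] show ?thesis by simp
        qed
        ultimately show "y \<in> h -` B \<inter> topspace Z" using hz B by auto
      qed
      then show "\<exists>T. openin Z T \<and> z \<in> T \<and> T \<subseteq> h -` B \<inter> topspace Z" using N by blast
    qed
  qed
qed

lemma continuous_map_loop_eval_compose:
  assumes "continuous_map Z (loop_space T p) f" "continuous_map Z unit_interval g"
  shows "continuous_map Z T (\<lambda>z. f z (g z))"
proof -
  have "continuous_map Z T ((\<lambda>(\<omega>, t). \<omega> t) \<circ> (\<lambda>z. (f z, g z)))"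
    by (rule continuous_map_compose[OF _ continuous_map_loop_eval[of T p]]) (intro continuous_map_pairedI assms)
  then show ?thesis by (simp add: o_def)
qed

lemma continuous_map_uncurry_loop:
  assumes "continuous_map Z (loop_space T p) f"
  shows "continuous_map (prod_topology Z unit_interval) T (\<lambda>(z, t). f z t)"
proof -
  have "continuous_map (prod_topology Z unit_interval) (loop_space T p) (\<lambda>x. f (fst x))"
    by (rule continuous_map_compose[OF continuous_map_fst assms, unfolded o_def])
  from continuous_map_loop_eval_compose[OF this continuous_map_snd]
  show ?thesis by (simp add: case_prod_beta')
qed

lemma continuous_map_loop_space_map:
  assumes "continuous_map T T' f"
  shows "continuous_map (loop_space T p) (loop_space T' (f p)) (\<lambda>\<omega>. f \<circ> \<omega>)"
proof (rule continuous_map_into_loop_space)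
  have "continuous_map (prod_topology (loop_space T p) unit_interval) T' (f \<circ> (\<lambda>(\<omega>, t). \<omega> t))"
    by (rule continuous_map_compose[OF continuous_map_loop_eval assms])
  then show "continuous_map (prod_topology (loop_space T p) unit_interval) T' (\<lambda>(\<omega>, t). (f \<circ> \<omega>) t)"
    by (simp add: o_def case_prod_beta')
  fix \<omega> and t :: real
  assume "\<omega> \<in> topspace (loop_space T p)" "t \<le> 0 \<or> 1 \<le> t"
  then have "\<omega> 0 = p" "\<omega> 1 = p" "t \<notin> {0..1} \<Longrightarrow> \<omega> t = p" "t = 0 \<or> t = 1 \<or> t \<notin> {0..1}"
    by (simp_all add: based_loops_def, linarith)
  then show "(f \<circ> \<omega>) t = f p" by auto
qed

lemma homeomorphic_maps_imp_loop_spaces: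
  assumes fg: "homeomorphic_maps T T' f g" and p: "p \<in> topspace T"
  shows "loop_space T p homeomorphic_space loop_space T' (f p)"
proof -
  have c: "continuous_map T T' f" "continuous_map T' T g" "\<And>x. x \<in> topspace T \<Longrightarrow> g (f x) = x"
      "\<And>x. x \<in> topspace T' \<Longrightarrow> f (g x) = x"
    using fg by (auto simp: homeomorphic_maps_def)
  \<comment> \<open>The inverse identities concern functions on all reals, so times outside the
    interval have to be covered too.\<close>
  have in_top: "\<omega> t \<in> topspace X" if "\<omega> \<in> based_loops X q" "q \<in> topspace X" for \<omega> t X and q :: "'z"
  proof (cases "t \<in> {0..1}")
    case True
    then show ?thesis using that continuous_map_image_subset_topspace by (fastforce simp: based_loops_def)
  next
    case False
    then show ?thesis using that by (auto simp: based_loops_def)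
  qed
  have fp: "f p \<in> topspace T'" using c(1) p by (auto simp: continuous_map_def)
  have "g \<circ> (f \<circ> \<omega>) = \<omega>" if "\<omega> \<in> based_loops T p" for \<omega>
    using in_top[OF that p] c(3) by (auto simp: o_def)
  moreover have "f \<circ> (g \<circ> \<omega>) = \<omega>" if "\<omega> \<in> based_loops T' (f p)" for \<omega>
    using in_top[OF that fp] c(4) by (auto simp: o_def)
  ultimately have "homeomorphic_maps (loop_space T p) (loop_space T' (f p)) (\<lambda>\<omega>. f \<circ> \<omega>) (\<lambda>\<omega>. g \<circ> \<omega>)"
    using continuous_map_loop_space_map[OF c(1), of p] continuous_map_loop_space_map[OF c(2), of "f p"] c(3)[OF p]
    unfolding homeomorphic_maps_def by simp
  then show ?thesis unfolding homeomorphic_space_def by blast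
qed

section \<open>Homotopies of loops relative to the base point\<close>

lemma loop_homotopicI:
  assumes "continuous_map (prod_topology unit_interval unit_interval) T (\<lambda>(s, t). h s t)"
    and "\<And>t. t \<in> {0..1} \<Longrightarrow> h 0 t = \<gamma> t" "\<And>t. t \<in> {0..1} \<Longrightarrow> h 1 t = \<delta> t"
    and "\<And>s. s \<in> {0..1} \<Longrightarrow> h s 0 = p \<and> h s 1 = p"
  shows "loop_homotopic T p \<gamma> \<delta>"
  unfolding loop_homotopic_def
proof (subst homotopic_with)
  show "\<exists>h. continuous_map (prod_topology unit_interval unit_interval) T h \<and>
        (\<forall>x\<in>topspace unit_interval. h (0, x) = \<gamma> x) \<and> (\<forall>x\<in>topspace unit_interval. h (1, x) = \<delta> x) \<and>
        (\<forall>t\<in>{0..1}. h (t, 0) = p \<and> h (t, 1) = p)"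
    using assms by (intro exI[of _ "\<lambda>(s, t). h s t"]) auto
qed auto

lemma loop_homotopicE:
  assumes "loop_homotopic T p \<gamma> \<delta>"
  obtains h where "continuous_map (prod_topology unit_interval unit_interval) T (\<lambda>(s, t). h s t)"
    "\<And>t. h 0 t = \<gamma> t" "\<And>t. h 1 t = \<delta> t"
    "\<And>s. s \<in> {0..1} \<Longrightarrow> h s 0 = p \<and> h s 1 = p"
proof -
  obtain h where "continuous_map (prod_topology unit_interval unit_interval) T h"
      "\<forall>x. h (0, x) = \<gamma> x" "\<forall>x. h (1, x) = \<delta> x" "\<forall>t\<in>{0..1}. h (t, 0) = p \<and> h (t, 1) = p"
    using assms unfolding loop_homotopic_def homotopic_with_def by blast
  then show ?thesis using that[of "\<lambda>s t. h (s, t)"] by simp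
qed

lemma loop_homotopic_sym: "loop_homotopic T p \<gamma> \<delta> \<Longrightarrow> loop_homotopic T p \<delta> \<gamma>"
  unfolding loop_homotopic_def by (rule homotopic_with_symD)

lemma loop_homotopic_trans:
  "loop_homotopic T p \<gamma> \<delta> \<Longrightarrow> loop_homotopic T p \<delta> \<epsilon> \<Longrightarrow> loop_homotopic T p \<gamma> \<epsilon>"
  unfolding loop_homotopic_def by (rule homotopic_with_trans)

lemma loop_homotopic_refl: "\<gamma> \<in> loops_at T p \<Longrightarrow> loop_homotopic T p \<gamma> \<gamma>"
  by (simp add: loop_homotopic_def loops_at_def pathin_def)

lemma loop_homotopic_equal:
  "\<gamma> \<in> loops_at T p \<Longrightarrow> (\<And>t. t \<in> {0..1} \<Longrightarrow> \<gamma> t = \<delta> t) \<Longrightarrow> loop_homotopic T p \<gamma> \<delta>"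
  unfolding loop_homotopic_def
  by (rule homotopic_with_equal) (auto simp: loops_at_def pathin_def)

lemma loop_homotopic_imp_loops_at:
  assumes "loop_homotopic T p \<gamma> \<delta>"
  shows "\<gamma> \<in> loops_at T p" "\<delta> \<in> loops_at T p"
  using homotopic_with_imp_continuous_maps[OF assms[unfolded loop_homotopic_def]]
    homotopic_with_imp_property[OF assms[unfolded loop_homotopic_def]]
  by (auto simp: loops_at_def pathin_def)

lemma loop_homotopic_compose:
  assumes "loop_homotopic T p \<gamma> \<delta>" "continuous_map T T' f"
  shows "loop_homotopic T' (f p) (f \<circ> \<gamma>) (f \<circ> \<delta>)"
  using assms unfolding loop_homotopic_def
  by (rule homotopic_with_compose_continuous_map_left) auto

lemma based_loops_subset_loops_at: "based_loops T p \<subseteq> loops_at T p"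
  by (auto simp: based_loops_def loops_at_def pathin_def)

text \<open>Pasting along \<open>t = 1/2\<close> with a parameter in \<open>Z\<close>, so that
  homotopies can be joined and not only loops.\<close>

lemma continuous_map_join_loops:
  assumes g: "continuous_map (prod_topology Z unit_interval) T (\<lambda>(s, t). g s t)"
    and h: "continuous_map (prod_topology Z unit_interval) T (\<lambda>(s, t). h s t)"
    and eq: "\<And>s. s \<in> topspace Z \<Longrightarrow> g s 1 = h s 0"
  shows "continuous_map (prod_topology Z unit_interval) T (\<lambda>(s, t). join_loops (g s) (h s) t)"
proof -
  let ?P = "prod_topology Z unit_interval"
  have snd: "continuous_map ?P euclideanreal snd"
    using continuous_map_snd continuous_map_into_fulltopology by blast
  let ?P1 = "subtopology ?P {x \<in> topspace ?P. snd x \<le> 1/2}"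
  let ?P2 = "subtopology ?P {x \<in> topspace ?P. 1/2 \<le> snd x}"
  have "continuous_map ?P1 unit_interval (\<lambda>x. 2 * snd x)"
    unfolding continuous_map_in_subtopology
    by (auto intro!: continuous_map_real_mult_left continuous_map_from_subtopology[OF snd])
  then have 1: "continuous_map ?P1 T ((\<lambda>(s, t). g s t) \<circ> (\<lambda>x. (fst x, 2 * snd x)))"
    by (intro continuous_map_compose[OF _ g] continuous_map_pairedI)
      (simp_all add: continuous_map_from_subtopology continuous_map_fst)
  have "continuous_map ?P2 unit_interval (\<lambda>x. 2 * snd x - 1)"
    unfolding continuous_map_in_subtopology
    by (auto intro!: continuous_map_diff continuous_map_real_mult_left continuous_map_from_subtopology[OF snd])
  then have 2: "continuous_map ?P2 T ((\<lambda>(s, t). h s t) \<circ> (\<lambda>x. (fst x, 2 * snd x - 1)))"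
    by (intro continuous_map_compose[OF _ h] continuous_map_pairedI)
      (simp_all add: continuous_map_from_subtopology continuous_map_fst)
  have 3: "((\<lambda>(s, t). g s t) \<circ> (\<lambda>x. (fst x, 2 * snd x))) x = ((\<lambda>(s, t). h s t) \<circ> (\<lambda>x. (fst x, 2 * snd x - 1))) x"
    if "x \<in> topspace ?P" "snd x = 1/2" for x
  proof -
    have "2 * snd x = 1" "2 * snd x - 1 = 0" using that(2) by simp_all
    then show ?thesis using that(1) eq[of "fst x"] by (simp only: o_def case_prod_conv) auto
  qed
  have "continuous_map ?P T (\<lambda>x. if snd x \<le> 1/2 then ((\<lambda>(s, t). g s t) \<circ> (\<lambda>x. (fst x, 2 * snd x))) x
      else ((\<lambda>(s, t). h s t) \<circ> (\<lambda>x. (fst x, 2 * snd x - 1))) x)"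
    by (rule continuous_map_cases_le[OF snd _ 1 2 3]) simp_all
  then show ?thesis by (rule continuous_map_eq) (auto simp: join_loops_def)
qed

lemma loop_homotopic_join:
  assumes "loop_homotopic T p \<gamma> \<gamma>'" "loop_homotopic T p \<delta> \<delta>'"
  shows "loop_homotopic T p (join_loops \<gamma> \<delta>) (join_loops \<gamma>' \<delta>')"
proof -
  obtain g where g: "continuous_map (prod_topology unit_interval unit_interval) T (\<lambda>(s, t). g s t)"
    "\<And>t. g 0 t = \<gamma> t" "\<And>t. g 1 t = \<gamma>' t"
    "\<And>s. s \<in> {0..1} \<Longrightarrow> g s 0 = p \<and> g s 1 = p" by (rule loop_homotopicE[OF assms(1)]) blast
  obtain h where h: "continuous_map (prod_topology unit_interval unit_interval) T (\<lambda>(s, t). h s t)"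
    "\<And>t. h 0 t = \<delta> t" "\<And>t. h 1 t = \<delta>' t"
    "\<And>s. s \<in> {0..1} \<Longrightarrow> h s 0 = p \<and> h s 1 = p" by (rule loop_homotopicE[OF assms(2)]) blast
  show ?thesis
  proof (rule loop_homotopicI[where h="\<lambda>s. join_loops (g s) (h s)"])
    show "continuous_map (prod_topology unit_interval unit_interval) T (\<lambda>(s, t). join_loops (g s) (h s) t)"
      using g(4) h(4) by (intro continuous_map_join_loops g(1) h(1)) auto
  qed (use g h in \<open>auto simp: join_loops_def\<close>)
qed

text \<open>The homotopy is affine in the two time functions. \<open>D\<close> rests at
  \<open>p\<close> on both tails, and the tails are convex, so the end times may differ as long as
  they lie there.\<close>

lemma loop_homotopic_reparametrize:
  assumes D: "continuous_map euclideanreal T D" and lo: "\<And>s. s \<le> lo \<Longrightarrow> D s = p" and hi: "\<And>s. hi \<le> s \<Longrightarrow> D s = p"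
    and x: "continuous_map unit_interval euclideanreal x" "x 0 \<le> lo" "hi \<le> x 1"
    and y: "continuous_map unit_interval euclideanreal y" "y 0 \<le> lo" "hi \<le> y 1"
  shows "loop_homotopic T p (D \<circ> x) (D \<circ> y)"
proof (rule loop_homotopicI[where h="\<lambda>s t. D ((1 - s) * x t + s * y t)"])
  let ?P = "prod_topology unit_interval unit_interval"
  have f: "continuous_map ?P euclideanreal fst" and s: "continuous_map ?P unit_interval snd"
    using continuous_map_fst continuous_map_into_fulltopology continuous_map_snd by blast+
  have "continuous_map ?P euclideanreal (\<lambda>z. (1 - fst z) * x (snd z) + snd z * 0 + fst z * y (snd z))"
    using continuous_map_compose[OF s x(1)] continuous_map_compose[OF s y(1)] f s continuous_map_into_fulltopology[OF s]
    by (intro continuous_map_add continuous_map_real_mult continuous_map_diff) (auto simp: o_def)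
  from continuous_map_compose[OF this D]
  show "continuous_map ?P T (\<lambda>(s, t). D ((1 - s) * x t + s * y t))" by (simp add: o_def case_prod_beta')
  fix s :: real assume s: "s \<in> {0..1}"
  have "(1 - s) * x 0 + s * y 0 \<le> lo" using x(2) y(2) s by (intro convex_bound_le) auto
  moreover have "(1 - s) * (- x 1) + s * (- y 1) \<le> - hi" using x(3) y(3) s by (intro convex_bound_le) auto
  then have "hi \<le> (1 - s) * x 1 + s * y 1" by simp
  ultimately show "D ((1 - s) * x 0 + s * y 0) = p \<and> D ((1 - s) * x 1 + s * y 1) = p" using lo hi by blast
qed auto

text \<open>Currying turns a homotopy relative to the base point into a path in the loop space, and
  back.\<close>

lemma loop_homotopic_iff_path_component:
  assumes "\<gamma> \<in> based_loops T p" "\<delta> \<in> based_loops T p"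
  shows "loop_homotopic T p \<gamma> \<delta> \<longleftrightarrow> path_component_of (loop_space T p) \<gamma> \<delta>"
proof
  assume "loop_homotopic T p \<gamma> \<delta>"
  then obtain h where h: "continuous_map (prod_topology unit_interval unit_interval) T (\<lambda>(s, t). h s t)"
    "\<And>t. h 0 t = \<gamma> t" "\<And>t. h 1 t = \<delta> t"
    "\<And>s. s \<in> {0..1} \<Longrightarrow> h s 0 = p \<and> h s 1 = p" by (rule loop_homotopicE) blast
  \<comment> \<open>The homotopy is arbitrary outside the unit interval, whereas based loops must
    rest at \<open>p\<close> there.\<close>
  let ?g = "\<lambda>s t. if t \<in> {0..1} then h s t else p"
  have "continuous_map unit_interval (loop_space T p) ?g"
  proof (rule continuous_map_into_loop_space)
    show "continuous_map (prod_topology unit_interval unit_interval) T (\<lambda>(s, t). ?g s t)"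
      by (rule continuous_map_eq[OF h(1)]) auto
    show "?g s t = p" if "s \<in> topspace unit_interval" "t \<le> 0 \<or> 1 \<le> t" for s t
    proof -
      have "t \<in> {0..1} \<Longrightarrow> t = 0 \<or> t = 1" using that by auto
      then show ?thesis using h(4)[of s] that by auto
    qed
  qed
  moreover have "?g 0 = \<gamma>" "?g 1 = \<delta>" using h assms by (auto simp: based_loops_def fun_eq_iff)
  ultimately show "path_component_of (loop_space T p) \<gamma> \<delta>"
    unfolding path_component_of_def pathin_def by metis
next
  assume "path_component_of (loop_space T p) \<gamma> \<delta>"
  then obtain g where g: "continuous_map unit_interval (loop_space T p) g" "g 0 = \<gamma>" "g 1 = \<delta>"
    unfolding path_component_of_def pathin_def by blast
  have "g s \<in> based_loops T p" if "s \<in> {0..1}" for s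
    using continuous_map_image_subset_topspace[OF g(1)] that by auto
  then show "loop_homotopic T p \<gamma> \<delta>"
    using g by (intro loop_homotopicI[OF continuous_map_uncurry_loop[OF g(1)]]) (auto simp: based_loops_def)
qed

section \<open>Max-normalised models of the two complexes\<close>

text \<open>Made for families over infinite index sets with finite range. The inserted 0 is neutral
  for nonnegative values, as the inserted 1 in \<open>fmin\<close> is for values at most 1.\<close>

definition fmax :: "('i \<Rightarrow> real) \<Rightarrow> real" where
  "fmax h = Max (insert 0 (range h))"

definition fmin :: "('i \<Rightarrow> real) \<Rightarrow> real" where
  "fmin h = Min (insert 1 (range h))"

lemma finite_range_support: "finite {i. h i \<noteq> b} \<Longrightarrow> finite (range h)"
  by (rule finite_subset[of _ "insert b (h ` {i. h i \<noteq> b})"]) auto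

lemma fmax_ge: "finite (range h) \<Longrightarrow> h i \<le> fmax h"
  unfolding fmax_def by (rule Max_ge) auto

lemma fmax_nonneg: "finite (range h) \<Longrightarrow> 0 \<le> fmax h"
  by (simp add: fmax_def)

lemma fmax_le: "finite (range h) \<Longrightarrow> (\<And>i. h i \<le> b) \<Longrightarrow> 0 \<le> b \<Longrightarrow> fmax h \<le> b"
  by (simp add: fmax_def)

lemma fmax_attained:
  assumes "finite (range h)" "fmax h \<noteq> 0" obtains i where "fmax h = h i"
proof -
  have "fmax h \<in> insert 0 (range h)" unfolding fmax_def using assms(1) by (intro Max_in) auto
  then show ?thesis using assms(2) that by auto
qed

lemma fmax_eq:
  assumes "\<And>i. i \<notin> K \<Longrightarrow> h i = 0" shows "fmax h = Max (insert 0 (h ` K))"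
proof -
  have "insert 0 (range h) = insert 0 (h ` K)" using assms by auto
  then show ?thesis by (simp add: fmax_def)
qed

lemma fmin_le: "finite (range h) \<Longrightarrow> fmin h \<le> h i"
  unfolding fmin_def by (rule Min_le) auto

lemma fmin_ge: "finite (range h) \<Longrightarrow> (\<And>i. b \<le> h i) \<Longrightarrow> b \<le> 1 \<Longrightarrow> b \<le> fmin h"
  by (simp add: fmin_def)

lemma fmin_eq:
  assumes "\<And>i. i \<notin> K \<Longrightarrow> h i = 1" shows "fmin h = Min (insert 1 (h ` K))"
proof -
  have "insert 1 (range h) = insert 1 (h ` K)" using assms by auto
  then show ?thesis by (simp add: fmin_def)
qed

definition kap :: "real \<Rightarrow> real" where
  "kap s = max 0 (min 1 (3 - 2 * \<bar>s\<bar>))"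

lemma kap_bounds: "0 \<le> kap s" "kap s \<le> 1"
  by (auto simp: kap_def)

lemma kap_eq_1: "\<bar>s\<bar> \<le> 1 \<Longrightarrow> kap s = 1"
  by (simp add: kap_def)

lemma kap_nonzero: "kap s \<noteq> 0 \<longleftrightarrow> \<bar>s\<bar> < 3/2"
  by (auto simp: kap_def max_def min_def)

text \<open>A path between points with max-norm 1 that keeps the max-norm equal to 1 and
  whose support is at most the union of the supports.\<close>
definition trop :: "real \<Rightarrow> real \<Rightarrow> real \<Rightarrow> real" where
  "trop l a b = max (min 1 (2 - 2 * l) * a) (min 1 (2 * l) * b)"

lemma trop_0: "0 \<le> a \<Longrightarrow> 0 \<le> b \<Longrightarrow> trop 0 a b = a"
  by (simp add: trop_def)

lemma trop_1: "0 \<le> a \<Longrightarrow> 0 \<le> b \<Longrightarrow> trop 1 a b = b"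
  by (simp add: trop_def)

lemma trop_zero: "trop l 0 0 = 0"
  by (simp add: trop_def)

lemma trop_idem: "0 \<le> a \<Longrightarrow> 0 \<le> l \<Longrightarrow> l \<le> 1 \<Longrightarrow> trop l a a = a"
proof -
  assume a: "0 \<le> a" "0 \<le> l" "l \<le> 1"
  have "min 1 (2 - 2 * l) * a \<le> 1 * a" "min 1 (2 * l) * a \<le> 1 * a"
    using a by (intro mult_right_mono; simp)+
  moreover have "min 1 (2 - 2 * l) = 1 \<or> min 1 (2 * l) = 1" by auto
  ultimately show ?thesis unfolding trop_def by (auto simp: max_def)
qed

lemma trop_bounds:
  assumes "0 \<le> a" "a \<le> 1" "0 \<le> b" "b \<le> 1" "0 \<le> l" "l \<le> 1"
  shows "0 \<le> trop l a b" "trop l a b \<le> 1"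
proof -
  have "0 \<le> min 1 (2 - 2 * l) * a" using assms by (intro mult_nonneg_nonneg) auto
  then show "0 \<le> trop l a b" by (simp add: trop_def max_def)
  have "min 1 (2 - 2 * l) * a \<le> 1 * 1" "min 1 (2 * l) * b \<le> 1 * 1"
    using assms by (intro mult_mono; simp)+
  then show "trop l a b \<le> 1" by (simp add: trop_def)
qed

lemma trop_eq_1:
  assumes "0 \<le> l" "l \<le> 1"
  shows "(l \<le> 1/2 \<and> a = 1 \<and> 0 \<le> b \<and> b \<le> 1) \<or> (1/2 \<le> l \<and> b = 1 \<and> 0 \<le> a \<and> a \<le> 1) \<Longrightarrow> trop l a b = 1"
proof -
  assume "(l \<le> 1/2 \<and> a = 1 \<and> 0 \<le> b \<and> b \<le> 1) \<or> (1/2 \<le> l \<and> b = 1 \<and> 0 \<le> a \<and> a \<le> 1)"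
  moreover have "min 1 (2 - 2 * l) * a \<le> 1 * 1" if "0 \<le> a" "a \<le> 1"
    using assms that by (intro mult_mono) auto
  moreover have "min 1 (2 * l) * b \<le> 1 * 1" if "0 \<le> b" "b \<le> 1"
    using assms that by (intro mult_mono) auto
  ultimately show ?thesis by (auto simp: trop_def max_def)
qed

lemma continuous_map_trop:
  assumes "continuous_map Z euclideanreal l" "continuous_map Z euclideanreal a" "continuous_map Z euclideanreal b"
  shows "continuous_map Z euclideanreal (\<lambda>z. trop (l z) (a z) (b z))"
  unfolding trop_def using assms
  by (intro continuous_map_real_max continuous_map_real_mult continuous_map_real_min continuous_map_diff
      continuous_map_real_mult_left) auto

locale based_bigraph =
  fixes V :: "'v set" and E :: "('v \<times> 'v) set" and c :: "'v \<Rightarrow> nat" and x0 x1 :: 'v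
  assumes based: "is_based_bigraph V E c x0 x1"
begin

abbreviation "Om \<equiv> omega_vertices V E c x0 x1"
abbreviation "Ed \<equiv> omega_edges V E c x0 x1"

definition par :: "int \<Rightarrow> nat" where "par k = nat (k mod 2)"
definition base :: "int \<Rightarrow> 'v" where "base k = (if even k then x0 else x1)"
text \<open>The distribution function of the vertex \<open>({x0}, {x1})\<close> of the box
  complex.\<close>

definition bpt :: "'v \<Rightarrow> real" where "bpt v = (if v = x0 \<or> v = x1 then 1 else 0)"

lemma E_sym: "(a, b) \<in> E \<Longrightarrow> (b, a) \<in> E"
  and E_V: "(a, b) \<in> E \<Longrightarrow> a \<in> V" "(a, b) \<in> E \<Longrightarrow> b \<in> V"
  using based unfolding is_based_bigraph_def is_bigraph_def is_graph_def by blast+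

lemma E_col: "(a, b) \<in> E \<Longrightarrow> c a \<noteq> c b"
  using based unfolding is_based_bigraph_def is_bigraph_def by fastforce

lemma col: "a \<in> V \<Longrightarrow> c a = 0 \<or> c a = 1"
  using based unfolding is_based_bigraph_def is_bigraph_def by blast

lemma x01: "x0 \<in> V" "x1 \<in> V" "c x0 = 0" "c x1 = 1" "(x0, x1) \<in> E" "(x1, x0) \<in> E" "x0 \<noteq> x1"
  using based unfolding is_based_bigraph_def by auto

lemma par_eq: "par k = (if even k then 0 else 1)"
  by (auto simp: par_def elim: oddE)

lemma base_props: "base k \<in> V" "c (base k) = par k" "(base k, base (k + 1)) \<in> E" "bpt (base k) = 1"
  using x01 by (auto simp: base_def par_eq bpt_def)

text \<open>By symmetry of \<open>E\<close>, edges need only be checked between consecutive indices,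
  and the tail condition on pairs \<open>2 * k\<close>, \<open>2 * k + 1\<close> becomes agreement
  with \<open>base\<close> far out.\<close>

lemma Om_iff: "\<gamma> \<in> Om \<longleftrightarrow> (\<forall>k. \<gamma> k \<in> V \<and> c (\<gamma> k) = par k \<and> (\<gamma> k, \<gamma> (k + 1)) \<in> E) \<and>
    (\<exists>N. \<forall>k. N \<le> \<bar>k\<bar> \<longrightarrow> \<gamma> k = base k)"
proof -
  have 1: "(\<forall>a b. \<bar>a - b\<bar> = 1 \<longrightarrow> (\<gamma> a, \<gamma> b) \<in> E) \<longleftrightarrow> (\<forall>k. (\<gamma> k, \<gamma> (k + 1)) \<in> E)" for \<gamma> :: "int \<Rightarrow> 'v"
  proof (intro iffI allI impI)
    fix a b :: int assume h: "\<forall>k. (\<gamma> k, \<gamma> (k + 1)) \<in> E" "\<bar>a - b\<bar> = 1"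
    then have "b = a + 1 \<or> a = b + 1" by linarith
    then show "(\<gamma> a, \<gamma> b) \<in> E" using h(1) E_sym by blast
  qed auto
  have 2: "(\<exists>N. \<forall>k. N \<le> \<bar>k\<bar> \<longrightarrow> \<gamma> (2 * k) = x0 \<and> \<gamma> (2 * k + 1) = x1) \<longleftrightarrow> (\<exists>N. \<forall>k. N \<le> \<bar>k\<bar> \<longrightarrow> \<gamma> k = base k)"
    (is "?A \<longleftrightarrow> ?B")
  proof
    assume ?A
    then obtain N where N: "\<And>k. N \<le> \<bar>k\<bar> \<Longrightarrow> \<gamma> (2 * k) = x0 \<and> \<gamma> (2 * k + 1) = x1" by blast
    \<comment> \<open>Here \<open>k\<close> is \<open>2 * j\<close> or \<open>2 * j + 1\<close>, and
      the bound forces \<open>\<bar>j\<bar> \<ge> \<bar>N\<bar>\<close>.\<close>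
    have "\<gamma> k = base k" if "2 * \<bar>N\<bar> + 2 \<le> \<bar>k\<bar>" for k
    proof (cases "even k")
      case True
      then obtain j where "k = 2 * j" by blast
      then show ?thesis using N[of j] that by (auto simp: base_def)
    next
      case False
      then obtain j where "k = 2 * j + 1" by (auto elim: oddE)
      then show ?thesis using N[of j] that by (auto simp: base_def)
    qed
    then show ?B by blast
  next
    assume ?B
    then obtain N where N: "\<And>k. N \<le> \<bar>k\<bar> \<Longrightarrow> \<gamma> k = base k" by blast
    have "\<gamma> (2 * k) = x0 \<and> \<gamma> (2 * k + 1) = x1" if "\<bar>N\<bar> + 1 \<le> \<bar>k\<bar>" for k
      using N[of "2 * k"] N[of "2 * k + 1"] that by (auto simp: base_def)
    then show ?A by blast
  qed
  show ?thesis unfolding omega_vertices_def mem_Collect_eq 1 2 par_def by blast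
qed

lemma Ed_iff: "(\<gamma>, \<gamma>') \<in> Ed \<longleftrightarrow> \<gamma> \<in> Om \<and> \<gamma>' \<in> Om \<and> (\<forall>k. (\<gamma> k, \<gamma>' (k + 1)) \<in> E \<and> (\<gamma>' k, \<gamma> (k + 1)) \<in> E)"
proof -
  have "(\<forall>a b. \<bar>a - b\<bar> = 1 \<longrightarrow> (\<gamma> a, \<gamma>' b) \<in> E) \<longleftrightarrow> (\<forall>k. (\<gamma> k, \<gamma>' (k + 1)) \<in> E \<and> (\<gamma>' k, \<gamma> (k + 1)) \<in> E)"
  proof (intro iffI allI impI)
    fix a b :: int assume h: "\<forall>k. (\<gamma> k, \<gamma>' (k + 1)) \<in> E \<and> (\<gamma>' k, \<gamma> (k + 1)) \<in> E" "\<bar>a - b\<bar> = 1"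
    then have "b = a + 1 \<or> a = b + 1" by linarith
    then show "(\<gamma> a, \<gamma>' b) \<in> E" using h(1) E_sym by blast
  next
    fix k :: int assume h: "\<forall>a b. \<bar>a - b\<bar> = 1 \<longrightarrow> (\<gamma> a, \<gamma>' b) \<in> E"
    then have "(\<gamma> k, \<gamma>' (k + 1)) \<in> E" "(\<gamma> (k + 1), \<gamma>' k) \<in> E" by auto
    then show "(\<gamma> k, \<gamma>' (k + 1)) \<in> E \<and> (\<gamma>' k, \<gamma> (k + 1)) \<in> E" using E_sym by blast
  qed
  then show ?thesis by (simp add: omega_edges_def)
qed

section \<open>Clique points, points of the box complex, and sequences between them\<close>

text \<open>\<open>par k\<close> runs through both colours. Normalising each colour separately
  records that both sets of a pair in the box complex are nonempty at every level.\<close>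

definition MB :: "('v \<Rightarrow> real) set" where
  "MB = {q. (\<forall>v. 0 \<le> q v \<and> q v \<le> 1) \<and> finite {v. q v \<noteq> 0} \<and> (\<forall>v. q v \<noteq> 0 \<longrightarrow> v \<in> V) \<and>
     (\<forall>a b. q a \<noteq> 0 \<longrightarrow> q b \<noteq> 0 \<longrightarrow> c a \<noteq> c b \<longrightarrow> (a, b) \<in> E) \<and> (\<forall>k. \<exists>v. c v = par k \<and> q v = 1)}"

definition MC :: "((int \<Rightarrow> 'v) \<Rightarrow> real) set" where
  "MC = {u. (\<forall>\<gamma>. 0 \<le> u \<gamma> \<and> u \<gamma> \<le> 1) \<and> finite {\<gamma>. u \<gamma> \<noteq> 0} \<and>
     (\<forall>\<gamma> \<gamma>'. u \<gamma> \<noteq> 0 \<longrightarrow> u \<gamma>' \<noteq> 0 \<longrightarrow> (\<gamma>, \<gamma>') \<in> Ed) \<and> (\<exists>\<gamma>. u \<gamma> = 1)}"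

text \<open>The intermediate object of both constructions: \<open>marg\<close> arrives here from
  clique points and \<open>wind\<close> from loops, while \<open>prodpt\<close> and
  \<open>line\<close> lead on to clique points and to points of the box complex.\<close>

definition SQ :: "(int \<Rightarrow> 'v \<Rightarrow> real) set" where
  "SQ = {p. (\<forall>k v. 0 \<le> p k v \<and> p k v \<le> 1) \<and> (\<forall>k v. p k v \<noteq> 0 \<longrightarrow> v \<in> V \<and> c v = par k) \<and>
     (\<forall>k. finite {v. p k v \<noteq> 0}) \<and> (\<forall>k. \<exists>v. p k v = 1) \<and>
     (\<forall>k a b. p k a \<noteq> 0 \<longrightarrow> p (k + 1) b \<noteq> 0 \<longrightarrow> (a, b) \<in> E) \<and>
     (\<exists>N. \<forall>k v. N \<le> \<bar>k\<bar> \<longrightarrow> p k v = (if v = base k then 1 else 0))}"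

lemma MB_D:
  assumes "q \<in> MB"
  shows "0 \<le> q v" "q v \<le> 1" "finite {v. q v \<noteq> 0}" "q v \<noteq> 0 \<Longrightarrow> v \<in> V"
    "q a \<noteq> 0 \<Longrightarrow> q b \<noteq> 0 \<Longrightarrow> c a \<noteq> c b \<Longrightarrow> (a, b) \<in> E" "\<exists>v. c v = par k \<and> q v = 1"
  using assms unfolding MB_def by blast+

lemma MC_D:
  assumes "u \<in> MC"
  shows "0 \<le> u \<gamma>" "u \<gamma> \<le> 1" "finite {\<gamma>. u \<gamma> \<noteq> 0}" "u \<gamma> \<noteq> 0 \<Longrightarrow> \<gamma> \<in> Om"
    "u \<gamma> \<noteq> 0 \<Longrightarrow> u \<gamma>' \<noteq> 0 \<Longrightarrow> (\<gamma>, \<gamma>') \<in> Ed" "\<exists>\<gamma>. u \<gamma> = 1"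
  using assms unfolding MC_def using Ed_iff by blast+

lemma SQ_D:
  assumes "p \<in> SQ"
  shows "0 \<le> p k v" "p k v \<le> 1" "p k v \<noteq> 0 \<Longrightarrow> v \<in> V" "p k v \<noteq> 0 \<Longrightarrow> c v = par k" "finite {v. p k v \<noteq> 0}"
    "\<exists>v. p k v = 1" "p k a \<noteq> 0 \<Longrightarrow> p (k + 1) b \<noteq> 0 \<Longrightarrow> (a, b) \<in> E"
    "\<exists>N. \<forall>k v. N \<le> \<bar>k\<bar> \<longrightarrow> p k v = (if v = base k then 1 else 0)"
  using assms unfolding SQ_def by blast+

lemma bpt_in_MB: "bpt \<in> MB"
  unfolding MB_def mem_Collect_eq
proof (intro conjI allI impI)
  show "finite {v. bpt v \<noteq> 0}" by (rule finite_subset[of _ "{x0, x1}"]) (auto simp: bpt_def)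
  show "\<exists>v. c v = par k \<and> bpt v = 1" for k using base_props by blast
qed (use x01 in \<open>auto simp: bpt_def split: if_splits\<close>)

definition marg :: "((int \<Rightarrow> 'v) \<Rightarrow> real) \<Rightarrow> int \<Rightarrow> 'v \<Rightarrow> real" where
  "marg u k v = fmax (\<lambda>\<gamma>. if \<gamma> k = v then u \<gamma> else 0)"

definition prodpt :: "(int \<Rightarrow> 'v \<Rightarrow> real) \<Rightarrow> (int \<Rightarrow> 'v) \<Rightarrow> real" where
  "prodpt p \<gamma> = fmin (\<lambda>k. p k (\<gamma> k))"

definition line :: "(int \<Rightarrow> 'v \<Rightarrow> real) \<Rightarrow> real \<Rightarrow> 'v \<Rightarrow> real" where
  "line p s v = fmax (\<lambda>k. kap (s - of_int k) * p k v)"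

lemma finite_range_marg:
  assumes "finite {\<gamma>. u \<gamma> \<noteq> 0}"
  shows "finite (range (\<lambda>\<gamma>. if \<gamma> k = v then u \<gamma> else 0))"
  by (rule finite_range_support[of _ 0]) (rule finite_subset[OF _ assms], auto)

lemma marg_ge: "u \<in> MC \<Longrightarrow> u \<gamma> \<le> marg u k (\<gamma> k)"
  using fmax_ge[OF finite_range_marg[OF MC_D(3)], of u \<gamma> k "\<gamma> k"] by (simp add: marg_def)

lemma marg_nonzero:
  assumes "u \<in> MC" "marg u k v \<noteq> 0"
  obtains \<gamma> where "u \<gamma> \<noteq> 0" "\<gamma> k = v" "marg u k v = u \<gamma>"
proof -
  obtain \<gamma> where "marg u k v = (if \<gamma> k = v then u \<gamma> else 0)"
    by (rule fmax_attained[OF finite_range_marg[OF MC_D(3)[OF assms(1)]] assms(2)[unfolded marg_def], folded marg_def])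
  then show ?thesis using that assms(2) by (auto split: if_splits)
qed

lemma Om_uniform_bound:
  assumes "finite A"
  shows "\<exists>N\<ge>0. \<forall>\<gamma>\<in>A \<inter> Om. \<forall>k. N \<le> \<bar>k\<bar> \<longrightarrow> \<gamma> k = base k"
  using assms
proof (induction A)
  case (insert \<gamma> A)
  then obtain N where N: "N \<ge> 0" "\<forall>\<gamma>\<in>A \<inter> Om. \<forall>k. N \<le> \<bar>k\<bar> \<longrightarrow> \<gamma> k = base k" by blast
  show ?case
  proof (cases "\<gamma> \<in> Om")
    case True
    then obtain M where "\<forall>k. M \<le> \<bar>k\<bar> \<longrightarrow> \<gamma> k = base k" using Om_iff by blast
    then show ?thesis using N by (intro exI[of _ "max M N"]) auto
  qed (use N in auto)
qed auto

lemma marg_bound: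
  assumes u: "u \<in> MC" and N: "\<And>\<gamma>. u \<gamma> \<noteq> 0 \<Longrightarrow> \<gamma> k = base k"
  shows "marg u k v = (if v = base k then 1 else 0)"
proof -
  obtain \<gamma> where g: "u \<gamma> = 1" using MC_D(6)[OF u] by blast
  have le: "marg u k v \<le> 1"
    unfolding marg_def by (rule fmax_le[OF finite_range_marg[OF MC_D(3)[OF u]]]) (auto simp: MC_D[OF u])
  show ?thesis
  proof (cases "v = base k")
    case True
    then show ?thesis using marg_ge[OF u, of \<gamma> k] g N[of \<gamma>] le by auto
  next
    case False
    then have "marg u k v = 0" using marg_nonzero[OF u] N by metis
    then show ?thesis using False by simp
  qed
qed

lemma marg_in_SQ:
  assumes u: "u \<in> MC" shows "marg u \<in> SQ"
  unfolding SQ_def mem_Collect_eq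
proof (intro conjI allI impI)
  note fin = finite_range_marg[OF MC_D(3)[OF u]]
  fix k v
  show "0 \<le> marg u k v" unfolding marg_def by (rule fmax_nonneg[OF fin])
  show le: "marg u k v \<le> 1" for k v unfolding marg_def by (rule fmax_le[OF fin]) (auto simp: MC_D[OF u])
  have "{v. marg u k v \<noteq> 0} \<subseteq> (\<lambda>\<gamma>. \<gamma> k) ` {\<gamma>. u \<gamma> \<noteq> 0}" using marg_nonzero[OF u] by blast
  then show "finite {v. marg u k v \<noteq> 0}" using MC_D(3)[OF u] finite_surj by blast
  obtain \<gamma> where "u \<gamma> = 1" using MC_D(6)[OF u] by blast
  then show "\<exists>v. marg u k v = 1" using marg_ge[OF u, of \<gamma> k] le[of k "\<gamma> k"] by (intro exI[of _ "\<gamma> k"]) linarith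
next
  fix k v assume "marg u k v \<noteq> 0"
  then obtain \<gamma> where "u \<gamma> \<noteq> 0" "\<gamma> k = v" by (rule marg_nonzero[OF u])
  then show "v \<in> V" "c v = par k" using MC_D(4)[OF u] Om_iff by blast+
next
  fix k a b assume "marg u k a \<noteq> 0" "marg u (k + 1) b \<noteq> 0"
  then obtain \<gamma> \<gamma>' where "u \<gamma> \<noteq> 0" "\<gamma> k = a" "u \<gamma>' \<noteq> 0" "\<gamma>' (k + 1) = b" using marg_nonzero[OF u] by metis
  then show "(a, b) \<in> E" using MC_D(5)[OF u] Ed_iff by blast
next
  obtain N where "\<forall>\<gamma>\<in>{\<gamma>. u \<gamma> \<noteq> 0} \<inter> Om. \<forall>k. N \<le> \<bar>k\<bar> \<longrightarrow> \<gamma> k = base k"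
    using Om_uniform_bound[OF MC_D(3)[OF u]] by blast
  then show "\<exists>N. \<forall>k v. N \<le> \<bar>k\<bar> \<longrightarrow> marg u k v = (if v = base k then 1 else 0)"
    using marg_bound[OF u] MC_D(4)[OF u] by (intro exI[of _ N]) blast
qed

lemma finite_range_prodpt:
  assumes "p \<in> SQ" shows "finite (range (\<lambda>k. p k (\<gamma> k)))"
proof -
  obtain N where N: "\<forall>k v. N \<le> \<bar>k\<bar> \<longrightarrow> p k v = (if v = base k then 1 else 0)" using SQ_D(8)[OF assms] by blast
  have "range (\<lambda>k. p k (\<gamma> k)) \<subseteq> insert 0 (insert 1 ((\<lambda>k. p k (\<gamma> k)) ` {-\<bar>N\<bar>..\<bar>N\<bar>}))"
  proof
    fix y assume "y \<in> range (\<lambda>k. p k (\<gamma> k))"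
    then obtain k where y: "y = p k (\<gamma> k)" by blast
    show "y \<in> insert 0 (insert 1 ((\<lambda>k. p k (\<gamma> k)) ` {-\<bar>N\<bar>..\<bar>N\<bar>}))"
    proof (cases "N \<le> \<bar>k\<bar>")
      case True
      then show ?thesis using N y by simp
    next
      case False
      then have "k \<in> {-\<bar>N\<bar>..\<bar>N\<bar>}" by auto
      then show ?thesis using y by blast
    qed
  qed
  then show ?thesis by (rule finite_subset) simp
qed

lemma prodpt_le: "p \<in> SQ \<Longrightarrow> prodpt p \<gamma> \<le> p k (\<gamma> k)"
  unfolding prodpt_def by (rule fmin_le[OF finite_range_prodpt])

lemma prodpt_ge: "p \<in> SQ \<Longrightarrow> (\<And>k. b \<le> p k (\<gamma> k)) \<Longrightarrow> b \<le> 1 \<Longrightarrow> b \<le> prodpt p \<gamma>"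
  unfolding prodpt_def by (rule fmin_ge[OF finite_range_prodpt])

lemma prodpt_bounds: "p \<in> SQ \<Longrightarrow> 0 \<le> prodpt p \<gamma>" "p \<in> SQ \<Longrightarrow> prodpt p \<gamma> \<le> 1"
  using prodpt_ge[of p 0 \<gamma>] SQ_D(1)[of p] prodpt_le[of p \<gamma> 0] SQ_D(2)[of p 0 "\<gamma> 0"] by auto

lemma prodpt_nonzero: "p \<in> SQ \<Longrightarrow> prodpt p \<gamma> \<noteq> 0 \<Longrightarrow> p k (\<gamma> k) \<noteq> 0"
  using prodpt_le[of p \<gamma> k] prodpt_bounds[of p \<gamma>] by linarith

text \<open>Only the coordinates with \<open>\<bar>k\<bar> \<le> \<bar>N\<bar>\<close> are free,
  each with finitely many values. This is what makes the support of \<open>prodpt\<close>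
  finite.\<close>

lemma finite_sections:
  assumes "\<And>k. finite (A k)"
  shows "finite {\<gamma> :: int \<Rightarrow> 'v. (\<forall>k. \<gamma> k \<in> A k) \<and> (\<forall>k. N \<le> \<bar>k\<bar> \<longrightarrow> \<gamma> k = base k)}"
proof (rule finite_subset)
  let ?I = "{-\<bar>N\<bar>..\<bar>N\<bar>}"
  show "{\<gamma>. (\<forall>k. \<gamma> k \<in> A k) \<and> (\<forall>k. N \<le> \<bar>k\<bar> \<longrightarrow> \<gamma> k = base k)} \<subseteq> (\<lambda>f k. if k \<in> ?I then f k else base k) ` PiE ?I A"
  proof
    fix \<gamma> assume g: "\<gamma> \<in> {\<gamma>. (\<forall>k. \<gamma> k \<in> A k) \<and> (\<forall>k. N \<le> \<bar>k\<bar> \<longrightarrow> \<gamma> k = base k)}"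
    have "\<gamma> = (\<lambda>k. if k \<in> ?I then restrict \<gamma> ?I k else base k)"
    proof
      fix k
      have "N \<le> \<bar>k\<bar>" if "k \<notin> ?I" using that by (auto simp: abs_if split: if_splits)
      then show "\<gamma> k = (if k \<in> ?I then restrict \<gamma> ?I k else base k)" using g by auto
    qed
    moreover have "restrict \<gamma> ?I \<in> PiE ?I A" using g by auto
    ultimately show "\<gamma> \<in> (\<lambda>f k. if k \<in> ?I then f k else base k) ` PiE ?I A" by blast
  qed
  show "finite ((\<lambda>f k. if k \<in> ?I then f k else base k) ` PiE ?I A)"
    using assms by (intro finite_imageI finite_PiE) auto
qed

text \<open>Consecutive supports of \<open>p\<close> are completely joined, so two choices of one
  supported vertex per index can be mixed freely. Independent choices therefore form a clique of
  paths.\<close>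

lemma SQ_sections_Ed:
  assumes p: "p \<in> SQ" and "\<And>k. p k (\<gamma> k) \<noteq> 0" "\<And>k. p k (\<gamma>' k) \<noteq> 0"
  shows "(\<gamma>, \<gamma>') \<in> Ed"
proof -
  have "\<gamma> \<in> Om" if g: "\<And>k. p k (\<gamma> k) \<noteq> 0" for \<gamma>
  proof -
    obtain N where N: "\<forall>k v. N \<le> \<bar>k\<bar> \<longrightarrow> p k v = (if v = base k then 1 else 0)" using SQ_D(8)[OF p] by blast
    have "\<forall>k. N \<le> \<bar>k\<bar> \<longrightarrow> \<gamma> k = base k" using N g by metis
    then show ?thesis unfolding Om_iff using g SQ_D(3,4,7)[OF p] by blast
  qed
  then show ?thesis unfolding Ed_iff using assms SQ_D(7)[OF p] by blast
qed

lemma prodpt_in_MC: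
  assumes p: "p \<in> SQ" shows "prodpt p \<in> MC"
  unfolding MC_def mem_Collect_eq
proof (intro conjI allI impI)
  show "0 \<le> prodpt p \<gamma>" "prodpt p \<gamma> \<le> 1" for \<gamma> using prodpt_bounds[OF p] by auto
  show "(\<gamma>, \<gamma>') \<in> Ed" if "prodpt p \<gamma> \<noteq> 0" "prodpt p \<gamma>' \<noteq> 0" for \<gamma> \<gamma>'
    using SQ_sections_Ed[OF p] prodpt_nonzero[OF p] that by blast
  obtain N where N: "\<forall>k v. N \<le> \<bar>k\<bar> \<longrightarrow> p k v = (if v = base k then 1 else 0)" using SQ_D(8)[OF p] by blast
  have "{\<gamma>. prodpt p \<gamma> \<noteq> 0} \<subseteq> {\<gamma>. (\<forall>k. \<gamma> k \<in> {v. p k v \<noteq> 0}) \<and> (\<forall>k. N \<le> \<bar>k\<bar> \<longrightarrow> \<gamma> k = base k)}"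
    using prodpt_nonzero[OF p] N by (auto; metis)
  then show "finite {\<gamma>. prodpt p \<gamma> \<noteq> 0}"
    by (rule finite_subset) (intro finite_sections SQ_D(5)[OF p])
  \<comment> \<open>Choosing a vertex of weight 1 at every index gives a path of weight 1.\<close>
  define \<gamma> where "\<gamma> = (\<lambda>k. SOME v. p k v = 1)"
  have "p k (\<gamma> k) = 1" for k unfolding \<gamma>_def using SQ_D(6)[OF p] by (rule someI_ex)
  then have "1 \<le> prodpt p \<gamma>" by (intro prodpt_ge[OF p]) auto
  then show "\<exists>\<gamma>. prodpt p \<gamma> = 1" using prodpt_bounds[OF p, of \<gamma>] by (intro exI[of _ \<gamma>]) linarith
qed

text \<open>A path through vertices of weight 1, rerouted through \<open>v\<close> at the single
  index \<open>k\<close>, has weight \<open>p k v\<close>. The opposite composite is in general not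
  the identity: it forgets how the values at different indices are correlated.\<close>

lemma marg_prodpt:
  assumes p: "p \<in> SQ" shows "marg (prodpt p) = p"
proof (intro ext)
  fix k v
  have M: "prodpt p \<in> MC" by (rule prodpt_in_MC[OF p])
  have "marg (prodpt p) k v \<le> p k v"
    unfolding marg_def by (rule fmax_le[OF finite_range_marg[OF MC_D(3)[OF M]]])
      (auto simp: prodpt_le[OF p] SQ_D(1)[OF p])
  moreover have "p k v \<le> marg (prodpt p) k v"
  proof -
    define \<gamma> where "\<gamma> = (\<lambda>k. SOME v. p k v = 1)(k := v)"
    have "p j (SOME v. p j v = 1) = 1" for j using SQ_D(6)[OF p] by (rule someI_ex)
    then have "p k v \<le> prodpt p \<gamma>"
      by (intro prodpt_ge[OF p]) (auto simp: \<gamma>_def SQ_D(2)[OF p])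
    also have "\<dots> \<le> marg (prodpt p) k (\<gamma> k)" by (rule marg_ge[OF M])
    finally show ?thesis by (simp add: \<gamma>_def)
  qed
  ultimately show "marg (prodpt p) k v = p k v" by simp
qed

lemma line_eq_Max:
  assumes "\<bar>s\<bar> \<le> of_int M"
  shows "line p s v = Max (insert 0 ((\<lambda>k. kap (s - of_int k) * p k v) ` {-M - 2..M + 2}))"
  unfolding line_def
proof (rule fmax_eq)
  fix k assume "k \<notin> {-M - 2..M + 2}"
  then have "k + 1 \<le> - M - 2 \<or> M + 2 + 1 \<le> k" by auto
  then have "real_of_int (k + 1) \<le> real_of_int (- M - 2) \<or> real_of_int (M + 2 + 1) \<le> real_of_int k"
    by (simp only: of_int_le_iff)
  then have "of_int k + 1 \<le> - of_int M - (2::real) \<or> of_int M + 2 + 1 \<le> (of_int k :: real)"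
    by simp
  then have "kap (s - of_int k) = 0" using assms kap_nonzero[of "s - of_int k"] by linarith
  then show "kap (s - of_int k) * p k v = 0" by simp
qed

lemma near_floor:
  assumes "\<bar>s - of_int k\<bar> < (3/2 :: real)" shows "k \<in> {\<lfloor>s\<rfloor> - 2..\<lfloor>s\<rfloor> + 2}"
proof -
  have "of_int \<lfloor>s\<rfloor> \<le> s" "s < of_int \<lfloor>s\<rfloor> + 1" by linarith+
  then have "real_of_int k < real_of_int (\<lfloor>s\<rfloor> + 3)" "real_of_int (\<lfloor>s\<rfloor> - 3) < real_of_int k"
    using assms unfolding abs_less_iff of_int_add of_int_diff of_int_numeral by linarith+
  then show ?thesis by (simp only: of_int_less_iff) auto
qed

lemma finite_range_line: "finite (range (\<lambda>k. kap (s - of_int k) * p k v))"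
proof (rule finite_range_support[of _ 0], rule finite_subset)
  show "{k. kap (s - of_int k) * p k v \<noteq> 0} \<subseteq> {\<lfloor>s\<rfloor> - 2..\<lfloor>s\<rfloor> + 2}"
  proof
    fix k assume "k \<in> {k. kap (s - of_int k) * p k v \<noteq> 0}"
    then have "\<bar>s - of_int k\<bar> < 3/2" using kap_nonzero by auto
    then show "k \<in> {\<lfloor>s\<rfloor> - 2..\<lfloor>s\<rfloor> + 2}" by (rule near_floor)
  qed
qed simp

lemma line_ge: "kap (s - of_int k) * p k v \<le> line p s v"
  unfolding line_def by (rule fmax_ge[OF finite_range_line])

lemma line_nonzero:
  assumes "line p s v \<noteq> 0"
  obtains k where "\<bar>s - of_int k\<bar> < 3/2" "p k v \<noteq> 0" "line p s v = kap (s - of_int k) * p k v"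
proof -
  obtain k where "line p s v = kap (s - of_int k) * p k v"
    by (rule fmax_attained[OF finite_range_line[of s p v] assms[unfolded line_def], folded line_def])
  then show ?thesis using that assms kap_nonzero by (metis mult_eq_0_iff)
qed

lemma line_le:
  assumes "\<And>k. \<bar>s - of_int k\<bar> < 3/2 \<Longrightarrow> p k v \<le> b" "\<And>k. 0 \<le> p k v" "0 \<le> b"
  shows "line p s v \<le> b"
  unfolding line_def
proof (rule fmax_le[OF finite_range_line])
  fix k
  show "kap (s - of_int k) * p k v \<le> b"
  proof (cases "kap (s - of_int k) = 0")
    case False
    have "kap (s - of_int k) * p k v \<le> 1 * p k v" using kap_bounds assms(2) by (intro mult_right_mono) auto
    also have "\<dots> \<le> b" using assms(1) False kap_nonzero by simp
    finally show ?thesis .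
  qed (use assms in simp)
qed (fact assms(3))

lemma line_bounds: "p \<in> SQ \<Longrightarrow> 0 \<le> line p s v" "p \<in> SQ \<Longrightarrow> line p s v \<le> 1"
  unfolding line_def[of p s v, symmetric]
  using fmax_nonneg[OF finite_range_line[of s p v]] line_le[of s p v 1] SQ_D(1,2)[of p] unfolding line_def by auto

lemma line_eq_1:
  assumes "p \<in> SQ" "\<bar>s - of_int k\<bar> \<le> 1" "p k v = 1" shows "line p s v = 1"
  using line_ge[of s k p v] line_bounds[OF assms(1)] assms(2,3) kap_eq_1[OF assms(2)] by (intro antisym) auto

lemma near_parity: "\<exists>j. par j = par k \<and> \<bar>s - of_int j\<bar> \<le> (1 :: real)"
proof (cases "par \<lfloor>s\<rfloor> = par k")
  case True
  moreover have "\<bar>s - of_int \<lfloor>s\<rfloor>\<bar> \<le> 1" by linarith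
  ultimately show ?thesis by blast
next
  case False
  then have "par (\<lfloor>s\<rfloor> + 1) = par k" by (auto simp: par_eq split: if_splits)
  moreover have "\<bar>s - of_int (\<lfloor>s\<rfloor> + 1)\<bar> \<le> 1" by (simp; linarith)
  ultimately show ?thesis by blast
qed

lemma line_in_MB:
  assumes p: "p \<in> SQ" shows "line p s \<in> MB"
  unfolding MB_def mem_Collect_eq
proof (intro conjI allI impI)
  show "0 \<le> line p s v" "line p s v \<le> 1" for v using line_bounds[OF p] by auto
  show "v \<in> V" if "line p s v \<noteq> 0" for v using line_nonzero[OF that] SQ_D(3)[OF p] by metis
  have "{v. line p s v \<noteq> 0} \<subseteq> (\<Union>k\<in>{\<lfloor>s\<rfloor> - 2..\<lfloor>s\<rfloor> + 2}. {v. p k v \<noteq> 0})"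
  proof
    fix v assume "v \<in> {v. line p s v \<noteq> 0}"
    then obtain k where k: "\<bar>s - of_int k\<bar> < 3/2" "p k v \<noteq> 0" using line_nonzero[of p s v] by auto
    from near_floor[OF k(1)] show "v \<in> (\<Union>k\<in>{\<lfloor>s\<rfloor> - 2..\<lfloor>s\<rfloor> + 2}. {v. p k v \<noteq> 0})" using k by blast
  qed
  then show "finite {v. line p s v \<noteq> 0}"
    by (rule finite_subset) (use SQ_D(5)[OF p] in auto)
  show "\<exists>v. c v = par k \<and> line p s v = 1" for k
  proof -
    obtain j where j: "par j = par k" "\<bar>s - of_int j\<bar> \<le> 1" using near_parity by blast
    obtain v where "p j v = 1" using SQ_D(6)[OF p] by blast
    then have "line p s v = 1" "c v = par k" using line_eq_1[OF p j(2)] SQ_D(4)[OF p, of j v] j(1) by auto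
    then show ?thesis by blast
  qed
  fix a b assume a: "line p s a \<noteq> 0" and b: "line p s b \<noteq> 0" and ab: "c a \<noteq> c b"
  obtain j where j: "\<bar>s - of_int j\<bar> < 3/2" "p j a \<noteq> 0" using line_nonzero[OF a] by metis
  obtain k where k: "\<bar>s - of_int k\<bar> < 3/2" "p k b \<noteq> 0" using line_nonzero[OF b] by metis
  \<comment> \<open>Both indices lie within 3/2 of \<open>s\<close>, so they differ by at most 2;
    different colours leave only neighbours.\<close>
  have "\<bar>of_int j - of_int k\<bar> < (3::real)" using j(1) k(1) by linarith
  then have "\<bar>j - k\<bar> < 3" by linarith
  moreover have "par j \<noteq> par k" using ab j(2) k(2) SQ_D(4)[OF p] by metis
  then have "j \<noteq> k" "j \<noteq> k + 2" "k \<noteq> j + 2" by (auto simp: par_eq)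
  ultimately have "k = j + 1 \<or> j = k + 1" by linarith
  then show "(a, b) \<in> E" using j(2) k(2) SQ_D(7)[OF p] E_sym by metis
qed

text \<open>Within 1/2 of \<open>k\<close> the only other active indices are \<open>k - 1\<close>
  and \<open>k + 1\<close>, of the opposite colour. So the coordinates of the colour of
  \<open>k\<close> show \<open>p k\<close> undisturbed.\<close>

lemma line_recover:
  assumes p: "p \<in> SQ" and s: "\<bar>s - of_int k\<bar> \<le> 1/2" and v: "c v = par k"
  shows "line p s v = p k v"
proof (rule antisym)
  show "p k v \<le> line p s v" using line_ge[of s k p v] kap_eq_1[of "s - of_int k"] s by simp
  have "p j v \<le> p k v" if "\<bar>s - of_int j\<bar> < 3/2" for j
  proof (cases "p j v = 0")
    case False
    then have "par j = par k" using SQ_D(4)[OF p] v by metis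
    then have "j \<noteq> k + 1" "k \<noteq> j + 1" by (auto simp: par_eq split: if_splits)
    moreover have "\<bar>of_int j - of_int k\<bar> < (2::real)" using that s by linarith
    then have "\<bar>j - k\<bar> < 2" by linarith
    ultimately have "j = k" by linarith
    then show ?thesis by simp
  qed (simp add: SQ_D(1)[OF p])
  then show "line p s v \<le> p k v" by (intro line_le SQ_D(1)[OF p])
qed

lemma line_base:
  assumes p: "p \<in> SQ" and N: "\<And>k v. \<bar>s - of_int k\<bar> < 3/2 \<Longrightarrow> p k v = (if v = base k then 1 else 0)"
  shows "line p s = bpt"
proof
  fix v
  show "line p s v = bpt v"
  proof (cases "v = x0 \<or> v = x1")
    case True
    then obtain k where k: "v = base k" by (metis base_def even_zero odd_one)
    obtain j where j: "par j = par k" "\<bar>s - of_int j\<bar> \<le> 1" using near_parity by blast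
    have "v = base j" using j(1) k by (auto simp: par_eq base_def split: if_splits)
    then have "line p s v = 1" using line_eq_1[OF p j(2)] N[of j v] j(2) by auto
    then show ?thesis using True by (simp add: bpt_def)
  next
    case False
    have "line p s v = 0"
    proof (rule ccontr)
      assume "line p s v \<noteq> 0"
      then obtain k where "\<bar>s - of_int k\<bar> < 3/2" "p k v \<noteq> 0" using line_nonzero by metis
      then show False using N[of k v] False by (auto simp: base_def split: if_splits)
    qed
    then show ?thesis using False by (simp add: bpt_def)
  qed
qed

text \<open>Up to \<open>l = 1/2\<close> the first coefficient of \<open>trop\<close> is 1, from
  then on the second. A vertex where \<open>q\<close>, respectively \<open>r\<close>, takes the
  value 1 thus keeps it.\<close>

lemma trop_in_MB:
  assumes q: "q \<in> MB" "r \<in> MB" and l: "0 \<le> l" "l \<le> 1"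
    and cross: "\<And>a b. q a \<noteq> 0 \<Longrightarrow> r b \<noteq> 0 \<Longrightarrow> c a \<noteq> c b \<Longrightarrow> (a, b) \<in> E"
  shows "(\<lambda>v. trop l (q v) (r v)) \<in> MB"
  unfolding MB_def mem_Collect_eq
proof (intro conjI allI impI)
  show "0 \<le> trop l (q v) (r v)" "trop l (q v) (r v) \<le> 1" for v
    using trop_bounds MB_D(1,2)[OF q(1)] MB_D(1,2)[OF q(2)] l by auto
  have nz: "q v \<noteq> 0 \<or> r v \<noteq> 0" if "trop l (q v) (r v) \<noteq> 0" for v using that trop_zero by metis
  then show "v \<in> V" if "trop l (q v) (r v) \<noteq> 0" for v using that MB_D(4)[OF q(1)] MB_D(4)[OF q(2)] by blast
  show "finite {v. trop l (q v) (r v) \<noteq> 0}"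
    by (rule finite_subset[OF _ finite_UnI[OF MB_D(3)[OF q(1)] MB_D(3)[OF q(2)]]]) (use nz in auto)
  show "(a, b) \<in> E" if "trop l (q a) (r a) \<noteq> 0" "trop l (q b) (r b) \<noteq> 0" "c a \<noteq> c b" for a b
    using nz[OF that(1)] nz[OF that(2)] that(3) cross[of a b] cross[of b a] MB_D(5)[OF q(1), of a b] MB_D(5)[OF q(2), of a b] E_sym
    by auto
  show "\<exists>v. c v = par k \<and> trop l (q v) (r v) = 1" for k
  proof (cases "l \<le> 1/2")
    case True
    obtain v where "c v = par k" "q v = 1" using MB_D(6)[OF q(1)] by blast
    then show ?thesis using trop_eq_1[OF l, of "q v" "r v"] True MB_D(1,2)[OF q(2), of v] by (intro exI[of _ v]) auto
  next
    case False
    obtain v where "c v = par k" "r v = 1" using MB_D(6)[OF q(2)] by blast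
    then show ?thesis using trop_eq_1[OF l, of "q v" "r v"] False MB_D(1,2)[OF q(1), of v] by (intro exI[of _ v]) auto
  qed
qed

lemma trop_in_MC:
  assumes q: "q \<in> MC" "r \<in> MC" and l: "0 \<le> l" "l \<le> 1"
    and cross: "\<And>a b. q a \<noteq> 0 \<Longrightarrow> r b \<noteq> 0 \<Longrightarrow> (a, b) \<in> Ed"
  shows "(\<lambda>v. trop l (q v) (r v)) \<in> MC"
  unfolding MC_def mem_Collect_eq
proof (intro conjI allI impI)
  show "0 \<le> trop l (q v) (r v)" "trop l (q v) (r v) \<le> 1" for v
    using trop_bounds MC_D(1,2)[OF q(1)] MC_D(1,2)[OF q(2)] l by auto
  have nz: "q v \<noteq> 0 \<or> r v \<noteq> 0" if "trop l (q v) (r v) \<noteq> 0" for v using that trop_zero by metis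
  show "finite {v. trop l (q v) (r v) \<noteq> 0}"
    by (rule finite_subset[OF _ finite_UnI[OF MC_D(3)[OF q(1)] MC_D(3)[OF q(2)]]]) (use nz in auto)
  have sym: "(a, b) \<in> Ed \<Longrightarrow> (b, a) \<in> Ed" for a b by (auto simp: Ed_iff)
  show "(a, b) \<in> Ed" if "trop l (q a) (r a) \<noteq> 0" "trop l (q b) (r b) \<noteq> 0" for a b
    using nz[OF that(1)] nz[OF that(2)] cross[of a b] cross[of b a] MC_D(5)[OF q(1), of a b] MC_D(5)[OF q(2), of a b] sym
    by auto
  show "\<exists>v. trop l (q v) (r v) = 1"
  proof (cases "l \<le> 1/2")
    case True
    obtain v where "q v = 1" using MC_D(6)[OF q(1)] by blast
    then show ?thesis using trop_eq_1[OF l, of "q v" "r v"] True MC_D(1,2)[OF q(2), of v] by (intro exI[of _ v]) auto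
  next
    case False
    obtain v where "r v = 1" using MC_D(6)[OF q(2)] by blast
    then show ?thesis using trop_eq_1[OF l, of "q v" "r v"] False MC_D(1,2)[OF q(1), of v] by (intro exI[of _ v]) auto
  qed
qed

section \<open>Superlevel sets in the two models\<close>

lemma MC_eq_level_model: "MC = level_model (clique_poset Om Ed)"
proof (intro equalityI subsetI)
  fix u assume u: "u \<in> MC"
  have "{\<gamma>. \<theta> < u \<gamma>} \<in> clique_poset Om Ed" if "0 \<le> \<theta>" "\<theta> < 1" for \<theta>
  proof -
    have sub: "{\<gamma>. \<theta> < u \<gamma>} \<subseteq> {\<gamma>. u \<gamma> \<noteq> 0}" using that by auto
    moreover obtain \<gamma> where "u \<gamma> = 1" using MC_D(6)[OF u] by blast
    then have "\<gamma> \<in> {\<gamma>. \<theta> < u \<gamma>}" using that by simp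
    then have "{\<gamma>. \<theta> < u \<gamma>} \<noteq> {}" by blast
    moreover have "finite {\<gamma>. \<theta> < u \<gamma>}" by (rule finite_subset[OF sub MC_D(3)[OF u]])
    ultimately show ?thesis
      using MC_D(4,5)[OF u] by (auto simp: clique_poset_def subset_iff)
  qed
  then show "u \<in> level_model (clique_poset Om Ed)"
    using MC_D(1-3)[OF u] by (auto simp: level_model_def)
next
  fix u assume u: "u \<in> level_model (clique_poset Om Ed)"
  then have b: "0 \<le> u \<gamma>" "u \<gamma> \<le> 1" "finite {\<gamma>. u \<gamma> \<noteq> 0}" for \<gamma> by (auto simp: level_model_def)
  have lev: "{\<gamma>. \<theta> < u \<gamma>} \<in> clique_poset Om Ed" if "0 \<le> \<theta>" "\<theta> < 1" for \<theta>
    using u that by (auto simp: level_model_def)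
  have nz: "{\<gamma>. u \<gamma> \<noteq> 0} = {\<gamma>. 0 < u \<gamma>}" using b(1) by (auto simp: order_less_le)
  have ne: "{\<gamma>. u \<gamma> \<noteq> 0} \<noteq> {}" using lev[of 0] nz by (auto simp: clique_poset_def)
  define m where "m = Max (u ` {\<gamma>. u \<gamma> \<noteq> 0})"
  have m: "m \<in> u ` {\<gamma>. u \<gamma> \<noteq> 0}" unfolding m_def using b(3) ne by (intro Max_in) auto
  \<comment> \<open>Were the largest value below 1, the superlevel set at that very level would be
    empty.\<close>
  have "m = 1"
  proof (rule ccontr)
    assume "m \<noteq> 1"
    then have "m < 1" "0 \<le> m" using m b by (auto simp: order_less_le)
    then obtain \<gamma> where g: "m < u \<gamma>" using lev[of m] by (auto simp: clique_poset_def)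
    then have "u \<gamma> \<in> u ` {\<gamma>. u \<gamma> \<noteq> 0}" using \<open>0 \<le> m\<close> by auto
    then have "u \<gamma> \<le> m" unfolding m_def using b(3) by (intro Max_ge) auto
    then show False using g by simp
  qed
  moreover have "(\<gamma>, \<gamma>') \<in> Ed" if "u \<gamma> \<noteq> 0" "u \<gamma>' \<noteq> 0" for \<gamma> \<gamma>'
  proof -
    have "{\<gamma>. 0 < u \<gamma>} \<times> {\<gamma>. 0 < u \<gamma>} \<subseteq> Ed" using lev[of 0] by (simp add: clique_poset_def)
    moreover have "\<gamma> \<in> {\<gamma>. 0 < u \<gamma>}" "\<gamma>' \<in> {\<gamma>. 0 < u \<gamma>}" unfolding nz[symmetric] using that by simp_all
    ultimately show ?thesis by blast
  qed
  ultimately show "u \<in> MC" using m b by (auto simp: MC_def)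
qed

text \<open>The colouring splits the union again, so a pair is encoded as one finite set and the
  level-set description of a poset of finite sets applies.\<close>

definition join_box :: "'v set \<times> 'v set \<Rightarrow> 'v set" where "join_box p = fst p \<union> snd p"

lemma MB_eq_level_model: "MB = level_model (join_box ` box_complex V E c)"
proof (intro equalityI subsetI)
  have p01: "par 0 = 0" "par 1 = 1" by (simp_all add: par_eq)
  fix q assume q: "q \<in> MB"
  have "{v. \<theta> < q v} \<in> join_box ` box_complex V E c" if th: "0 \<le> \<theta>" "\<theta> < 1" for \<theta>
  proof -
    let ?s = "{v. \<theta> < q v \<and> c v = 0}" and ?t = "{v. \<theta> < q v \<and> c v = 1}"
    have "finite ?s" "finite ?t" by (rule finite_subset[OF _ MB_D(3)[OF q]]; use th in auto)+
    moreover obtain v w where "c v = 0" "q v = 1" "c w = 1" "q w = 1"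
      using MB_D(6)[OF q, of 0] MB_D(6)[OF q, of 1] p01 by auto
    then have "v \<in> ?s" "w \<in> ?t" using th by auto
    then have "?s \<noteq> {}" "?t \<noteq> {}" by blast+
    moreover have "?s \<times> ?t \<subseteq> E" using MB_D(5)[OF q] th by force
    moreover have "v \<in> V" if "\<theta> < q v" for v using MB_D(4)[OF q, of v] that th by force
    ultimately have "(?s, ?t) \<in> box_complex V E c" by (auto simp: box_complex_def)
    moreover have "join_box (?s, ?t) = {v. \<theta> < q v}"
      using col \<open>\<And>v. \<theta> < q v \<Longrightarrow> v \<in> V\<close> by (auto simp: join_box_def)
    ultimately show ?thesis by (intro image_eqI[of _ join_box "(?s, ?t)"]) simp_all
  qed
  then show "q \<in> level_model (join_box ` box_complex V E c)"
    using MB_D(1-3)[OF q] by (auto simp: level_model_def)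
next
  fix u assume u: "u \<in> level_model (join_box ` box_complex V E c)"
  then have b: "0 \<le> u v" "u v \<le> 1" "finite {v. u v \<noteq> 0}" for v by (auto simp: level_model_def)
  have lev: "\<exists>p\<in>box_complex V E c. {v. \<theta> < u v} = join_box p" if "0 \<le> \<theta>" "\<theta> < 1" for \<theta>
    using u that by (auto simp: level_model_def image_iff)
  have nz: "u v \<noteq> 0 \<longleftrightarrow> 0 < u v" for v using b(1)[of v] by auto
  obtain s t where st: "(s, t) \<in> box_complex V E c" "{v. 0 < u v} = s \<union> t"
    using lev[of 0] by (auto simp: join_box_def)
  have "(a, b) \<in> E" if "u a \<noteq> 0" "u b \<noteq> 0" "c a \<noteq> c b" for a b
  proof -
    have "a \<in> s \<union> t" "b \<in> s \<union> t" using that st(2) nz by auto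
    moreover have "c v = 0" if "v \<in> s" for v using that st(1) by (auto simp: box_complex_def)
    moreover have "c v = 1" if "v \<in> t" for v using that st(1) by (auto simp: box_complex_def)
    ultimately have "(a \<in> s \<and> b \<in> t) \<or> (a \<in> t \<and> b \<in> s)" using that(3) by auto
    then show ?thesis using st(1) E_sym by (auto simp: box_complex_def)
  qed
  moreover have "v \<in> V" if "u v \<noteq> 0" for v
  proof -
    have "v \<in> s \<union> t" using that nz st(2) by auto
    then show ?thesis using st(1) by (auto simp: box_complex_def)
  qed
  moreover have "\<exists>v. c v = par k \<and> u v = 1" for k
  proof -
    let ?W = "{v. u v \<noteq> 0 \<and> c v = par k}"
    \<comment> \<open>The maximum is taken inside one colour class, which every member of the box
      complex meets.\<close>
    have lk: "\<exists>v. \<theta> < u v \<and> c v = par k" if th: "0 \<le> \<theta>" "\<theta> < 1" for \<theta>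
    proof -
      obtain s t where st: "(s, t) \<in> box_complex V E c" "{v. \<theta> < u v} = s \<union> t"
        using lev[OF th] by (auto simp: join_box_def)
      then obtain a b where "a \<in> s" "b \<in> t" by (auto simp: box_complex_def)
      moreover have "c a = 0" "c b = 1" using calculation st(1) by (auto simp: box_complex_def)
      moreover have "\<theta> < u a" "\<theta> < u b" using calculation st(2) by auto
      ultimately show ?thesis by (cases "even k") (auto simp: par_eq)
    qed
    have f: "finite ?W" by (rule finite_subset[OF _ b(3)]) auto
    have ne: "?W \<noteq> {}" using lk[of 0] nz by auto
    define m where "m = Max (u ` ?W)"
    have m: "m \<in> u ` ?W" unfolding m_def using f ne by (intro Max_in) auto
    have "m = 1"
    proof (rule ccontr)
      assume "m \<noteq> 1"
      then have "m < 1" "0 \<le> m" using m b by (auto simp: order_less_le)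
      then obtain v where g: "m < u v" "c v = par k" using lk[of m] by auto
      then have "u v \<in> u ` ?W" using \<open>0 \<le> m\<close> by auto
      then have "u v \<le> m" unfolding m_def using f by (intro Max_ge) auto
      then show False using g by simp
    qed
    then show ?thesis using m by auto
  qed
  ultimately show "u \<in> MB" using b by (auto simp: MB_def)
qed

end

section \<open>From clique points to loops and back\<close>

text \<open>The line on which bi-infinite sequences live is identified with the open interval of
  loop time, with inverse \<open>tau\<close>. At the times 0 and 1 the value of \<open>rho\<close>
  has no meaning.\<close>

definition rho :: "real \<Rightarrow> real" where "rho t = tan (pi * (t - 1/2))"
definition tau :: "real \<Rightarrow> real" where "tau s = 1/2 + arctan s / pi"
definition clip :: "real \<Rightarrow> real \<Rightarrow> real \<Rightarrow> real" where "clip a b t = max a (min t b)"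
text \<open>Weights up to 1/4 vanish, which leaves room for perturbations outside the support.
  Weights from 1/2 on become 1, so a vertex staying at height 1/2 over a window restores the
  normalisation.\<close>

definition trunc :: "real \<Rightarrow> real" where "trunc r = max 0 (min 1 (4 * r - 1))"

lemma tau_bounds: "0 < tau s" "tau s < 1"
  using arctan_bounded[of s] by (auto simp: tau_def field_simps)

lemma rho_tau [simp]: "rho (tau s) = s"
  by (simp add: rho_def tau_def tan_arctan)

lemma tau_le_iff [simp]: "tau s \<le> tau s' \<longleftrightarrow> s \<le> s'"
  by (simp add: tau_def divide_le_cancel arctan_le_iff)

lemma tau_rho:
  assumes "0 < t" "t < 1" shows "tau (rho t) = t"
proof -
  have "pi * t < pi * 1" "0 < pi * t" using assms by (auto intro: mult_strict_left_mono)
  then have "- (pi / 2) < pi * (t - 1/2)" "pi * (t - 1/2) < pi / 2"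
    by (simp_all add: algebra_simps)
  then show ?thesis by (simp add: rho_def tau_def arctan_tan)
qed

lemma tau_le: "0 < t \<Longrightarrow> t < 1 \<Longrightarrow> tau s \<le> t \<longleftrightarrow> s \<le> rho t"
  using tau_le_iff[of s "rho t"] tau_rho[of t] by simp

lemma le_tau: "0 < t \<Longrightarrow> t < 1 \<Longrightarrow> t \<le> tau s \<longleftrightarrow> rho t \<le> s"
  using tau_le_iff[of "rho t" s] tau_rho[of t] by simp

lemma continuous_on_rho: "continuous_on {0<..<1} rho"
  unfolding rho_def
proof (intro continuous_intros ballI)
  fix t :: real assume t: "t \<in> {0<..<1}"
  then have "pi * t < pi * 1" "0 < pi * t" by (auto intro: mult_strict_left_mono)
  then have "- (pi / 2) < pi * (t - 1/2)" "pi * (t - 1/2) < pi / 2"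
    by (simp_all add: algebra_simps)
  then show "cos (pi * (t - 1/2)) \<noteq> 0" using cos_gt_zero_pi by force
qed

lemma continuous_map_clip:
  assumes "continuous_map Z euclideanreal a" "continuous_map Z euclideanreal b" "continuous_map Z euclideanreal t"
  shows "continuous_map Z euclideanreal (\<lambda>z. clip (a z) (b z) (t z))"
  unfolding clip_def by (intro continuous_map_real_max continuous_map_real_min assms)

lemma clip_bounds: "a \<le> b \<Longrightarrow> a \<le> clip a b t" "a \<le> b \<Longrightarrow> clip a b t \<le> b"
  by (auto simp: clip_def)

text \<open>\<open>rho\<close> is continuous on the open interval; clipping first keeps its argument
  in a compact subinterval.\<close>

lemma continuous_map_rho_clip:
  assumes "continuous_map Z euclideanreal t" and ab: "a \<le> b"
  shows "continuous_map Z euclideanreal (\<lambda>z. rho (clip (tau a) (tau b) (t z)))"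
proof -
  have "continuous_map Z (top_of_set {0<..<1}) (\<lambda>z. clip (tau a) (tau b) (t z))"
    unfolding continuous_map_in_subtopology
  proof (intro conjI)
    show "continuous_map Z euclideanreal (\<lambda>z. clip (tau a) (tau b) (t z))"
      using assms(1) by (intro continuous_map_clip) auto
    have "clip (tau a) (tau b) r \<in> {0<..<1}" for r
      using clip_bounds[of "tau a" "tau b" r] ab tau_bounds[of a] tau_bounds[of b] by simp
    then show "(\<lambda>z. clip (tau a) (tau b) (t z)) \<in> topspace Z \<rightarrow> {0<..<1}" by blast
  qed
  moreover have "continuous_map (top_of_set {0<..<1}) euclideanreal rho"
    using continuous_on_rho by simp
  ultimately have "continuous_map Z euclideanreal (rho \<circ> (\<lambda>z. clip (tau a) (tau b) (t z)))"
    by (rule continuous_map_compose)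
  then show ?thesis by (simp add: o_def)
qed

lemma continuous_map_kap:
  assumes "continuous_map Z euclideanreal g" shows "continuous_map Z euclideanreal (\<lambda>z. kap (g z))"
  unfolding kap_def using assms
  by (intro continuous_map_real_max continuous_map_real_min continuous_map_diff continuous_map_real_mult_left
      continuous_map_real_abs) auto

lemma continuous_map_trunc:
  assumes "continuous_map Z euclideanreal g" shows "continuous_map Z euclideanreal (\<lambda>z. trunc (g z))"
  unfolding trunc_def using assms
  by (intro continuous_map_real_max continuous_map_real_min continuous_map_diff continuous_map_real_mult_left) auto

lemma trunc_bounds: "0 \<le> trunc r" "trunc r \<le> 1"
  by (auto simp: trunc_def)

lemma trunc_mono: "r \<le> s \<Longrightarrow> trunc r \<le> trunc s"
  by (auto simp: trunc_def)

lemma trunc_nonzero: "trunc r \<noteq> 0 \<Longrightarrow> 1/4 < r"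
  by (auto simp: trunc_def max_def min_def split: if_splits)

lemma trunc_eq_1: "1/2 \<le> r \<Longrightarrow> trunc r = 1"
  by (auto simp: trunc_def)

lemma trunc_0 [simp]: "trunc 0 = 0"
  by (simp add: trunc_def)

lemma continuous_map_prod_swap:
  assumes "continuous_map (prod_topology X Y) Z (\<lambda>(x, y). f y x)"
  shows "continuous_map (prod_topology Y X) Z (\<lambda>(y, x). f y x)"
proof -
  have "continuous_map (prod_topology Y X) Z ((\<lambda>(x, y). f y x) \<circ> (\<lambda>z. (snd z, fst z)))"
    by (rule continuous_map_compose[OF _ assms]) (intro continuous_map_pairedI continuous_map_fst continuous_map_snd)
  then show ?thesis by (simp add: o_def case_prod_beta')
qed

context based_bigraph
begin

lemma finite_support_MC: "u \<in> MC \<Longrightarrow> finite {\<gamma>. u \<gamma> \<noteq> 0}"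
  by (rule MC_D(3))

lemma finite_support_MB: "u \<in> MB \<Longrightarrow> finite {\<gamma>. u \<gamma> \<noteq> 0}"
  by (rule MB_D(3))

abbreviation "TB \<equiv> weak_top MB"
abbreviation "TC \<equiv> weak_top MC"
abbreviation "LB \<equiv> loop_space TB bpt"

section \<open>The loop of a clique point\<close>

definition loop_of :: "((int \<Rightarrow> 'v) \<Rightarrow> real) \<Rightarrow> real \<Rightarrow> 'v \<Rightarrow> real" where
  "loop_of u t = (if 0 < t \<and> t < 1 then line (marg u) (rho t) else bpt)"

text \<open>The margin 2 covers the reach 3/2 of \<open>kap\<close>: only indices of absolute value
  at least \<open>N\<close> are seen from \<open>s\<close>.\<close>

lemma line_marg_far:
  assumes u: "u \<in> MC" and N: "\<And>\<gamma> k. u \<gamma> \<noteq> 0 \<Longrightarrow> N \<le> \<bar>k\<bar> \<Longrightarrow> \<gamma> k = base k" and s: "of_int (N + 2) \<le> \<bar>s\<bar>"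
  shows "line (marg u) s = bpt"
proof (rule line_base[OF marg_in_SQ[OF u]])
  fix k v assume "\<bar>s - of_int k\<bar> < 3/2"
  then have "real_of_int N \<le> \<bar>real_of_int k\<bar>" using s by (simp, linarith)
  then have "N \<le> \<bar>k\<bar>" by linarith
  then show "marg u k v = (if v = base k then 1 else 0)" using marg_bound[OF u] N by blast
qed

text \<open>Beyond \<open>N + 2\<close> the line rests at the base point, so time may be clipped
  there. The result is one formula for all \<open>t\<close> that stays away from the ends of
  \<open>rho\<close>.\<close>

lemma loop_of_clip:
  assumes u: "u \<in> MC" and N: "\<And>\<gamma> k. u \<gamma> \<noteq> 0 \<Longrightarrow> N \<le> \<bar>k\<bar> \<Longrightarrow> \<gamma> k = base k" and N0: "0 \<le> N"
  shows "loop_of u t = line (marg u) (rho (clip (tau (- of_int (N + 2))) (tau (of_int (N + 2))) t))"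
proof -
  let ?M = "real_of_int (N + 2)"
  have M: "0 \<le> ?M" using N0 by simp
  have far: "line (marg u) s = bpt" if "of_int (N + 2) \<le> \<bar>s\<bar>" for s
    using u N that by (rule line_marg_far)
  consider "t \<le> tau (- ?M)" | "tau ?M \<le> t" | "tau (- ?M) < t" "t < tau ?M" by linarith
  then show ?thesis
  proof cases
    case 1
    have "tau (- ?M) \<le> tau ?M" using M by simp
    then have "clip (tau (- ?M)) (tau ?M) t = tau (- ?M)" using 1 by (auto simp: clip_def)
    moreover have "loop_of u t = bpt"
    proof (cases "0 < t \<and> t < 1")
      case True
      then have "rho t \<le> - ?M" using le_tau 1 by blast
      then show ?thesis using far[of "rho t"] M by (auto simp: loop_of_def)
    qed (simp only: loop_of_def if_False)
    ultimately show ?thesis using far[of "- ?M"] M by simp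
  next
    case 2
    have "tau (- ?M) \<le> tau ?M" using M by simp
    then have "clip (tau (- ?M)) (tau ?M) t = tau ?M" using 2 by (auto simp: clip_def)
    moreover have "loop_of u t = bpt"
    proof (cases "0 < t \<and> t < 1")
      case True
      then have "?M \<le> rho t" using tau_le 2 by blast
      then show ?thesis using far[of "rho t"] M by (auto simp: loop_of_def)
    qed (simp only: loop_of_def if_False)
    ultimately show ?thesis using far[of "?M"] M by simp
  next
    case 3
    then have "clip (tau (- ?M)) (tau ?M) t = t" by (auto simp: clip_def)
    moreover have "0 < t \<and> t < 1" using 3 tau_bounds[of "- ?M"] tau_bounds[of ?M] by linarith
    ultimately show ?thesis by (simp add: loop_of_def)
  qed
qed

lemma loop_of_in_MB: "u \<in> MC \<Longrightarrow> loop_of u t \<in> MB"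
  by (simp add: loop_of_def bpt_in_MB line_in_MB marg_in_SQ)

lemma loop_of_ends: "t \<le> 0 \<or> 1 \<le> t \<Longrightarrow> loop_of u t = bpt"
  by (auto simp: loop_of_def)

text \<open>Near a point \<open>s\<close> is bounded, so a fixed finite range of indices suffices
  and the maximum is one of finitely many continuous functions.\<close>

lemma continuous_map_line:
  assumes s: "continuous_map Z euclideanreal s" and p: "\<And>k. continuous_map Z euclideanreal (\<lambda>z. p z k v)"
  shows "continuous_map Z euclideanreal (\<lambda>z. line (p z) (s z) v)"
proof (rule continuous_map_locally)
  fix z assume z: "z \<in> topspace Z"
  define M where "M = \<lceil>\<bar>s z\<bar> + 1\<rceil>"
  let ?N = "{y \<in> topspace Z. s y \<in> {s z - 1<..<s z + 1}}"
  have "openin Z ?N" by (rule openin_continuous_map_preimage[OF s]) simp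
  moreover have "z \<in> ?N" using z by simp
  moreover have "continuous_map (subtopology Z ?N) euclideanreal (\<lambda>z. line (p z) (s z) v)"
  proof (rule continuous_map_eq)
    show "continuous_map (subtopology Z ?N) euclideanreal
        (\<lambda>y. Max (insert 0 ((\<lambda>k. kap (s y - of_int k) * p y k v) ` {-M - 2..M + 2})))"
      by (intro continuous_map_Max continuous_map_real_mult continuous_map_kap continuous_map_diff
          continuous_map_from_subtopology s p) auto
    fix y assume "y \<in> topspace (subtopology Z ?N)"
    then have "\<bar>s y\<bar> \<le> \<bar>s z\<bar> + 1" by auto
    then have "\<bar>s y\<bar> \<le> of_int M" unfolding M_def by linarith
    then show "Max (insert 0 ((\<lambda>k. kap (s y - of_int k) * p y k v) ` {-M - 2..M + 2})) = line (p y) (s y) v"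
      by (rule line_eq_Max[symmetric])
  qed
  ultimately show "\<exists>N. openin Z N \<and> z \<in> N \<and> continuous_map (subtopology Z N) euclideanreal (\<lambda>z. line (p z) (s z) v)"
    by blast
qed

lemma continuous_map_marg_part:
  assumes A: "finite A"
  shows "continuous_map (part_top MC A) euclideanreal (\<lambda>u. marg u k v)"
proof (rule continuous_map_eq)
  have "continuous_map (part_top MC A) euclideanreal (\<lambda>u. if \<gamma> k = v then u \<gamma> else 0)" for \<gamma>
    by (cases "\<gamma> k = v") (simp_all add: continuous_map_part_top_coord)
  then show "continuous_map (part_top MC A) euclideanreal (\<lambda>u. Max (insert 0 ((\<lambda>\<gamma>. if \<gamma> k = v then u \<gamma> else 0) ` A)))"
    by (intro continuous_map_Max A)
  fix u assume "u \<in> topspace (part_top MC A)"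
  then have "u \<gamma> = 0" if "\<gamma> \<notin> A" for \<gamma> using that by (simp add: part_def)
  then show "Max (insert 0 ((\<lambda>\<gamma>. if \<gamma> k = v then u \<gamma> else 0) ` A)) = marg u k v"
    unfolding marg_def by (intro fmax_eq[symmetric]) auto
qed

lemma finite_range_Om:
  assumes "\<gamma> \<in> Om" shows "finite (range \<gamma>)"
proof -
  obtain N where N: "\<forall>k. N \<le> \<bar>k\<bar> \<longrightarrow> \<gamma> k = base k" using assms Om_iff by blast
  have "range \<gamma> \<subseteq> {x0, x1} \<union> \<gamma> ` {-\<bar>N\<bar>..\<bar>N\<bar>}"
  proof
    fix v assume "v \<in> range \<gamma>"
    then obtain k where k: "v = \<gamma> k" by blast
    show "v \<in> {x0, x1} \<union> \<gamma> ` {-\<bar>N\<bar>..\<bar>N\<bar>}"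
    proof (cases "N \<le> \<bar>k\<bar>")
      case True
      then show ?thesis using N k by (simp add: base_def)
    next
      case False
      then have "k \<in> {-\<bar>N\<bar>..\<bar>N\<bar>}" by auto
      then show ?thesis using k by blast
    qed
  qed
  then show ?thesis by (rule finite_subset) simp
qed

text \<open>The paths of \<open>Om\<close> in \<open>A\<close> agree with \<open>base\<close> beyond
  a common \<open>N\<close> and visit finitely many vertices altogether. One clipping formula and
  one finite support therefore serve the whole part.\<close>

lemma continuous_map_loop_of_part:
  assumes A: "finite A"
  shows "continuous_map (prod_topology (part_top MC A) unit_interval) TB (\<lambda>(u, t). loop_of u t)"
proof (rule continuous_map_into_weak_top_finite)
  let ?Z = "prod_topology (part_top MC A) unit_interval"
  show "(case z of (u, t) \<Rightarrow> loop_of u t) \<in> MB" if "z \<in> topspace ?Z" for z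
    using that loop_of_in_MB by (auto simp: part_def)
  obtain N where N: "0 \<le> N" "\<forall>\<gamma>\<in>A \<inter> Om. \<forall>k. N \<le> \<bar>k\<bar> \<longrightarrow> \<gamma> k = base k"
    using Om_uniform_bound[OF A] by blast
  have Nu: "\<gamma> k = base k" if "u \<in> part MC A" "u \<gamma> \<noteq> 0" "N \<le> \<bar>k\<bar>" for u \<gamma> k
    using that N MC_D(4)[of u \<gamma>] by (auto simp: part_def)
  let ?l = "tau (- of_int (N + 2))" and ?h = "tau (of_int (N + 2))"
  have eq: "loop_of u t = line (marg u) (rho (clip ?l ?h t))" if "u \<in> part MC A" for u t
    using that Nu by (intro loop_of_clip N) (auto simp: part_def)
  have snd: "continuous_map ?Z euclideanreal snd"
    using continuous_map_snd continuous_map_into_fulltopology by blast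
  have "continuous_map ?Z euclideanreal (\<lambda>z. line (marg (fst z)) (rho (clip ?l ?h (snd z))) v)" for v
  proof (rule continuous_map_line)
    show "continuous_map ?Z euclideanreal (\<lambda>z. rho (clip ?l ?h (snd z)))"
      using N(1) by (intro continuous_map_rho_clip snd) simp
    show "continuous_map ?Z euclideanreal (\<lambda>z. marg (fst z) k v)" for k
      using continuous_map_compose[OF continuous_map_fst continuous_map_marg_part[OF A]] by (simp add: o_def)
  qed
  then show "continuous_map ?Z euclideanreal (\<lambda>z. (case z of (u, t) \<Rightarrow> loop_of u t) v)" for v
    by (rule continuous_map_eq) (auto simp: eq)
  let ?B = "{x0, x1} \<union> (\<Union>\<gamma>\<in>A \<inter> Om. range \<gamma>)"
  show "finite ?B" using A finite_range_Om by auto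
  have supp: "loop_of u t v = 0" if "u \<in> part MC A" "v \<notin> ?B" for u t v
  proof (rule ccontr)
    assume nz: "loop_of u t v \<noteq> 0"
    have u: "u \<in> MC" "\<And>\<gamma>. u \<gamma> \<noteq> 0 \<Longrightarrow> \<gamma> \<in> A" using that by (auto simp: part_def)
    have "line (marg u) (rho t) v \<noteq> 0" using nz that(2) by (auto simp: loop_of_def bpt_def split: if_splits)
    then obtain k where "marg u k v \<noteq> 0" by (rule line_nonzero)
    then obtain \<gamma> where "u \<gamma> \<noteq> 0" "\<gamma> k = v" by (rule marg_nonzero[OF u(1)])
    then have "v \<in> range \<gamma>" "\<gamma> \<in> A \<inter> Om" using u MC_D(4)[OF u(1)] by auto
    then show False using that(2) by blast
  qed
  then show "(case z of (u, t) \<Rightarrow> loop_of u t) v = 0" if "z \<in> topspace ?Z" "v \<notin> ?B" for z v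
    using that by auto
qed

lemma continuous_map_loop_of: "continuous_map TC LB loop_of"
proof (rule continuous_map_into_loop_space)
  \<comment> \<open>The interval is the locally compact factor, so it has to come first.\<close>
  have "continuous_map (prod_topology unit_interval TC) TB (\<lambda>(t, u). loop_of u t)"
  proof (rule continuous_map_weak_top_prod[OF locally_compact_unit_interval])
    show "continuous_map (prod_topology unit_interval (part_top MC A)) TB (\<lambda>(t, u). loop_of u t)" if "finite A" for A
      by (rule continuous_map_prod_swap[OF continuous_map_loop_of_part[OF that]])
  qed (rule finite_support_MC)
  then show "continuous_map (prod_topology TC unit_interval) TB (\<lambda>(u, t). loop_of u t)"
    by (rule continuous_map_prod_swap)
qed (rule loop_of_ends)

section \<open>Windows and the clique point of a loop\<close>

text \<open>The window is parametrised by the unit interval, so that moving endpoints enter only the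
  function and the infimum runs over a fixed compact set.\<close>

definition wind :: "(real \<Rightarrow> 'v \<Rightarrow> real) \<Rightarrow> (int \<Rightarrow> real) \<Rightarrow> (int \<Rightarrow> real) \<Rightarrow> int \<Rightarrow> 'v \<Rightarrow> real" where
  "wind w x y k v = (if c v = par k then trunc (INF r\<in>{0..1}. w (x k + r * (y k - x k)) v) else 0)"

text \<open>The condition is on rays, not just on windows: during a sweep a window can lie strictly
  between the two given ones.\<close>
definition base_beyond :: "int \<Rightarrow> (real \<Rightarrow> 'v \<Rightarrow> real) \<Rightarrow> (int \<Rightarrow> real) \<Rightarrow> (int \<Rightarrow> real) \<Rightarrow> bool" where
  "base_beyond N w x y \<longleftrightarrow>
     (\<forall>k\<ge>N. \<forall>t\<ge>x k. w t = bpt) \<and> (\<forall>k\<le>-N. \<forall>t\<le>y k. w t = bpt)"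

text \<open>Neighbouring windows intersect, which yields edges between consecutive supports. A
  vertex of the right colour at height 1/2 throughout the window yields weight 1 after
  \<open>trunc\<close>.\<close>

definition good :: "(real \<Rightarrow> 'v \<Rightarrow> real) \<Rightarrow> (int \<Rightarrow> real) \<Rightarrow> (int \<Rightarrow> real) \<Rightarrow> bool" where
  "good w x y \<longleftrightarrow> (\<forall>t\<in>{0..1}. w t \<in> MB) \<and>
    (\<forall>k. 0 \<le> x k \<and> x k \<le> y k \<and> y k \<le> 1 \<and> x (k + 1) \<le> y k \<and> x k \<le> y (k + 1)) \<and>
    (\<forall>k. \<exists>v. c v = par k \<and> (\<forall>t\<in>{x k..y k}. 1/2 \<le> w t v)) \<and> (\<exists>N. base_beyond N w x y)"

lemma goodD:
  assumes "good w x y"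
  shows "t \<in> {0..1} \<Longrightarrow> w t \<in> MB" "0 \<le> x k" "x k \<le> y k" "y k \<le> 1" "x (k + 1) \<le> y k" "x k \<le> y (k + 1)"
    "\<exists>v. c v = par k \<and> (\<forall>t\<in>{x k..y k}. 1/2 \<le> w t v)" "\<exists>N. base_beyond N w x y"
    "t \<in> {x k..y k} \<Longrightarrow> w t \<in> MB"
proof -
  show "t \<in> {0..1} \<Longrightarrow> w t \<in> MB" "0 \<le> x k" "x k \<le> y k" "y k \<le> 1" "x (k + 1) \<le> y k" "x k \<le> y (k + 1)"
    "\<exists>v. c v = par k \<and> (\<forall>t\<in>{x k..y k}. 1/2 \<le> w t v)" "\<exists>N. base_beyond N w x y" for t
    using assms unfolding good_def by blast+
  then show "t \<in> {x k..y k} \<Longrightarrow> w t \<in> MB" using order_trans by (metis atLeastAtMost_iff)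
qed

lemma window_point:
  assumes "a \<le> b" "r \<in> {0..1}" shows "a + r * (b - a) \<in> {a..b::real}"
  using assms mult_left_le_one_le[of "b - a" r] mult_nonneg_nonneg[of r "b - a"] by auto

lemma wind_le:
  assumes g: "good w x y" and t: "t \<in> {x k..y k}"
  shows "wind w x y k v \<le> trunc (w t v)"
proof -
  have bdd: "bdd_below ((\<lambda>r. w (x k + r * (y k - x k)) v) ` {0..1})"
    using MB_D(1)[OF goodD(9)[OF g window_point[OF goodD(3)[OF g]]]]
    by (intro bdd_belowI[of _ 0]) auto
  obtain r where r: "r \<in> {0..1}" "t = x k + r * (y k - x k)"
  proof (cases "x k = y k")
    case True
    then show ?thesis using t that[of 0] by auto
  next
    case False
    then have "x k < y k" using goodD(3)[OF g, of k] by simp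
    then show ?thesis using t that[of "(t - x k) / (y k - x k)"] by (auto simp: field_simps)
  qed
  have "(INF r\<in>{0..1}. w (x k + r * (y k - x k)) v) \<le> w t v"
    using cINF_lower[OF bdd r(1)] r(2) by simp
  then show ?thesis unfolding wind_def using trunc_mono trunc_bounds by simp
qed

text \<open>An infimum that survives truncation bounds the weight below at every time of the window.
  Sampling a single time, such as the left end, is thus enough to control supports.\<close>

lemma wind_nonzero:
  assumes "good w x y" "t \<in> {x k..y k}" "wind w x y k v \<noteq> 0"
  shows "1/4 < w t v"
  using wind_le[OF assms(1,2), of v] assms(3) trunc_nonzero[of "w t v"] trunc_bounds(1)
  by (smt (verit) wind_def)

lemma wind_eq:
  assumes "\<And>t. t \<in> {x k..y k} \<Longrightarrow> w t v = a" "x k \<le> y k" "c v = par k"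
  shows "wind w x y k v = trunc a"
proof -
  have "(INF r\<in>{0..1}. w (x k + r * (y k - x k)) v) = (INF r\<in>{0..1::real}. a)"
    using assms(1) window_point[OF assms(2)] by (intro INF_cong) auto
  then show ?thesis using assms(3) by (simp add: wind_def)
qed

lemma wind_base:
  assumes g: "good w x y" and N: "base_beyond N w x y" "N \<le> \<bar>k\<bar>"
  shows "wind w x y k v = (if v = base k then 1 else 0)"
proof (cases "c v = par k")
  case True
  have "wind w x y k v = trunc (bpt v)"
  proof (rule wind_eq)
    fix t assume "t \<in> {x k..y k}"
    moreover have "N \<le> k \<or> k \<le> - N" using N(2) by linarith
    ultimately show "w t v = bpt v" using N(1) by (auto simp: base_beyond_def)
  qed (use goodD(3)[OF g] True in auto)
  moreover have "bpt v = (if v = base k then 1 else 0)"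
    using True x01 by (auto simp: bpt_def base_def par_eq)
  ultimately show ?thesis by (auto simp: trunc_def)
next
  case False
  then have "v \<noteq> base k" using base_props by metis
  then show ?thesis using False by (simp add: wind_def)
qed

lemma wind_in_SQ:
  assumes g: "good w x y" shows "wind w x y \<in> SQ"
  unfolding SQ_def mem_Collect_eq
proof (intro conjI allI impI)
  fix k v
  show "0 \<le> wind w x y k v" "wind w x y k v \<le> 1" by (auto simp: wind_def trunc_bounds)
  have xk: "x k \<in> {x k..y k}" using goodD(3)[OF g] by simp
  have "{v. wind w x y k v \<noteq> 0} \<subseteq> {v. w (x k) v \<noteq> 0}" using wind_nonzero[OF g xk] by force
  then show "finite {v. wind w x y k v \<noteq> 0}"
    using MB_D(3)[OF goodD(9)[OF g xk]] by (rule finite_subset)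
  obtain v where v: "c v = par k" "\<And>t. t \<in> {x k..y k} \<Longrightarrow> 1/2 \<le> w t v" using goodD(7)[OF g] by blast
  have "1/2 \<le> (INF r\<in>{0..1}. w (x k + r * (y k - x k)) v)"
    using v(2) window_point[OF goodD(3)[OF g]] by (intro cINF_greatest) auto
  then have "wind w x y k v = 1" using v(1) by (simp add: wind_def trunc_eq_1)
  then show "\<exists>v. wind w x y k v = 1" by blast
next
  fix k v assume nz: "wind w x y k v \<noteq> 0"
  have xk: "x k \<in> {x k..y k}" using goodD(3)[OF g] by simp
  show "v \<in> V" using wind_nonzero[OF g xk nz] MB_D(4)[OF goodD(9)[OF g xk], of v] by force
  show "c v = par k" using nz by (auto simp: wind_def split: if_splits)
next
  fix k a b assume nz: "wind w x y k a \<noteq> 0" "wind w x y (k + 1) b \<noteq> 0"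
  \<comment> \<open>The later of the two left ends belongs to both windows, and at this time both
    vertices have positive weight.\<close>
  let ?t = "max (x k) (x (k + 1))"
  have t: "?t \<in> {x k..y k}" "?t \<in> {x (k + 1)..y (k + 1)}"
    using goodD(3,5,6)[OF g, of k] goodD(3)[OF g, of "k + 1"] by auto
  have "w ?t a \<noteq> 0" "w ?t b \<noteq> 0" using wind_nonzero[OF g t(1) nz(1)] wind_nonzero[OF g t(2) nz(2)] by auto
  moreover have "c a \<noteq> c b" using nz by (auto simp: wind_def par_eq split: if_splits)
  ultimately show "(a, b) \<in> E" using MB_D(5)[OF goodD(9)[OF g t(1)]] by blast
next
  obtain N where "base_beyond N w x y" using goodD(8)[OF g] by blast
  then show "\<exists>N. \<forall>k v. N \<le> \<bar>k\<bar> \<longrightarrow> wind w x y k v = (if v = base k then 1 else 0)"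
    using wind_base[OF g] by blast
qed

lemma continuous_map_window_point:
  assumes w: "continuous_map (prod_topology Z unit_interval) TB (\<lambda>(z, t). w z t)"
    and s: "continuous_map Z' unit_interval s" and f: "continuous_map Z' Z f"
  shows "continuous_map Z' TB (\<lambda>z. w (f z) (s z))"
proof -
  have "continuous_map Z' TB ((\<lambda>(z, t). w z t) \<circ> (\<lambda>z. (f z, s z)))"
    by (rule continuous_map_compose[OF _ w]) (intro continuous_map_pairedI s f)
  then show ?thesis by (simp add: o_def)
qed

lemma continuous_map_wind:
  assumes w: "continuous_map (prod_topology Z unit_interval) TB (\<lambda>(z, t). w z t)"
    and x: "\<And>k. continuous_map Z euclideanreal (\<lambda>z. x z k)" and y: "\<And>k. continuous_map Z euclideanreal (\<lambda>z. y z k)"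
    and g: "\<And>z. z \<in> topspace Z \<Longrightarrow> good (w z) (x z) (y z)"
  shows "continuous_map Z euclideanreal (\<lambda>z. wind (w z) (x z) (y z) k v)"
proof (cases "c v = par k")
  case True
  let ?P = "prod_topology Z unit_interval"
  let ?t = "\<lambda>p. x (fst p) k + snd p * (y (fst p) k - x (fst p) k)"
  have fst: "continuous_map ?P Z fst" by (rule continuous_map_fst)
  have snd: "continuous_map ?P euclideanreal snd"
    using continuous_map_snd continuous_map_into_fulltopology by blast
  have xf: "continuous_map ?P euclideanreal (\<lambda>p. x (fst p) k)"
    using continuous_map_compose[OF fst x] by (simp add: o_def)
  have yf: "continuous_map ?P euclideanreal (\<lambda>p. y (fst p) k)"
    using continuous_map_compose[OF fst y] by (simp add: o_def)
  have "continuous_map ?P euclideanreal ?t"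
    by (intro continuous_map_add continuous_map_real_mult continuous_map_diff xf yf snd)
  moreover have "?t p \<in> {0..1}" if "p \<in> topspace ?P" for p
  proof -
    have z: "fst p \<in> topspace Z" "snd p \<in> {0..1}" using that by auto
    note gz = g[OF z(1)]
    have "?t p \<in> {x (fst p) k..y (fst p) k}" by (rule window_point[OF goodD(3)[OF gz] z(2)])
    then show ?thesis using goodD(2)[OF gz, of k] goodD(4)[OF gz, of k] by auto
  qed
  ultimately have "continuous_map ?P unit_interval ?t"
    by (auto simp: continuous_map_in_subtopology)
  then have "continuous_map ?P TB (\<lambda>p. w (fst p) (?t p))"
    by (rule continuous_map_window_point[OF w _ fst])
  from continuous_map_compose[OF this continuous_map_weak_top_coord[OF finite_support_MB]]
  have "continuous_map ?P euclideanreal (\<lambda>p. w (fst p) (?t p) v)" by (simp add: o_def)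
  from continuous_map_trunc[OF continuous_map_INF_unit_interval[OF this]]
  show ?thesis using True by (simp add: wind_def)
next
  case False
  then show ?thesis by (simp add: wind_def)
qed

text \<open>Near \<open>z\<close>, a vertex outside the finite support of \<open>w z (x z k)\<close>
  has weight below 1/4 at the left end of the k-th window and is erased; from a locally uniform
  index on, the windows see only the base point. So finitely many paths occur near \<open>z\<close>,
  each with a weight determined by finitely many windows.\<close>

lemma continuous_map_prodpt_wind:
  assumes w: "continuous_map (prod_topology Z unit_interval) TB (\<lambda>(z, t). w z t)"
    and x: "\<And>k. continuous_map Z euclideanreal (\<lambda>z. x z k)" and y: "\<And>k. continuous_map Z euclideanreal (\<lambda>z. y z k)"
    and g: "\<And>z. z \<in> topspace Z \<Longrightarrow> good (w z) (x z) (y z)"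
    and N: "\<And>z. z \<in> topspace Z \<Longrightarrow> \<exists>O' N. openin Z O' \<and> z \<in> O' \<and> (\<forall>z'\<in>O'. base_beyond N (w z') (x z') (y z'))"
  shows "continuous_map Z TC (\<lambda>z. prodpt (wind (w z) (x z) (y z)))"
proof (rule continuous_map_into_weak_top)
  show "prodpt (wind (w z) (x z) (y z)) \<in> MC" if "z \<in> topspace Z" for z
    by (intro prodpt_in_MC wind_in_SQ g that)
  fix z assume z: "z \<in> topspace Z"
  obtain O' N0 where O': "openin Z O'" "z \<in> O'" "\<And>z'. z' \<in> O' \<Longrightarrow> base_beyond N0 (w z') (x z') (y z')"
    using N[OF z] by blast
  \<comment> \<open>The absolute value keeps \<open>{-N..N}\<close> nonempty, as the finite
    intersection of open sets below requires.\<close>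
  define N where "N = \<bar>N0\<bar>"
  let ?A = "\<lambda>k. {v. w z (x z k) v \<noteq> 0}"
  have finA: "finite (?A k)" for k
    using goodD(3)[OF g[OF z], of k] by (intro MB_D(3)[OF goodD(9)[OF g[OF z], of _ k]]) simp
  let ?U = "\<lambda>k. {q \<in> MB. \<forall>v\<in>-?A k. \<bar>q v - 0\<bar> < 1/4}"
  have U: "openin TB (?U k)" for k
    by (rule openin_weak_top_bound[OF finite_support_MB]) simp_all
  have wx: "continuous_map Z TB (\<lambda>z. w z (x z k))" for k
  proof (rule continuous_map_window_point[OF w])
    show "continuous_map Z unit_interval (\<lambda>z. x z k)"
      using x goodD(2)[OF g, of _ k] order_trans[OF goodD(3)[OF g, of _ k] goodD(4)[OF g, of _ k]]
      by (auto simp: continuous_map_in_subtopology)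
  qed simp
  let ?O = "\<lambda>k. {z' \<in> topspace Z. w z' (x z' k) \<in> ?U k}"
  have Ok: "openin Z (?O k)" for k by (rule openin_continuous_map_preimage[OF wx U])
  let ?W = "O' \<inter> (\<Inter>k\<in>{-N..N}. ?O k)"
  have "0 \<in> {-N..N}" by (simp add: N_def)
  then have W: "openin Z ?W" using Ok by (intro openin_Int O' openin_INT2) auto
  have zW: "z \<in> ?W"
  proof -
    have "w z (x z k) \<in> MB" for k
      using goodD(3)[OF g[OF z], of k] by (intro goodD(9)[OF g[OF z], of _ k]) simp
    then show ?thesis using O' z by simp
  qed
  have WZ: "?W \<subseteq> topspace Z" using openin_subset[OF W] .
  \<comment> \<open>For \<open>\<bar>k\<bar> > N\<close> the only admissible vertex is
    \<open>base k\<close>; so every index has a finite set of choices.\<close>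
  let ?A' = "\<lambda>k. if \<bar>k\<bar> \<le> N then ?A k else {base k}"
  let ?B = "{\<gamma>. (\<forall>k. \<gamma> k \<in> ?A' k) \<and> (\<forall>k. N \<le> \<bar>k\<bar> \<longrightarrow> \<gamma> k = base k)}"
  have B: "finite ?B" by (rule finite_sections) (simp add: finA)
  have supp: "\<gamma> \<in> ?B" if z': "z' \<in> ?W" and nz: "prodpt (wind (w z') (x z') (y z')) \<gamma> \<noteq> 0" for z' \<gamma>
  proof -
    have zZ: "z' \<in> topspace Z" using z' WZ by blast
    note gz = g[OF zZ]
    have k: "wind (w z') (x z') (y z') k (\<gamma> k) \<noteq> 0" for k by (rule prodpt_nonzero[OF wind_in_SQ[OF gz] nz])
    have 1: "\<gamma> k = base k" if "N \<le> \<bar>k\<bar>" for k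
    proof -
      have "base_beyond N0 (w z') (x z') (y z')" "N0 \<le> \<bar>k\<bar>" using O'(3)[of z'] z' that by (auto simp: N_def)
      from wind_base[OF gz this] show ?thesis using k[of k] by (auto split: if_splits)
    qed
    have "\<gamma> k \<in> ?A k" if "\<bar>k\<bar> \<le> N" for k
    proof (rule ccontr)
      assume "\<gamma> k \<notin> ?A k"
      moreover have "k \<in> {-N..N}" using that by auto
      then have "w z' (x z' k) \<in> ?U k" using z' by blast
      ultimately have "\<bar>w z' (x z' k) (\<gamma> k) - 0\<bar> < 1/4" by blast
      then have "w z' (x z' k) (\<gamma> k) < 1/4" by linarith
      moreover have "x z' k \<in> {x z' k..y z' k}" using goodD(3)[OF gz] by simp
      ultimately show False using wind_nonzero[OF gz _ k] by force
    qed
    then show ?thesis using 1 by auto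
  qed
  have cont: "continuous_map (subtopology Z ?W) euclideanreal (\<lambda>z. prodpt (wind (w z) (x z) (y z)) \<gamma>)" if \<gamma>: "\<gamma> \<in> ?B" for \<gamma>
  proof (rule continuous_map_eq)
    show "continuous_map (subtopology Z ?W) euclideanreal
        (\<lambda>z. Min (insert 1 ((\<lambda>k. wind (w z) (x z) (y z) k (\<gamma> k)) ` {-N..N})))"
      by (intro continuous_map_Min continuous_map_from_subtopology continuous_map_wind[OF w x y g]) auto
    fix z' assume "z' \<in> topspace (subtopology Z ?W)"
    then have z': "z' \<in> ?W" "z' \<in> topspace Z" by auto
    have "wind (w z') (x z') (y z') k (\<gamma> k) = 1" if "k \<notin> {-N..N}" for k
    proof -
      have Nk: "N \<le> \<bar>k\<bar>" using that by auto
      then have "base_beyond N0 (w z') (x z') (y z')" "N0 \<le> \<bar>k\<bar>" using O'(3)[of z'] z' by (auto simp: N_def)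
      then show ?thesis using wind_base[OF g[OF z'(2)]] \<gamma> Nk by auto
    qed
    then show "Min (insert 1 ((\<lambda>k. wind (w z') (x z') (y z') k (\<gamma> k)) ` {-N..N})) = prodpt (wind (w z') (x z') (y z')) \<gamma>"
      unfolding prodpt_def by (rule fmin_eq[symmetric])
  qed
  show "\<exists>N A. openin Z N \<and> z \<in> N \<and> finite A \<and>
           (\<forall>y'\<in>N. \<forall>v. v \<notin> A \<longrightarrow> prodpt (wind (w y') (x y') (y y')) v = 0) \<and>
           (\<forall>v\<in>A. continuous_map (subtopology Z N) euclideanreal (\<lambda>y'. prodpt (wind (w y') (x y') (y y')) v))"
  proof (intro exI[of _ ?W] exI[of _ ?B] conjI W zW B ballI allI impI)
    show "prodpt (wind (w y') (x y') (y y')) \<gamma> = 0" if "y' \<in> ?W" "\<gamma> \<notin> ?B" for y' \<gamma>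
      using supp[OF that(1), of \<gamma>] that(2) by argo
    show "continuous_map (subtopology Z ?W) euclideanreal (\<lambda>y'. prodpt (wind (w y') (x y') (y y')) \<gamma>)" if "\<gamma> \<in> ?B" for \<gamma>
      by (rule cont[OF that])
  qed
qed

end

section \<open>The homotopy equivalence\<close>

lemma homotopic_withI:
  assumes "continuous_map (prod_topology unit_interval X) Y (\<lambda>(l, x). h l x)"
    and "\<And>x. x \<in> topspace X \<Longrightarrow> h 0 x = f x" "\<And>x. x \<in> topspace X \<Longrightarrow> h 1 x = g x"
  shows "homotopic_with (\<lambda>_. True) X Y f g"
proof (subst homotopic_with)
  show "\<exists>h. continuous_map (prod_topology unit_interval X) Y h \<and> (\<forall>x\<in>topspace X. h (0, x) = f x) \<and>
        (\<forall>x\<in>topspace X. h (1, x) = g x) \<and> (\<forall>t\<in>{0..1}. True)"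
    using assms by (intro exI[of _ "\<lambda>(l, x). h l x"]) auto
qed simp

lemma clip_mono: "a \<le> a' \<Longrightarrow> b \<le> b' \<Longrightarrow> t \<le> t' \<Longrightarrow> clip a b t \<le> clip a' b' t'"
  by (auto simp: clip_def max_def min_def)

text \<open>While \<open>l \<le> b1\<close> the right end still rests at \<open>b1\<close>; once
  \<open>l \<ge> a2\<close> the left end has arrived at \<open>a2\<close>; for
  \<open>b1 < l < a2\<close> both ends sit at \<open>l\<close>.\<close>

lemma clip_window:
  assumes "a1 \<le> b1" "a2 \<le> b2" "a1 \<le> a2" "b1 \<le> b2"
  shows "{clip a1 a2 l..clip b1 b2 l} \<subseteq> {a1..b1} \<or> {clip a1 a2 l..clip b1 b2 l} \<subseteq> {a2..b2} \<or> clip a1 a2 l = clip b1 b2 l"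
  using assms by (auto simp: clip_def max_def min_def)

text \<open>The minimum window is contained in whichever window supplies its left end.\<close>

lemma min_window:
  fixes a1 :: real
  assumes "a1 \<le> b1" "a2 \<le> b2"
  shows "{min a1 a2..min b1 b2} \<subseteq> {a1..b1} \<or> {min a1 a2..min b1 b2} \<subseteq> {a2..b2}"
  using assms by (auto simp: min_def)

lemma clip_01_Lipschitz: "a \<le> b \<Longrightarrow> clip 0 1 b - clip 0 1 a \<le> b - a"
  by (auto simp: clip_def max_def min_def)

context based_bigraph
begin

abbreviation "loops \<equiv> based_loops TB bpt"

lemma loopsD:
  assumes "w \<in> loops"
  shows "continuous_map unit_interval TB w" "w t \<in> MB" "t \<le> 0 \<or> 1 \<le> t \<Longrightarrow> w t = bpt"
proof -
  show c: "continuous_map unit_interval TB w" using assms by (simp add: based_loops_def)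
  show "w t = bpt" if "t \<le> 0 \<or> 1 \<le> t" for t
  proof -
    have "t = 0 \<or> t = 1 \<or> t \<notin> {0..1}" using that by auto
    then show ?thesis using assms by (auto simp: based_loops_def)
  qed
  then show "w t \<in> MB"
    using continuous_map_image_subset_topspace[OF c] bpt_in_MB by (cases "t \<in> {0..1}") auto
qed

section \<open>Lebesgue numbers of loops\<close>

definition lebset :: "(real \<Rightarrow> 'v \<Rightarrow> real) \<Rightarrow> real set" where
  "lebset w = {s. 0 \<le> s \<and> (\<forall>a b k. 0 \<le> a \<longrightarrow> a \<le> b \<longrightarrow> b \<le> 1 \<longrightarrow> b - a \<le> s \<longrightarrow>
     (\<exists>v. c v = par k \<and> (\<forall>t\<in>{a..b}. 1/2 + s \<le> w t v)))}"

text \<open>A Lebesgue number of the loop. Because the length bound and the height bound in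
  \<open>lebset\<close> are tied to the same \<open>s\<close>, its supremum is 1-Lipschitz in the loop.\<close>
definition leb :: "(real \<Rightarrow> 'v \<Rightarrow> real) \<Rightarrow> real" where
  "leb w = Sup (lebset w) / 6"

lemma lebset_le:
  assumes w: "w \<in> loops" and s: "s \<in> lebset w" shows "s \<le> 1/2"
proof -
  obtain v where "1/2 + s \<le> w 0 v"
    using s[unfolded lebset_def, simplified, THEN conjunct2, rule_format, of 0 0 0] s by (auto simp: lebset_def)
  then show ?thesis using MB_D(2)[OF loopsD(2)[OF w], of 0 v] by simp
qed

lemma lebset_0:
  assumes w: "w \<in> loops" shows "0 \<in> lebset w"
proof -
  have "\<exists>v. c v = par k \<and> (\<forall>t\<in>{a..b}. 1/2 \<le> w t v)" if "a \<le> b" "b - a \<le> 0" for a b k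
  proof -
    obtain v where "c v = par k" "w a v = 1" using MB_D(6)[OF loopsD(2)[OF w, of a], of k] by blast
    moreover have "t = a" if "t \<in> {a..b}" for t using that \<open>b - a \<le> 0\<close> by auto
    ultimately have "\<forall>t\<in>{a..b}. 1/2 \<le> w t v" by force
    then show ?thesis using \<open>c v = par k\<close> by blast
  qed
  then show ?thesis by (simp add: lebset_def)
qed

lemma bdd_above_lebset: "w \<in> loops \<Longrightarrow> bdd_above (lebset w)"
  using lebset_le by (intro bdd_aboveI[of _ "1/2"]) auto

lemma Sup_lebset_Lipschitz:
  assumes w: "w \<in> loops" "w' \<in> loops" and e: "\<And>t v. t \<in> {0..1} \<Longrightarrow> \<bar>w t v - w' t v\<bar> \<le> e"
  shows "Sup (lebset w) - e \<le> Sup (lebset w')"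
proof -
  have e0: "0 \<le> e" using e[of 0] abs_ge_zero order_trans by (metis atLeastAtMost_iff order_refl zero_le_one)
  have "s \<le> Sup (lebset w') + e" if s: "s \<in> lebset w" for s
  proof (cases "e \<le> s")
    case True
    \<comment> \<open>Heights drop by at most \<open>e\<close>, and a window of length at most
      \<open>s - e\<close> already satisfies the length bound for \<open>s\<close>.\<close>
    have "s - e \<in> lebset w'"
      unfolding lebset_def
    proof (intro CollectI conjI allI impI)
      fix a b k assume ab: "0 \<le> a" "a \<le> b" "b \<le> 1" "b - a \<le> s - e"
      then have "b - a \<le> s" using e0 by simp
      then obtain v where v: "c v = par k" "\<And>t. t \<in> {a..b} \<Longrightarrow> 1/2 + s \<le> w t v"
        using s ab unfolding lebset_def by blast
      have "1/2 + (s - e) \<le> w' t v" if "t \<in> {a..b}" for t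
        using v(2)[OF that] e[of t v] that ab by auto
      then show "\<exists>v. c v = par k \<and> (\<forall>t\<in>{a..b}. 1/2 + (s - e) \<le> w' t v)" using v(1) by blast
    qed (use True in simp)
    then have "s - e \<le> Sup (lebset w')" by (rule cSup_upper[OF _ bdd_above_lebset[OF w(2)]])
    then show ?thesis by simp
  next
    case False
    have "0 \<le> Sup (lebset w')" by (rule cSup_upper[OF lebset_0[OF w(2)] bdd_above_lebset[OF w(2)]])
    then show ?thesis using False by simp
  qed
  then have "Sup (lebset w) \<le> Sup (lebset w') + e"
    using lebset_0[OF w(1)] by (intro cSup_least) auto
  then show ?thesis by simp
qed

lemma openin_near: "q \<in> MB \<Longrightarrow> 0 < e \<Longrightarrow> openin TB {r \<in> MB. \<forall>v\<in>UNIV. \<bar>r v - q v\<bar> < e}"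
  by (rule openin_weak_top_bound[OF finite_support_MB finite_support_MB])

text \<open>The Lebesgue number lemma is applied to sets of times on which \<open>w\<close> stays
  uniformly within 1/4 of one of its values. A vertex of weight 1 for that value keeps more than
  3/4, which is at least \<open>1/2 + s\<close> for \<open>s \<le> 1/4\<close>.\<close>

lemma leb_pos:
  assumes w: "w \<in> loops" shows "0 < leb w"
proof -
  let ?C = "{G. open G \<and> (\<exists>t0. \<forall>t\<in>G \<inter> {0..1}. \<forall>v. \<bar>w t v - w t0 v\<bar> < 1/4)}"
  have cov: "\<exists>G\<in>?C. t0 \<in> G" if t0: "t0 \<in> {0..1}" for t0
  proof -
    let ?O = "{r \<in> MB. \<forall>v\<in>UNIV. \<bar>r v - w t0 v\<bar> < 1/4}"
    have "openin unit_interval {t \<in> topspace unit_interval. w t \<in> ?O}"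
      by (rule openin_continuous_map_preimage[OF loopsD(1)[OF w] openin_near[OF loopsD(2)[OF w]]]) simp
    then obtain G where G: "open G" "{t \<in> topspace unit_interval. w t \<in> ?O} = {0..1} \<inter> G"
      by (auto simp: openin_open)
    have "t0 \<in> {t \<in> topspace unit_interval. w t \<in> ?O}" using t0 loopsD(2)[OF w] by simp
    then have "t0 \<in> G" using G(2) by blast
    moreover have "\<bar>w t v - w t0 v\<bar> < 1/4" if "t \<in> G \<inter> {0..1}" for t v
    proof -
      have "t \<in> {t \<in> topspace unit_interval. w t \<in> ?O}" using G(2) that by blast
      then show ?thesis by blast
    qed
    ultimately show ?thesis using G(1) by blast
  qed
  have "\<exists>G. G \<in> ?C" using cov[of 0] by auto
  then have "?C \<noteq> {}" by blast
  moreover have "{0..1} \<subseteq> \<Union>?C" using cov by blast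
  ultimately obtain d where d: "0 < d" "\<And>T. T \<subseteq> {0..1} \<Longrightarrow> diameter T < d \<Longrightarrow> \<exists>B\<in>?C. T \<subseteq> B"
    using Lebesgue_number_lemma[of "{0..1::real}" ?C] by (metis (no_types, lifting) compact_Icc mem_Collect_eq)
  \<comment> \<open>Half of \<open>d\<close>, because diameters must be strictly below
    \<open>d\<close>.\<close>
  define s where "s = min (1/4) (d / 2)"
  have "s \<in> lebset w"
    unfolding lebset_def
  proof (intro CollectI conjI allI impI)
    show "0 \<le> s" using d by (simp add: s_def)
    fix a b k assume ab: "0 \<le> a" "a \<le> b" "b \<le> 1" "b - a \<le> s"
    then have "diameter {a..b} < d" using d(1) by (simp add: s_def min_def split: if_splits)
    moreover have "{a..b} \<subseteq> {0..1}" using ab by auto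
    ultimately obtain G t0 where G: "{a..b} \<subseteq> G" "\<And>t v. t \<in> G \<inter> {0..1} \<Longrightarrow> \<bar>w t v - w t0 v\<bar> < 1/4"
      using d(2)[of "{a..b}"] by blast
    obtain v where v: "c v = par k" "w t0 v = 1" using MB_D(6)[OF loopsD(2)[OF w, of t0], of k] by blast
    have "1/2 + s \<le> w t v" if "t \<in> {a..b}" for t
    proof -
      have "\<bar>w t v - w t0 v\<bar> < 1/4" using G \<open>{a..b} \<subseteq> {0..1}\<close> that by blast
      moreover have "s \<le> 1/4" by (simp add: s_def)
      ultimately show ?thesis using v(2) by linarith
    qed
    then show "\<exists>v. c v = par k \<and> (\<forall>t\<in>{a..b}. 1/2 + s \<le> w t v)" using v(1) by blast
  qed
  then have "s \<le> Sup (lebset w)" by (rule cSup_upper[OF _ bdd_above_lebset[OF w]])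
  moreover have "0 < s" using d by (simp add: s_def)
  ultimately show ?thesis by (simp add: leb_def)
qed

lemma leb_window:
  assumes w: "w \<in> loops" and ab: "0 \<le> a" "a \<le> b" "b \<le> 1" "b - a \<le> 3 * leb w"
  shows "\<exists>v. c v = par k \<and> (\<forall>t\<in>{a..b}. 1/2 \<le> w t v)"
proof -
  \<comment> \<open>Origin of the divisor 6 in \<open>leb\<close>: the length
    \<open>3 * leb w\<close> is half of the supremum, hence strictly below it and below some member
    of \<open>lebset w\<close>.\<close>
  have "b - a < Sup (lebset w)" using ab(4) leb_pos[OF w] by (simp add: leb_def)
  moreover have "lebset w \<noteq> {}" using lebset_0[OF w] by blast
  ultimately obtain s where s: "s \<in> lebset w" "b - a < s"
    using less_cSupD[of "lebset w" "b - a"] by blast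
  have ex: "\<exists>v. c v = par k \<and> (\<forall>t\<in>{a..b}. 1/2 + s \<le> w t v)"
    using s ab by (simp add: lebset_def)
  then obtain v where v: "c v = par k" "\<And>t. t \<in> {a..b} \<Longrightarrow> 1/2 + s \<le> w t v" by blast
  have "0 \<le> s" using s(1) by (simp add: lebset_def)
  then have "1/2 \<le> w t v" if "t \<in> {a..b}" for t using v(2)[OF that] by linarith
  then show ?thesis using v(1) by blast
qed

text \<open>The compact-open topology controls the sup norm over all times and vertices. For each
  \<open>t0\<close>, pairs of a loop and a time with value near \<open>w t0\<close> are restricted
  to times at which \<open>w\<close> is near \<open>w t0\<close> as well; these sets are open, and
  the tube lemma makes the estimate uniform.\<close>

lemma loop_nbhd:
  assumes w: "w \<in> loops" and e: "0 < e"
  shows "\<exists>N. openin LB N \<and> w \<in> N \<and> (\<forall>w'\<in>N. \<forall>t\<in>{0..1}. \<forall>v. \<bar>w' t v - w t v\<bar> < e)"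
proof -
  let ?P = "prod_topology LB unit_interval"
  let ?B = "\<lambda>t. {r \<in> MB. \<forall>v\<in>UNIV. \<bar>r v - w t v\<bar> < e/2}"
  let ?ev = "\<lambda>p. case p of (\<omega>, t) \<Rightarrow> \<omega> t"
  let ?O = "\<lambda>t0. {p \<in> topspace ?P. ?ev p \<in> ?B t0} \<inter> (topspace LB \<times> {t \<in> topspace unit_interval. w t \<in> ?B t0})"
  have B: "openin TB (?B t)" for t by (rule openin_near[OF loopsD(2)[OF w]]) (use e in simp)
  have O: "openin ?P (?O t0)" for t0
  proof (rule openin_Int)
    show "openin ?P {p \<in> topspace ?P. ?ev p \<in> ?B t0}"
      by (rule openin_continuous_map_preimage[OF continuous_map_loop_eval B])
    have "openin unit_interval {t \<in> topspace unit_interval. w t \<in> ?B t0}"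
      by (rule openin_continuous_map_preimage[OF loopsD(1)[OF w] B])
    then show "openin ?P (topspace LB \<times> {t \<in> topspace unit_interval. w t \<in> ?B t0})"
      by (simp only: openin_prod_Times_iff openin_topspace simp_thms)
  qed
  have W: "openin ?P (\<Union>t0\<in>{0..1}. ?O t0)" using O by blast
  have wt: "w \<in> topspace LB" using w by simp
  have wB: "w t \<in> ?B t" for t using loopsD(2)[OF w] e by simp
  have "{w} \<times> {0..1} \<subseteq> (\<Union>t0\<in>{0..1}. ?O t0)"
  proof
    fix p assume "p \<in> {w} \<times> {0..1::real}"
    then obtain t where "p = (w, t)" "t \<in> {0..1}" by blast
    then have "p \<in> ?O t" using wB[of t] wt by simp
    then show "p \<in> (\<Union>t0\<in>{0..1}. ?O t0)" using \<open>t \<in> {0..1}\<close> by blast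
  qed
  from tube_lemma_right[OF W compactin_unit_interval wt this]
  obtain N M where N: "openin LB N" "w \<in> N" "{0..1} \<subseteq> M" "N \<times> M \<subseteq> (\<Union>t0\<in>{0..1}. ?O t0)" by blast
  have "\<bar>w' t v - w t v\<bar> < e" if "w' \<in> N" "t \<in> {0..1}" for w' t v
  proof -
    have "(w', t) \<in> N \<times> M" using that N(3) by blast
    with N(4) have "(w', t) \<in> (\<Union>t0\<in>{0..1}. ?O t0)" by (rule subsetD)
    then obtain t0 where "w' t \<in> ?B t0" "w t \<in> ?B t0" by auto
    then have "\<bar>w' t v - w t0 v\<bar> < e/2" "\<bar>w t v - w t0 v\<bar> < e/2" by blast+
    then show ?thesis by linarith
  qed
  then show ?thesis using N by blast
qed

lemma continuous_map_leb: "continuous_map LB euclideanreal leb"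
proof (rule continuous_map_realI)
  fix w and e :: real assume "w \<in> topspace LB" and e: "0 < e"
  then have w: "w \<in> loops" by simp
  obtain N where N: "openin LB N" "w \<in> N" "\<And>w' t v. w' \<in> N \<Longrightarrow> t \<in> {0..1} \<Longrightarrow> \<bar>w' t v - w t v\<bar> < e"
    using loop_nbhd[OF w e] by blast
  have "\<bar>leb w' - leb w\<bar> < e" if w': "w' \<in> N" for w'
  proof -
    have l: "w' \<in> loops" using openin_subset[OF N(1)] w' by auto
    have "Sup (lebset w') - e \<le> Sup (lebset w)"
      using N(3)[OF w'] by (intro Sup_lebset_Lipschitz[OF l w]) (simp add: less_imp_le)
    moreover have "Sup (lebset w) - e \<le> Sup (lebset w')"
      using N(3)[OF w'] by (intro Sup_lebset_Lipschitz[OF w l]) (simp add: less_imp_le abs_minus_commute)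
    ultimately show ?thesis using e unfolding leb_def by linarith
  qed
  then show "\<exists>N. openin LB N \<and> w \<in> N \<and> (\<forall>y\<in>N. \<bar>leb y - leb w\<bar> < e)" using N by blast
qed

text \<open>The \<open>k\<close>-th window is three mesh widths long because \<open>line p s\<close> involves every \<open>k\<close>
  with \<open>\<bar>s - k\<bar> < 3/2\<close>, and all these windows have to contain one common time.\<close>
definition finex :: "(real \<Rightarrow> 'v \<Rightarrow> real) \<Rightarrow> int \<Rightarrow> real" where
  "finex w k = clip 0 1 ((of_int k - 1) * leb w)"

definition finey :: "(real \<Rightarrow> 'v \<Rightarrow> real) \<Rightarrow> int \<Rightarrow> real" where
  "finey w k = clip 0 1 ((of_int k + 2) * leb w)"

text \<open>The bound depends only on a lower bound \<open>d\<close> of \<open>leb w\<close>, hence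
  is locally uniform in \<open>w\<close>. Once \<open>(k - 1) * d \<ge> 1\<close> the left end is
  clipped to 1; for \<open>k \<le> - 2\<close> the right end is clipped to 0.\<close>

lemma fine_base_beyond:
  assumes w: "w \<in> loops" and d: "0 < d" "d \<le> leb w"
  shows "base_beyond (\<lceil>1 / d\<rceil> + 2) w (finex w) (finey w)"
  unfolding base_beyond_def
proof (intro conjI allI impI)
  have l: "0 < leb w" by (rule leb_pos[OF w])
  have "0 \<le> 1 / d" using d by simp
  then have d0: "0 \<le> \<lceil>1 / d\<rceil>" by linarith
  fix k t
  show "w t = bpt" if 1: "\<lceil>1 / d\<rceil> + 2 \<le> k" and t: "finex w k \<le> t"
  proof -
    from 1 have "real_of_int (\<lceil>1 / d\<rceil> + 1) \<le> real_of_int (k - 1)" by (simp only: of_int_le_iff)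
    then have "real_of_int \<lceil>1 / d\<rceil> + 1 \<le> real_of_int k - 1" by simp
    then have "1 / d \<le> real_of_int k - 1" using le_of_int_ceiling[of "1 / d"] by linarith
    moreover have "0 \<le> real_of_int k - 1" using \<open>0 \<le> 1 / d\<close> calculation by linarith
    ultimately have "1 / d * d \<le> (real_of_int k - 1) * leb w" using d by (intro mult_mono) simp_all
    then have "finex w k = 1" using d by (simp add: finex_def clip_def)
    then show ?thesis using t loopsD(3)[OF w] by simp
  qed
  show "w t = bpt" if 2: "k \<le> - (\<lceil>1 / d\<rceil> + 2)" and t: "t \<le> finey w k"
  proof -
    have "k \<le> - 2" using 2 d0 by linarith
    then have "real_of_int k + 2 \<le> 0" by simp
    then have "(real_of_int k + 2) * leb w \<le> 0" using l by (intro mult_nonpos_nonneg) auto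
    then have "finey w k = 0" by (simp add: finey_def clip_def)
    then show ?thesis using t loopsD(3)[OF w] by simp
  qed
qed

lemma fine_good:
  assumes w: "w \<in> loops" shows "good w (finex w) (finey w)"
  unfolding good_def
proof (intro conjI allI ballI)
  have l: "0 < leb w" by (rule leb_pos[OF w])
  show "w t \<in> MB" for t by (rule loopsD(2)[OF w])
  fix k
  have m: "clip 0 1 (a * leb w) \<le> clip 0 1 (b * leb w)" if "a \<le> b" for a b
    using that l by (intro clip_mono mult_right_mono) auto
  show b: "0 \<le> finex w k" "finex w k \<le> finey w k" "finey w k \<le> 1"
      "finex w (k + 1) \<le> finey w k" "finex w k \<le> finey w (k + 1)"
    unfolding finex_def finey_def using m clip_bounds[of 0 1] by auto
  \<comment> \<open>From \<open>k - 1\<close> to \<open>k + 2\<close> there are three mesh widths,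
    exactly what \<open>leb_window\<close> allows.\<close>
  have "finey w k - finex w k \<le> (of_int k + 2) * leb w - (of_int k - 1) * leb w"
    unfolding finex_def finey_def using l by (intro clip_01_Lipschitz mult_right_mono) auto
  then have "finey w k - finex w k \<le> 3 * leb w" by (simp add: algebra_simps)
  then show "\<exists>v. c v = par k \<and> (\<forall>t\<in>{finex w k..finey w k}. 1/2 \<le> w t v)"
    by (rule leb_window[OF w b(1,2,3)])
  show "\<exists>N. base_beyond N w (finex w) (finey w)" using fine_base_beyond[OF w l] by blast
qed

definition clique_of :: "(real \<Rightarrow> 'v \<Rightarrow> real) \<Rightarrow> (int \<Rightarrow> 'v) \<Rightarrow> real" where
  "clique_of w = prodpt (wind w (finex w) (finey w))"

lemma continuous_map_fine:
  assumes "continuous_map Z LB f"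
  shows "continuous_map Z euclideanreal (\<lambda>z. finex (f z) k)" "continuous_map Z euclideanreal (\<lambda>z. finey (f z) k)"
proof -
  have "continuous_map Z euclideanreal (\<lambda>z. leb (f z))"
    using continuous_map_compose[OF assms continuous_map_leb] by (simp add: o_def)
  then show "continuous_map Z euclideanreal (\<lambda>z. finex (f z) k)" "continuous_map Z euclideanreal (\<lambda>z. finey (f z) k)"
    unfolding finex_def finey_def by (intro continuous_map_clip continuous_map_real_mult; simp)+
qed

lemma fine_locally_base_beyond:
  assumes f: "continuous_map Z LB f" and z: "z \<in> topspace Z"
  shows "\<exists>O' N. openin Z O' \<and> z \<in> O' \<and> (\<forall>z'\<in>O'. base_beyond N (f z') (finex (f z')) (finey (f z')))"
proof -
  have c: "continuous_map Z euclideanreal (\<lambda>z. leb (f z))"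
    using continuous_map_compose[OF f continuous_map_leb] by (simp add: o_def)
  have fl: "f z' \<in> loops" if "z' \<in> topspace Z" for z'
    using continuous_map_image_subset_topspace[OF f] that by auto
  \<comment> \<open>By continuity of \<open>leb\<close>, nearby loops keep more than half of the
    mesh width.\<close>
  let ?d = "leb (f z) / 2"
  let ?O = "{z' \<in> topspace Z. leb (f z') \<in> {?d<..}}"
  have d: "0 < ?d" using leb_pos[OF fl[OF z]] by simp
  have "openin Z ?O" by (rule openin_continuous_map_preimage[OF c]) simp
  moreover have "z \<in> ?O" using z d by simp
  moreover have "base_beyond (\<lceil>1 / ?d\<rceil> + 2) (f z') (finex (f z')) (finey (f z'))" if "z' \<in> ?O" for z'
    using that by (intro fine_base_beyond fl d) auto
  ultimately show ?thesis by blast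
qed

lemma continuous_map_clique_of: "continuous_map LB TC clique_of"
proof -
  have id: "continuous_map LB LB (\<lambda>w. w)" by simp
  have "continuous_map LB TC (\<lambda>w. prodpt (wind w (finex w) (finey w)))"
  proof (rule continuous_map_prodpt_wind)
    show "continuous_map (prod_topology LB unit_interval) TB (\<lambda>(z, t). z t)" by (rule continuous_map_loop_eval)
    show "continuous_map LB euclideanreal (\<lambda>z. finex z k)" "continuous_map LB euclideanreal (\<lambda>z. finey z k)" for k
      by (rule continuous_map_fine[OF id])+
    show "good z (finex z) (finey z)" if "z \<in> topspace LB" for z using that fine_good by simp
    show "\<exists>O' N. openin LB O' \<and> z \<in> O' \<and> (\<forall>z'\<in>O'. base_beyond N z' (finex z') (finey z'))" if "z \<in> topspace LB" for z
      by (rule fine_locally_base_beyond[OF id that])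
  qed
  then show ?thesis by (simp add: clique_of_def[abs_def])
qed

section \<open>Comparison of window systems\<close>

text \<open>Windows chosen continuously for the loops of clique points. Uniformity of the based
  tails is asked on finite parts, which is where homotopies on \<open>TC\<close> are tested.\<close>

definition wsys :: "(((int \<Rightarrow> 'v) \<Rightarrow> real) \<Rightarrow> int \<Rightarrow> real) \<Rightarrow> (((int \<Rightarrow> 'v) \<Rightarrow> real) \<Rightarrow> int \<Rightarrow> real) \<Rightarrow> bool" where
  "wsys x y \<longleftrightarrow> (\<forall>u\<in>MC. good (loop_of u) (x u) (y u)) \<and>
     (\<forall>k. continuous_map TC euclideanreal (\<lambda>u. x u k) \<and> continuous_map TC euclideanreal (\<lambda>u. y u k)) \<and>
     (\<forall>A. finite A \<longrightarrow> (\<forall>u\<in>part MC A. \<exists>O' N. openin (part_top MC A) O' \<and> u \<in> O' \<and> (\<forall>u'\<in>O'. base_beyond N (loop_of u') (x u') (y u'))))"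

lemma base_beyond_sub:
  assumes "base_beyond N w x y" "base_beyond N' w x' y'"
    and "\<And>k. min (x k) (x' k) \<le> xx k \<and> yy k \<le> max (y k) (y' k)"
  shows "base_beyond (max N N') w xx yy"
  unfolding base_beyond_def
proof (intro conjI allI impI)
  fix k t
  show "w t = bpt" if "max N N' \<le> k" "xx k \<le> t"
  proof -
    have "x k \<le> t \<or> x' k \<le> t" using assms(3)[of k] that(2) by linarith
    then show ?thesis using assms(1,2) that(1) by (auto simp: base_beyond_def)
  qed
  show "w t = bpt" if "k \<le> - max N N'" "t \<le> yy k"
  proof -
    have "t \<le> y k \<or> t \<le> y' k" using assms(3)[of k] that(2) by linarith
    moreover have "k \<le> - N" "k \<le> - N'" using that(1) by auto
    ultimately show ?thesis using assms(1,2) unfolding base_beyond_def by blast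
  qed
qed

text \<open>A window inside an admissible one inherits its witness vertex; a one-point window has a
  witness because \<open>w\<close> takes values in \<open>MB\<close>.\<close>

lemma good_sub:
  assumes "good w x y" "good w x' y'"
    and "\<And>k. xx k \<le> yy k \<and> xx (k + 1) \<le> yy k \<and> xx k \<le> yy (k + 1)"
    and btw: "\<And>k. min (x k) (x' k) \<le> xx k \<and> yy k \<le> max (y k) (y' k)"
    and sub: "\<And>k. {xx k..yy k} \<subseteq> {x k..y k} \<or> {xx k..yy k} \<subseteq> {x' k..y' k} \<or> xx k = yy k"
  shows "good w xx yy"
  unfolding good_def
proof (intro conjI allI ballI)
  show "w t \<in> MB" if "t \<in> {0..1}" for t by (rule goodD(1)[OF assms(1) that])
  fix k
  show "xx k \<le> yy k" "xx (k + 1) \<le> yy k" "xx k \<le> yy (k + 1)" using assms(3) by auto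
  show b: "0 \<le> xx k" "yy k \<le> 1"
    using btw[of k] goodD(2,4)[OF assms(1), of k] goodD(2,4)[OF assms(2), of k] by auto
  show "\<exists>v. c v = par k \<and> (\<forall>t\<in>{xx k..yy k}. 1/2 \<le> w t v)"
  proof (cases "xx k = yy k")
    case True
    then have "w (xx k) \<in> MB" using b by (intro goodD(1)[OF assms(1)]) simp
    then obtain v where "c v = par k" "w (xx k) v = 1" using MB_D(6) by blast
    then show ?thesis using True by (intro exI[of _ v]) simp
  next
    case False
    then show ?thesis using sub[of k] goodD(7)[OF assms(1), of k] goodD(7)[OF assms(2), of k] by blast
  qed
  obtain N N' where "base_beyond N w x y" "base_beyond N' w x' y'" using goodD(8) assms(1,2) by blast
  then show "\<exists>N. base_beyond N w xx yy" using base_beyond_sub[of N w x y N' x' y' xx yy] btw by blast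
qed

lemma wsys_local:
  assumes "wsys x y" "finite A" "u \<in> part MC A"
  shows "\<exists>O' N. openin (part_top MC A) O' \<and> u \<in> O' \<and> (\<forall>u'\<in>O'. base_beyond N (loop_of u') (x u') (y u'))"
  using assms by (simp add: wsys_def)

lemma wsys_local_pair:
  assumes "wsys x y" "wsys x' y'" "finite A" "u \<in> part MC A"
  obtains O' N N' where "openin (part_top MC A) O'" "u \<in> O'"
    "\<And>u'. u' \<in> O' \<Longrightarrow> base_beyond N (loop_of u') (x u') (y u')"
    "\<And>u'. u' \<in> O' \<Longrightarrow> base_beyond N' (loop_of u') (x' u') (y' u')"
proof -
  obtain O1 N where 1: "openin (part_top MC A) O1" "u \<in> O1" "\<And>u'. u' \<in> O1 \<Longrightarrow> base_beyond N (loop_of u') (x u') (y u')"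
    using wsys_local[OF assms(1,3,4)] by blast
  obtain O2 N' where 2: "openin (part_top MC A) O2" "u \<in> O2" "\<And>u'. u' \<in> O2 \<Longrightarrow> base_beyond N' (loop_of u') (x' u') (y' u')"
    using wsys_local[OF assms(2,3,4)] by blast
  show ?thesis by (rule that[of "O1 \<inter> O2" N N']) (use 1 2 in auto)
qed

lemma wsysD:
  assumes "wsys x y"
  shows "u \<in> MC \<Longrightarrow> good (loop_of u) (x u) (y u)" "continuous_map TC euclideanreal (\<lambda>u. x u k)"
    "continuous_map TC euclideanreal (\<lambda>u. y u k)"
  using assms unfolding wsys_def by blast+

text \<open>A sweep moves endpoints only to the right. The pointwise minimum precedes both systems,
  so it links systems that are not comparable with each other.\<close>

lemma wsys_min:
  assumes "wsys x y" "wsys x' y'"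
  shows "wsys (\<lambda>u k. min (x u k) (x' u k)) (\<lambda>u k. min (y u k) (y' u k))"
  unfolding wsys_def
proof (intro conjI ballI allI impI)
  have sub: "{min (x u k) (x' u k)..min (y u k) (y' u k)} \<subseteq> {x u k..y u k} \<or>
        {min (x u k) (x' u k)..min (y u k) (y' u k)} \<subseteq> {x' u k..y' u k} \<or>
        min (x u k) (x' u k) = min (y u k) (y' u k)" if "u \<in> MC" for u k
    using min_window[OF goodD(3)[OF wsysD(1)[OF assms(1) that]] goodD(3)[OF wsysD(1)[OF assms(2) that]]]
    by (simp only: disj_assoc[symmetric] simp_thms)
  show "good (loop_of u) (\<lambda>k. min (x u k) (x' u k)) (\<lambda>k. min (y u k) (y' u k))" if u: "u \<in> MC" for u
  proof (rule good_sub[OF wsysD(1)[OF assms(1) u] wsysD(1)[OF assms(2) u] _ _ sub[OF u]])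
    fix k
    show "min (x u k) (x' u k) \<le> min (y u k) (y' u k) \<and> min (x u (k + 1)) (x' u (k + 1)) \<le> min (y u k) (y' u k) \<and>
        min (x u k) (x' u k) \<le> min (y u (k + 1)) (y' u (k + 1))"
      using goodD(3,5,6)[OF wsysD(1)[OF assms(1) u], of k] goodD(3,5,6)[OF wsysD(1)[OF assms(2) u], of k]
      by (auto intro: min.coboundedI1 min.coboundedI2)
  qed simp
  show "continuous_map TC euclideanreal (\<lambda>u. min (x u k) (x' u k))"
    "continuous_map TC euclideanreal (\<lambda>u. min (y u k) (y' u k))" for k
    by (intro continuous_map_real_min wsysD(2,3)[OF assms(1)] wsysD(2,3)[OF assms(2)])+
  fix A :: "(int \<Rightarrow> 'v) set" and u assume A: "finite A" and u: "u \<in> part MC A"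
  obtain O' N N' where O': "openin (part_top MC A) O'" "u \<in> O'"
    "\<And>u'. u' \<in> O' \<Longrightarrow> base_beyond N (loop_of u') (x u') (y u')"
    "\<And>u'. u' \<in> O' \<Longrightarrow> base_beyond N' (loop_of u') (x' u') (y' u')" by (rule wsys_local_pair[OF assms A u]) blast
  have "base_beyond (max N N') (loop_of u') (\<lambda>k. min (x u' k) (x' u' k)) (\<lambda>k. min (y u' k) (y' u' k))" if "u' \<in> O'" for u'
    by (rule base_beyond_sub[OF O'(3,4)[OF that]]) simp
  then show "\<exists>O' N. openin (part_top MC A) O' \<and> u \<in> O' \<and>
      (\<forall>u'\<in>O'. base_beyond N (loop_of u') (\<lambda>k. min (x u' k) (x' u' k)) (\<lambda>k. min (y u' k) (y' u' k)))"
    using O'(1,2) by blast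
qed

lemma continuous_map_part_snd:
  assumes "continuous_map TC Y f" "finite A"
  shows "continuous_map (prod_topology Z (part_top MC A)) Y (\<lambda>p. f (snd p))"
proof -
  have "continuous_map (part_top MC A) Y (f \<circ> (\<lambda>u. u))"
    by (rule continuous_map_compose[OF continuous_map_part_top_weak_top[OF assms(2)] assms(1)])
  from continuous_map_compose[OF continuous_map_snd this]
  show ?thesis by (simp add: o_def)
qed

text \<open>The window systems \<open>(x, y)\<close> and \<open>(x', y')\<close> are connected by sweeping a cursor \<open>l\<close> from
  0 to 1: endpoints to the left of the cursor have already been moved. Every intermediate window
  is a point or lies in an old or in a new one, so no fineness is required.\<close>
lemma wsys_sweep:
  assumes s: "wsys x y" "wsys x' y'"
    and le: "\<And>u k. u \<in> MC \<Longrightarrow> x u k \<le> x' u k" "\<And>u k. u \<in> MC \<Longrightarrow> y u k \<le> y' u k"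
  shows "homotopic_with (\<lambda>_. True) TC TC (\<lambda>u. prodpt (wind (loop_of u) (x u) (y u))) (\<lambda>u. prodpt (wind (loop_of u) (x' u) (y' u)))"
proof (rule homotopic_withI)
  let ?x = "\<lambda>l u k. clip (x u k) (x' u k) l" and ?y = "\<lambda>l u k. clip (y u k) (y' u k) l"
  have btw: "min (x u k) (x' u k) \<le> ?x l u k \<and> ?y l u k \<le> max (y u k) (y' u k)" for l u k
    by (auto simp: clip_def)
  have sub: "{?x l u k..?y l u k} \<subseteq> {x u k..y u k} \<or> {?x l u k..?y l u k} \<subseteq> {x' u k..y' u k} \<or> ?x l u k = ?y l u k"
    if "u \<in> MC" for l u k
    by (rule clip_window[OF goodD(3)[OF wsysD(1)[OF s(1) that]] goodD(3)[OF wsysD(1)[OF s(2) that]] le(1)[OF that] le(2)[OF that]])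
  have good: "good (loop_of u) (?x l u) (?y l u)" if u: "u \<in> MC" for l u
    by (rule good_sub[OF wsysD(1)[OF s(1) u] wsysD(1)[OF s(2) u] _ btw sub[OF u]])
      (intro conjI clip_mono goodD[OF wsysD(1)[OF s(1) u]] goodD[OF wsysD(1)[OF s(2) u]] order_refl)
  \<comment> \<open>All endpoints lie in the unit interval: a cursor at 0 has moved none of them, a
    cursor at 1 all of them.\<close>
  have end0: "clip a b 0 = a" if "0 \<le> a" for a b using that by (auto simp: clip_def)
  have end1: "clip a b 1 = b" if "a \<le> b" "b \<le> 1" for a b using that by (auto simp: clip_def)
  show "prodpt (wind (loop_of u) (?x 0 u) (?y 0 u)) = prodpt (wind (loop_of u) (x u) (y u))" if "u \<in> topspace TC" for u
  proof -
    have u: "u \<in> MC" using that by simp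
    have "0 \<le> x u k" "0 \<le> y u k" for k
      using goodD(2,3)[OF wsysD(1)[OF s(1) u], of k] by auto
    then show ?thesis by (simp add: end0)
  qed
  show "prodpt (wind (loop_of u) (?x 1 u) (?y 1 u)) = prodpt (wind (loop_of u) (x' u) (y' u))" if "u \<in> topspace TC" for u
  proof -
    have u: "u \<in> MC" using that by simp
    have "x' u k \<le> 1" "y' u k \<le> 1" for k
      using goodD(3,4)[OF wsysD(1)[OF s(2) u], of k] by auto
    then show ?thesis using le[OF u] by (simp add: end1)
  qed
  show "continuous_map (prod_topology unit_interval TC) TC (\<lambda>(l, u). prodpt (wind (loop_of u) (?x l u) (?y l u)))"
  proof (rule continuous_map_weak_top_prod[OF locally_compact_unit_interval finite_support_MC])
    fix A :: "(int \<Rightarrow> 'v) set" assume A: "finite A"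
    let ?Z = "prod_topology unit_interval (part_top MC A)"
    have MC: "snd z \<in> MC" if "z \<in> topspace ?Z" for z using that by (auto simp: part_def)
    have fst: "continuous_map ?Z euclideanreal fst"
      using continuous_map_fst continuous_map_into_fulltopology by blast
    have "continuous_map ?Z TC (\<lambda>z. prodpt (wind (loop_of (snd z)) (?x (fst z) (snd z)) (?y (fst z) (snd z))))"
    proof (rule continuous_map_prodpt_wind)
      have "continuous_map (prod_topology ?Z unit_interval) (prod_topology (part_top MC A) unit_interval) (\<lambda>p. (snd (fst p), snd p))"
        by (intro continuous_map_pairedI continuous_map_snd continuous_map_compose[OF continuous_map_fst continuous_map_snd, unfolded o_def])
      from continuous_map_compose[OF this continuous_map_loop_of_part[OF A]]
      show "continuous_map (prod_topology ?Z unit_interval) TB (\<lambda>(z, t). loop_of (snd z) t)"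
        by (simp add: o_def case_prod_beta')
      show "continuous_map ?Z euclideanreal (\<lambda>z. ?x (fst z) (snd z) k)"
        "continuous_map ?Z euclideanreal (\<lambda>z. ?y (fst z) (snd z) k)" for k
        by (intro continuous_map_clip fst continuous_map_part_snd[OF wsysD(2)[OF s(1)] A] continuous_map_part_snd[OF wsysD(3)[OF s(1)] A]
            continuous_map_part_snd[OF wsysD(2)[OF s(2)] A] continuous_map_part_snd[OF wsysD(3)[OF s(2)] A])+
      show "good (loop_of (snd z)) (?x (fst z) (snd z)) (?y (fst z) (snd z))" if "z \<in> topspace ?Z" for z
        by (rule good[OF MC[OF that]])
      fix z assume z: "z \<in> topspace ?Z"
      then have u: "snd z \<in> part MC A" by auto
      obtain O' N N' where O': "openin (part_top MC A) O'" "snd z \<in> O'"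
        "\<And>u'. u' \<in> O' \<Longrightarrow> base_beyond N (loop_of u') (x u') (y u')"
        "\<And>u'. u' \<in> O' \<Longrightarrow> base_beyond N' (loop_of u') (x' u') (y' u')" by (rule wsys_local_pair[OF s A u]) blast
      have "base_beyond (max N N') (loop_of u') (?x l u') (?y l u')" if "u' \<in> O'" for u' l
        by (rule base_beyond_sub[OF O'(3,4)[OF that] btw])
      moreover have "openin ?Z (topspace unit_interval \<times> O')"
        using O'(1) by (simp only: openin_prod_Times_iff openin_topspace simp_thms)
      moreover have "z \<in> topspace unit_interval \<times> O'" using z O'(2) by auto
      ultimately show "\<exists>O' N. openin ?Z O' \<and> z \<in> O' \<and> (\<forall>z'\<in>O'. base_beyond N (loop_of (snd z')) (?x (fst z') (snd z')) (?y (fst z') (snd z')))"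
        by (intro exI[of _ "topspace unit_interval \<times> O'"] exI[of _ "max N N'"]) auto
    qed
    then show "continuous_map ?Z TC (\<lambda>(l, u). prodpt (wind (loop_of u) (?x l u) (?y l u)))"
      by (simp add: case_prod_beta')
  qed
qed

section \<open>The natural windows of the loop of a clique point\<close>

text \<open>With \<open>naty\<close>, the interval of radius 1/2 around \<open>k\<close> in line
  coordinates: the range on which \<open>line_recover\<close> applies. Neighbouring windows share an
  endpoint.\<close>

definition natx :: "int \<Rightarrow> real" where "natx k = tau (of_int k - 1/2)"
definition naty :: "int \<Rightarrow> real" where "naty k = tau (of_int k + 1/2)"

lemma nat_window:
  assumes "t \<in> {natx k..naty k}"
  shows "0 < t" "t < 1" "\<bar>rho t - of_int k\<bar> \<le> 1/2"
proof -
  show t: "0 < t" "t < 1" using assms tau_bounds unfolding natx_def naty_def by (meson atLeastAtMost_iff less_le_trans le_less_trans)+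
  have "of_int k - 1/2 \<le> rho t" "rho t \<le> of_int k + 1/2"
    using assms tau_le[OF t] le_tau[OF t] by (auto simp: natx_def naty_def)
  then show "\<bar>rho t - of_int k\<bar> \<le> 1/2" unfolding abs_le_iff by linarith
qed

lemma loop_of_nat_window:
  assumes "u \<in> MC" "t \<in> {natx k..naty k}" "c v = par k"
  shows "loop_of u t v = marg u k v"
  using nat_window[OF assms(2)] line_recover[OF marg_in_SQ[OF assms(1)] _ assms(3)] by (simp add: loop_of_def)

text \<open>\<open>N + 3\<close> leaves room for half the width of a window beyond the threshold
  \<open>N + 2\<close> of \<open>line_marg_far\<close>.\<close>

lemma nat_base_beyond:
  assumes u: "u \<in> MC" and N: "\<And>\<gamma> k. u \<gamma> \<noteq> 0 \<Longrightarrow> N \<le> \<bar>k\<bar> \<Longrightarrow> \<gamma> k = base k" "0 \<le> N"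
  shows "base_beyond (N + 3) (loop_of u) natx naty"
  unfolding base_beyond_def
proof (intro conjI allI impI)
  have far: "line (marg u) s = bpt" if "of_int (N + 2) \<le> \<bar>s\<bar>" for s
    using u N(1) that by (rule line_marg_far)
  fix k t
  show "loop_of u t = bpt" if k: "N + 3 \<le> k" "natx k \<le> t"
  proof (cases "t < 1")
    case True
    have t: "0 < t" using k(2) tau_bounds[of "of_int k - 1/2"] by (simp add: natx_def)
    have "of_int k - 1/2 \<le> rho t" using k(2) tau_le[OF t True] by (simp add: natx_def)
    moreover have "real_of_int (N + 3) \<le> of_int k" using k(1) by (simp only: of_int_le_iff)
    ultimately have "of_int (N + 2) \<le> \<bar>rho t\<bar>" by simp
    then show ?thesis using far by (simp add: loop_of_def)
  qed (simp add: loop_of_ends)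
  show "loop_of u t = bpt" if k: "k \<le> - (N + 3)" "t \<le> naty k"
  proof (cases "0 < t")
    case True
    have t: "t < 1" using k(2) tau_bounds[of "of_int k + 1/2"] by (simp add: naty_def)
    have "rho t \<le> of_int k + 1/2" using k(2) le_tau[OF True t] by (simp add: naty_def)
    moreover have "of_int k \<le> real_of_int (- (N + 3))" using k(1) by (simp only: of_int_le_iff)
    ultimately have "of_int (N + 2) \<le> \<bar>rho t\<bar>" by simp
    then show ?thesis using far by (simp add: loop_of_def)
  qed (simp add: loop_of_ends)
qed

lemma nat_good:
  assumes u: "u \<in> MC" shows "good (loop_of u) natx naty"
  unfolding good_def
proof (intro conjI allI ballI)
  show "loop_of u t \<in> MB" for t by (rule loop_of_in_MB[OF u])
  show "0 \<le> natx k" "natx k \<le> naty k" "naty k \<le> 1" "natx (k + 1) \<le> naty k" "natx k \<le> naty (k + 1)" for k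
    using tau_bounds[of "of_int k - 1/2"] tau_bounds[of "of_int k + 1/2"] by (auto simp: natx_def naty_def)
  show "\<exists>v. c v = par k \<and> (\<forall>t\<in>{natx k..naty k}. 1/2 \<le> loop_of u t v)" for k
  proof -
    obtain v where v: "marg u k v = 1" using SQ_D(6)[OF marg_in_SQ[OF u]] by blast
    then have "c v = par k" using SQ_D(4)[OF marg_in_SQ[OF u], of k v] by simp
    then show ?thesis using v loop_of_nat_window[OF u] by (intro exI[of _ v]) simp
  qed
  obtain N where "0 \<le> N" "\<forall>\<gamma>\<in>{\<gamma>. u \<gamma> \<noteq> 0} \<inter> Om. \<forall>k. N \<le> \<bar>k\<bar> \<longrightarrow> \<gamma> k = base k"
    using Om_uniform_bound[OF MC_D(3)[OF u]] by blast
  then have "base_beyond (N + 3) (loop_of u) natx naty"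
    using MC_D(4)[OF u] by (intro nat_base_beyond[OF u]) auto
  then show "\<exists>N. base_beyond N (loop_of u) natx naty" by blast
qed

lemma part_bound:
  assumes "finite A"
  obtains N where "0 \<le> N" "\<And>u \<gamma> k. u \<in> part MC A \<Longrightarrow> u \<gamma> \<noteq> 0 \<Longrightarrow> N \<le> \<bar>k\<bar> \<Longrightarrow> \<gamma> k = base k"
proof -
  obtain N where N: "0 \<le> N" "\<forall>\<gamma>\<in>A \<inter> Om. \<forall>k. N \<le> \<bar>k\<bar> \<longrightarrow> \<gamma> k = base k"
    using Om_uniform_bound[OF assms] by blast
  show ?thesis
  proof (rule that[OF N(1)])
    fix u \<gamma> k assume "u \<in> part MC A" "u \<gamma> \<noteq> 0" "N \<le> \<bar>k\<bar>"
    then show "\<gamma> k = base k" using N(2) MC_D(4)[of u \<gamma>] by (auto simp: part_def)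
  qed
qed

lemma wsys_nat: "wsys (\<lambda>_. natx) (\<lambda>_. naty)"
  unfolding wsys_def
proof (intro conjI ballI allI impI)
  show "good (loop_of u) natx naty" if "u \<in> MC" for u by (rule nat_good[OF that])
  fix A :: "(int \<Rightarrow> 'v) set" and u assume A: "finite A" and u: "u \<in> part MC A"
  obtain N where N: "0 \<le> N" "\<And>u \<gamma> k. u \<in> part MC A \<Longrightarrow> u \<gamma> \<noteq> 0 \<Longrightarrow> N \<le> \<bar>k\<bar> \<Longrightarrow> \<gamma> k = base k"
    by (rule part_bound[OF A]) blast
  have "base_beyond (N + 3) (loop_of u') natx naty" if "u' \<in> part MC A" for u'
  proof (rule nat_base_beyond)
    show "u' \<in> MC" using that by (simp add: part_def)
    show "\<gamma> k = base k" if "u' \<gamma> \<noteq> 0" "N \<le> \<bar>k\<bar>" for \<gamma> k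
      using N(2)[OF \<open>u' \<in> part MC A\<close> that] .
  qed (rule N(1))
  moreover have "openin (part_top MC A) (part MC A)" using openin_topspace[of "part_top MC A"] by simp
  ultimately show "\<exists>O' N. openin (part_top MC A) O' \<and> u \<in> O' \<and> (\<forall>u'\<in>O'. base_beyond N (loop_of u') natx naty)"
    using u by blast
qed simp_all

lemma loop_of_in_loops: "u \<in> MC \<Longrightarrow> loop_of u \<in> loops"
  using continuous_map_image_subset_topspace[OF continuous_map_loop_of] by auto

lemma wsys_fine: "wsys (\<lambda>u. finex (loop_of u)) (\<lambda>u. finey (loop_of u))"
  unfolding wsys_def
proof (intro conjI ballI allI impI)
  show "good (loop_of u) (finex (loop_of u)) (finey (loop_of u))" if "u \<in> MC" for u
    by (rule fine_good[OF loop_of_in_loops[OF that]])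
  show "continuous_map TC euclideanreal (\<lambda>u. finex (loop_of u) k)" "continuous_map TC euclideanreal (\<lambda>u. finey (loop_of u) k)" for k
    by (rule continuous_map_fine[OF continuous_map_loop_of])+
  fix A :: "(int \<Rightarrow> 'v) set" and u assume A: "finite A" and u: "u \<in> part MC A"
  have "continuous_map (part_top MC A) LB (\<lambda>u. loop_of u)"
    using continuous_map_compose[OF continuous_map_part_top_weak_top[OF A] continuous_map_loop_of] by (simp add: o_def)
  from fine_locally_base_beyond[OF this] u
  show "\<exists>O' N. openin (part_top MC A) O' \<and> u \<in> O' \<and> (\<forall>u'\<in>O'. base_beyond N (loop_of u') (finex (loop_of u')) (finey (loop_of u')))"
    by simp
qed

text \<open>On a natural window the loop is constant in the coordinates of the colour of
  \<open>k\<close>, so the infimum is the marginal and only the truncation remains.\<close>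

lemma wind_nat: "u \<in> MC \<Longrightarrow> wind (loop_of u) natx naty = (\<lambda>k v. trunc (marg u k v))"
proof (intro ext)
  fix k v assume u: "u \<in> MC"
  show "wind (loop_of u) natx naty k v = trunc (marg u k v)"
  proof (cases "c v = par k")
    case True
    then show ?thesis using goodD(3)[OF nat_good[OF u]] loop_of_nat_window[OF u] by (intro wind_eq) auto
  next
    case False
    then have "marg u k v = 0" using SQ_D(4)[OF marg_in_SQ[OF u]] by blast
    then show ?thesis using False by (simp add: wind_def)
  qed
qed

text \<open>Both \<open>u\<close> and the recombined point are supported on paths through the
  supports of the marginals of \<open>u\<close>, and any two such paths are adjacent. So
  \<open>trop\<close> may connect the two points although their supports can differ.\<close>

lemma homotopic_prodpt_nat: "homotopic_with (\<lambda>_. True) TC TC (\<lambda>u. prodpt (wind (loop_of u) natx naty)) id"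
proof (rule homotopic_with_symD, rule homotopic_withI)
  let ?n = "\<lambda>u. prodpt (wind (loop_of u) natx naty)"
  have SQ: "wind (loop_of u) natx naty \<in> SQ" if "u \<in> MC" for u by (rule wind_in_SQ[OF nat_good[OF that]])
  have nMC: "?n u \<in> MC" if "u \<in> MC" for u by (rule prodpt_in_MC[OF SQ[OF that]])
  have nz: "marg u k (\<gamma> k) \<noteq> 0" if "u \<in> MC" "?n u \<gamma> \<noteq> 0" for u \<gamma> k
    using prodpt_nonzero[OF SQ[OF that(1)] that(2), of k] by (auto simp: wind_nat[OF that(1)])
  have nzu: "marg u k (\<gamma> k) \<noteq> 0" if "u \<in> MC" "u \<gamma> \<noteq> 0" for u \<gamma> k
    using marg_ge[OF that(1), of \<gamma> k] MC_D(1)[OF that(1), of \<gamma>] that(2) by linarith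
  have cross: "(\<gamma>, \<gamma>') \<in> Ed" if "u \<in> MC" "u \<gamma> \<noteq> 0" "?n u \<gamma>' \<noteq> 0" for u \<gamma> \<gamma>'
    using SQ_sections_Ed[OF marg_in_SQ[OF that(1)] nzu[OF that(1,2)] nz[OF that(1,3)]] .
  show "(\<lambda>\<gamma>. trop 0 (u \<gamma>) (?n u \<gamma>)) = id u" if "u \<in> topspace TC" for u
    using that MC_D(1)[of u] MC_D(1)[OF nMC, of u] by (simp add: trop_0)
  show "(\<lambda>\<gamma>. trop 1 (u \<gamma>) (?n u \<gamma>)) = ?n u" if "u \<in> topspace TC" for u
    using that MC_D(1)[of u] MC_D(1)[OF nMC, of u] by (simp add: trop_1)
  show "continuous_map (prod_topology unit_interval TC) TC (\<lambda>(l, u). (\<lambda>\<gamma>. trop l (u \<gamma>) (?n u \<gamma>)))"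
  proof (rule continuous_map_weak_top_prod[OF locally_compact_unit_interval finite_support_MC])
    fix A :: "(int \<Rightarrow> 'v) set" assume A: "finite A"
    let ?Z = "prod_topology unit_interval (part_top MC A)"
    obtain N where N: "0 \<le> N" "\<And>u \<gamma> k. u \<in> part MC A \<Longrightarrow> u \<gamma> \<noteq> 0 \<Longrightarrow> N \<le> \<bar>k\<bar> \<Longrightarrow> \<gamma> k = base k"
      by (rule part_bound[OF A]) blast
    show "continuous_map ?Z TC (\<lambda>(l, u). (\<lambda>\<gamma>. trop l (u \<gamma>) (?n u \<gamma>)))"
    proof (rule continuous_map_into_weak_top_finite)
      show "(case z of (l, u) \<Rightarrow> (\<lambda>\<gamma>. trop l (u \<gamma>) (?n u \<gamma>))) \<in> MC" if z: "z \<in> topspace ?Z" for z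
      proof -
        obtain l u where lu: "z = (l, u)" "0 \<le> l" "l \<le> 1" "u \<in> MC" using z by (auto simp: part_def)
        show ?thesis unfolding lu prod.case
          by (rule trop_in_MC[OF lu(4) nMC[OF lu(4)] lu(2,3)]) (rule cross[OF lu(4)])
      qed
      \<comment> \<open>Paths assembled index by index from values of members of \<open>A\<close>;
        together with \<open>A\<close> they form a finite set containing all supports on this
        part.\<close>
      let ?S = "{\<gamma>. (\<forall>k. \<gamma> k \<in> (\<lambda>\<gamma>. \<gamma> k) ` A) \<and> (\<forall>k. N \<le> \<bar>k\<bar> \<longrightarrow> \<gamma> k = base k)}"
      show "finite (A \<union> ?S)" using A by (intro finite_UnI finite_sections) auto
      have inS: "\<gamma> \<in> ?S" if u: "u \<in> part MC A" and n: "?n u \<gamma> \<noteq> 0" for u \<gamma>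
      proof -
        have uM: "u \<in> MC" using u by (simp add: part_def)
        have "\<exists>\<gamma>'. u \<gamma>' \<noteq> 0 \<and> \<gamma>' k = \<gamma> k" for k
          using marg_nonzero[OF uM nz[OF uM n, of k]] by metis
        moreover have "\<gamma>' \<in> A" if "u \<gamma>' \<noteq> 0" for \<gamma>' using that u by (auto simp: part_def)
        ultimately show ?thesis using N(2)[OF u] by (auto simp: image_iff) metis+
      qed
      have supp: "trop l (u \<gamma>) (?n u \<gamma>) = 0" if "u \<in> part MC A" "\<gamma> \<notin> A \<union> ?S" for l u \<gamma>
      proof -
        have "u \<gamma> = 0" using that by (auto simp: part_def)
        moreover have "?n u \<gamma> = 0" using inS[OF that(1), of \<gamma>] that(2) by blast
        ultimately show ?thesis by (simp add: trop_zero)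
      qed
      have fst: "continuous_map ?Z euclideanreal fst"
        using continuous_map_fst continuous_map_into_fulltopology by blast
      have "continuous_map (part_top MC A) TC ?n"
      proof (rule continuous_map_prodpt_wind[OF continuous_map_loop_of_part[OF A]])
        show "good (loop_of z) natx naty" if "z \<in> topspace (part_top MC A)" for z
          using that nat_good by (auto simp: part_def)
        show "\<exists>O' N. openin (part_top MC A) O' \<and> z \<in> O' \<and> (\<forall>z'\<in>O'. base_beyond N (loop_of z') natx naty)"
          if "z \<in> topspace (part_top MC A)" for z
          using wsys_local[OF wsys_nat A] that by simp
      qed simp_all
      from continuous_map_compose[OF continuous_map_snd this]
      have "continuous_map ?Z TC (\<lambda>z. ?n (snd z))" by (simp add: o_def)
      from continuous_map_compose[OF this continuous_map_weak_top_coord[OF finite_support_MC]]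
      have n: "continuous_map ?Z euclideanreal (\<lambda>z. ?n (snd z) \<gamma>)" for \<gamma> by (simp add: o_def)
      have "continuous_map ?Z euclideanreal (\<lambda>z. snd z \<gamma>)" for \<gamma>
        using continuous_map_compose[OF continuous_map_snd continuous_map_part_top_coord] by (simp add: o_def)
      then have "continuous_map ?Z euclideanreal (\<lambda>z. trop (fst z) (snd z \<gamma>) (?n (snd z) \<gamma>))" for \<gamma>
        by (intro continuous_map_trop fst n)
      then show "continuous_map ?Z euclideanreal (\<lambda>z. (case z of (l, u) \<Rightarrow> (\<lambda>\<gamma>. trop l (u \<gamma>) (?n u \<gamma>))) \<gamma>)" for \<gamma>
        by (simp add: case_prod_beta')
      fix z \<gamma> assume z: "z \<in> topspace ?Z" "\<gamma> \<notin> A \<union> ?S"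
      then obtain l u where "z = (l, u)" "u \<in> part MC A" by auto
      then show "(case z of (l, u) \<Rightarrow> (\<lambda>\<gamma>. trop l (u \<gamma>) (?n u \<gamma>))) \<gamma> = 0" using supp z(2) by simp
    qed
  qed
qed

lemma homotopic_clique_of_loop_of: "homotopic_with (\<lambda>_. True) TC TC (clique_of \<circ> loop_of) id"
proof -
  note m = wsys_min[OF wsys_nat wsys_fine]
  have "homotopic_with (\<lambda>_. True) TC TC (\<lambda>u. prodpt (wind (loop_of u) (\<lambda>k. min (natx k) (finex (loop_of u) k)) (\<lambda>k. min (naty k) (finey (loop_of u) k))))
      (\<lambda>u. prodpt (wind (loop_of u) (finex (loop_of u)) (finey (loop_of u))))"
    by (rule wsys_sweep[OF m wsys_fine]) auto
  moreover have "homotopic_with (\<lambda>_. True) TC TC (\<lambda>u. prodpt (wind (loop_of u) (\<lambda>k. min (natx k) (finex (loop_of u) k)) (\<lambda>k. min (naty k) (finey (loop_of u) k))))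
      (\<lambda>u. prodpt (wind (loop_of u) natx naty))"
    by (rule wsys_sweep[OF m wsys_nat]) auto
  ultimately have "homotopic_with (\<lambda>_. True) TC TC (\<lambda>u. prodpt (wind (loop_of u) (finex (loop_of u)) (finey (loop_of u)))) id"
    using homotopic_with_trans[OF homotopic_with_symD homotopic_with_trans[OF _ homotopic_prodpt_nat]] by blast
  then show ?thesis by (simp add: o_def clique_of_def)
qed

section \<open>The composite on the loop space\<close>

text \<open>The time of \<open>w\<close> that belongs to the line coordinate \<open>rho t\<close>.
  Before clipping, the k-th window runs from \<open>(k - 1) * leb w\<close> to
  \<open>(k + 2) * leb w\<close> with midpoint \<open>(k + 1/2) * leb w\<close>; the summand 1/2
  thus puts this time into every window with \<open>\<bar>rho t - k\<bar> < 3/2\<close>.\<close>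

definition eta :: "(real \<Rightarrow> 'v \<Rightarrow> real) \<Rightarrow> real \<Rightarrow> real" where
  "eta w t = (if t \<le> 0 then 0 else if 1 \<le> t then 1 else clip 0 1 ((rho t + 1/2) * leb w))"

lemma eta_bounds: "eta w t \<in> {0..1}"
  using clip_bounds[of 0 1] by (auto simp: eta_def)

lemma eta_ends: "t \<le> 0 \<Longrightarrow> eta w t = 0" "1 \<le> t \<Longrightarrow> eta w t = 1"
  by (auto simp: eta_def)

text \<open>\<open>M \<ge> 1 / d + 1\<close> makes the value 1 at the upper clip for every
  \<open>leb w \<ge> d\<close>, and \<open>M \<ge> 1\<close> makes it 0 at the lower one. A single
  clipping thus serves a neighbourhood of \<open>w\<close>.\<close>

lemma eta_clip:
  assumes "0 < d" "d \<le> leb w" "1 / d + 1 \<le> M"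
  shows "eta w t = clip 0 1 ((rho (clip (tau (- M)) (tau M) t) + 1/2) * leb w)"
proof -
  have M: "1 \<le> M" using assms by (smt (verit) divide_pos_pos)
  have l: "0 < leb w" using assms by simp
  have hi: "clip 0 1 ((s + 1/2) * leb w) = 1" if "M \<le> s" for s
  proof -
    have "1 / d * d \<le> (s + 1/2) * leb w" using assms that M by (intro mult_mono) auto
    then show ?thesis using assms(1) by (simp add: clip_def)
  qed
  have lo: "clip 0 1 ((s + 1/2) * leb w) = 0" if "s \<le> - M" for s
  proof -
    have "(s + 1/2) * leb w \<le> 0" using that M l by (intro mult_nonpos_nonneg) auto
    then show ?thesis by (simp add: clip_def)
  qed
  consider "t \<le> tau (- M)" | "tau M \<le> t" | "tau (- M) < t" "t < tau M" by linarith
  then show ?thesis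
  proof cases
    case 1
    have "tau (- M) \<le> tau M" using M by simp
    then have c: "clip (tau (- M)) (tau M) t = tau (- M)" using 1 by (auto simp: clip_def)
    have "eta w t = 0"
    proof (cases "0 < t")
      case True
      have "t < 1" using 1 tau_bounds[of "- M"] by simp
      then show ?thesis using lo[of "rho t"] le_tau[of t "- M"] True 1 by (simp add: eta_def)
    qed (simp add: eta_def)
    then show ?thesis using lo[of "- M"] by (simp only: c rho_tau)
  next
    case 2
    have "tau (- M) \<le> tau M" using M by simp
    then have c: "clip (tau (- M)) (tau M) t = tau M" using 2 by (auto simp: clip_def)
    have "eta w t = 1"
    proof (cases "t < 1")
      case True
      have "0 < t" using 2 tau_bounds[of M] by simp
      then show ?thesis using hi[of "rho t"] tau_le[of t M] True 2 by (simp add: eta_def)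
    next
      case False
      then show ?thesis by (simp add: eta_def)
    qed
    then show ?thesis using hi[of M] by (simp only: c rho_tau)
  next
    case 3
    then have c: "clip (tau (- M)) (tau M) t = t" by (auto simp: clip_def)
    moreover have "0 < t" "t < 1" using 3 tau_bounds[of "- M"] tau_bounds[of M] by linarith+
    ultimately show ?thesis by (simp add: eta_def)
  qed
qed

lemma continuous_map_eta: "continuous_map (prod_topology LB unit_interval) unit_interval (\<lambda>(w, t). eta w t)"
proof -
  let ?Z = "prod_topology LB unit_interval"
  have leb: "continuous_map ?Z euclideanreal (\<lambda>z. leb (fst z))"
    using continuous_map_compose[OF continuous_map_fst continuous_map_leb] by (simp add: o_def)
  have snd: "continuous_map ?Z euclideanreal snd"
    using continuous_map_snd continuous_map_into_fulltopology by blast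
  have "continuous_map ?Z euclideanreal (\<lambda>z. eta (fst z) (snd z))"
  proof (rule continuous_map_locally)
    fix z assume z: "z \<in> topspace ?Z"
    let ?d = "leb (fst z) / 2"
    have d: "0 < ?d" using z leb_pos by auto
    let ?M = "1 / ?d + 1"
    let ?O = "{z' \<in> topspace ?Z. leb (fst z') \<in> {?d<..}}"
    have "openin ?Z ?O" by (rule openin_continuous_map_preimage[OF leb]) simp
    moreover have "z \<in> ?O" using z d by simp
    moreover have "continuous_map (subtopology ?Z ?O) euclideanreal (\<lambda>z. eta (fst z) (snd z))"
    proof (rule continuous_map_eq)
      have "0 \<le> 1 / ?d" using d by simp
      then have M: "- ?M \<le> ?M" by linarith
      show "continuous_map (subtopology ?Z ?O) euclideanreal
          (\<lambda>z. clip 0 1 ((rho (clip (tau (- ?M)) (tau ?M) (snd z)) + 1/2) * leb (fst z)))"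
        by (intro continuous_map_clip continuous_map_real_mult continuous_map_add continuous_map_rho_clip
            continuous_map_from_subtopology snd leb M) auto
      fix z' assume "z' \<in> topspace (subtopology ?Z ?O)"
      then have "?d \<le> leb (fst z')" by auto
      then show "clip 0 1 ((rho (clip (tau (- ?M)) (tau ?M) (snd z')) + 1/2) * leb (fst z')) = eta (fst z') (snd z')"
        by (rule eta_clip[OF d _ order_refl, symmetric])
    qed
    ultimately show "\<exists>N. openin ?Z N \<and> z \<in> N \<and> continuous_map (subtopology ?Z N) euclideanreal (\<lambda>z. eta (fst z) (snd z))"
      by blast
  qed
  then show ?thesis using eta_bounds by (auto simp: continuous_map_in_subtopology case_prod_beta')
qed

text \<open>Every window active at \<open>rho t\<close> contains \<open>eta w t\<close>, so each
  infimum is at most the value there. The support of the reconstructed loop is therefore contained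
  in that of the reparametrised one, which makes \<open>trop\<close> applicable.\<close>

lemma loop_of_clique_of_le:
  assumes w: "w \<in> loops"
  shows "loop_of (clique_of w) t v \<le> trunc (w (eta w t) v)"
proof (cases "0 < t \<and> t < 1")
  case True
  note g = fine_good[OF w]
  have l: "0 < leb w" by (rule leb_pos[OF w])
  let ?q = "wind w (finex w) (finey w)"
  have q: "?q \<in> SQ" by (rule wind_in_SQ[OF g])
  have "line ?q (rho t) v \<le> trunc (w (eta w t) v)"
  proof (rule line_le)
    fix k assume k: "\<bar>rho t - of_int k\<bar> < 3/2"
    have "of_int k - 1 \<le> rho t + 1/2" "rho t + 1/2 \<le> of_int k + 2" using k unfolding abs_less_iff by linarith+
    then have "eta w t \<in> {finex w k..finey w k}"
      using True l by (auto simp: eta_def finex_def finey_def intro!: clip_mono mult_right_mono)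
    then show "?q k v \<le> trunc (w (eta w t) v)" by (rule wind_le[OF g])
  qed (use SQ_D(1)[OF q] trunc_bounds in auto)
  then show ?thesis using True marg_prodpt[OF q] by (simp add: loop_of_def clique_of_def)
next
  case False
  then have "loop_of (clique_of w) t v = bpt v" "w (eta w t) = bpt"
    using loop_of_ends loopsD(3)[OF w] eta_ends by (auto simp: not_less)
  then show ?thesis by (simp add: bpt_def trunc_def)
qed

lemma clique_of_in_MC: "w \<in> loops \<Longrightarrow> clique_of w \<in> MC"
  using continuous_map_image_subset_topspace[OF continuous_map_clique_of] by auto

lemma trunc_in_MB:
  assumes q: "q \<in> MB" shows "(\<lambda>v. trunc (q v)) \<in> MB"
proof -
  have nz: "q v \<noteq> 0" if "trunc (q v) \<noteq> 0" for v using that by auto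
  have "finite {v. trunc (q v) \<noteq> 0}" by (rule finite_subset[OF _ MB_D(3)[OF q]]) (use nz in auto)
  moreover have "\<exists>v. c v = par k \<and> trunc (q v) = 1" for k
  proof -
    obtain v where "c v = par k" "q v = 1" using MB_D(6)[OF q] by blast
    then show ?thesis by (intro exI[of _ v]) (simp add: trunc_eq_1)
  qed
  ultimately show ?thesis using trunc_bounds nz MB_D(4,5)[OF q] by (auto simp: MB_def)
qed

lemma continuous_map_trunc_homotopy:
  "continuous_map (prod_topology unit_interval TB) TB (\<lambda>(l, q). (\<lambda>v. trop l (trunc (q v)) (q v)))"
proof (rule continuous_map_weak_top_prod[OF locally_compact_unit_interval finite_support_MB])
  fix A :: "'v set" assume A: "finite A"
  let ?Z = "prod_topology unit_interval (part_top MB A)"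
  let ?h = "\<lambda>z. (case z of (l, q) \<Rightarrow> (\<lambda>v. trop l (trunc (q v)) (q v)))"
  show "continuous_map ?Z TB ?h"
  proof (rule continuous_map_into_weak_top_finite[OF _ A])
    show "?h z \<in> MB" if z: "z \<in> topspace ?Z" for z
    proof -
      obtain l q where lq: "z = (l, q)" "0 \<le> l" "l \<le> 1" "q \<in> MB" using z by (auto simp: part_def)
      show ?thesis unfolding lq prod.case
      proof (rule trop_in_MB[OF trunc_in_MB[OF lq(4)] lq(4) lq(2,3)])
        fix a b assume "trunc (q a) \<noteq> 0" "q b \<noteq> 0" "c a \<noteq> c b"
        moreover from this have "q a \<noteq> 0" by auto
        ultimately show "(a, b) \<in> E" using MB_D(5)[OF lq(4)] by blast
      qed
    qed
    have fst: "continuous_map ?Z euclideanreal fst"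
      using continuous_map_fst continuous_map_into_fulltopology by blast
    have "continuous_map ?Z euclideanreal (\<lambda>z. snd z v)" for v
      using continuous_map_compose[OF continuous_map_snd continuous_map_part_top_coord] by (simp add: o_def)
    then have "continuous_map ?Z euclideanreal (\<lambda>z. trop (fst z) (trunc (snd z v)) (snd z v))" for v
      by (intro continuous_map_trop continuous_map_trunc fst)
    then show "continuous_map ?Z euclideanreal (\<lambda>z. ?h z v)" for v by (simp add: case_prod_beta')
    show "?h z v = 0" if "z \<in> topspace ?Z" "v \<notin> A" for z v using that by (auto simp: part_def trop_zero)
  qed
qed

text \<open>The reconstructed loop is moved to the truncated reparametrised loop \<open>?m\<close>
  that dominates it, then truncation and reparametrisation are undone. The detour through
  \<open>?m\<close> is there because the first homotopy is checked by locally finite supports, which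
  \<open>w (eta w t)\<close> need not have.\<close>

lemma homotopic_loop_of_clique_of: "homotopic_with (\<lambda>_. True) LB LB (loop_of \<circ> clique_of) id"
proof -
  let ?Z = "prod_topology unit_interval LB"
  let ?ZI = "prod_topology ?Z unit_interval"
  let ?m = "\<lambda>w t v. trunc (w (eta w t) v)"
  have l: "continuous_map ?ZI unit_interval (\<lambda>p. fst (fst p))"
    using continuous_map_compose[OF continuous_map_fst continuous_map_fst] by (simp add: o_def)
  have lr: "continuous_map ?ZI euclideanreal (\<lambda>p. fst (fst p))"
    using l continuous_map_into_fulltopology by blast
  have w: "continuous_map ?ZI LB (\<lambda>p. snd (fst p))"
    using continuous_map_compose[OF continuous_map_fst continuous_map_snd] by (simp add: o_def)
  have t: "continuous_map ?ZI unit_interval snd" by (rule continuous_map_snd)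
  have tr: "continuous_map ?ZI euclideanreal snd"
    using t continuous_map_into_fulltopology by blast
  have "continuous_map ?ZI unit_interval ((\<lambda>(w, t). eta w t) \<circ> (\<lambda>p. (snd (fst p), snd p)))"
    by (rule continuous_map_compose[OF _ continuous_map_eta]) (intro continuous_map_pairedI w t)
  then have e: "continuous_map ?ZI unit_interval (\<lambda>p. eta (snd (fst p)) (snd p))" by (simp add: o_def)
  then have er: "continuous_map ?ZI euclideanreal (\<lambda>p. eta (snd (fst p)) (snd p))"
    using continuous_map_into_fulltopology by blast
  have we: "continuous_map ?ZI TB (\<lambda>p. snd (fst p) (eta (snd (fst p)) (snd p)))"
    by (rule continuous_map_loop_eval_compose[OF w e])
  have ZI: "\<exists>l w t. p = ((l, w), t) \<and> 0 \<le> l \<and> l \<le> 1 \<and> w \<in> loops \<and> t \<in> {0..1}" if "p \<in> topspace ?ZI" for p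
    using that by auto
  have trop_bpt: "trop l (bpt v) (bpt v) = bpt v" if "0 \<le> l" "l \<le> 1" for l v
    using that by (intro trop_idem) (auto simp: bpt_def)
  have trunc_bpt: "trunc (bpt v) = bpt v" for v by (simp add: bpt_def trunc_def)
  have wend: "w (eta w t) = bpt" if "w \<in> loops" "t \<le> 0 \<or> 1 \<le> t" for w t
    using eta_ends[of t w] loopsD(3)[OF that(1)] that(2) by auto
  have "homotopic_with (\<lambda>_. True) LB LB (loop_of \<circ> clique_of) ?m"
  proof (rule homotopic_withI)
    let ?H = "\<lambda>l w t v. trop l (loop_of (clique_of w) t v) (?m w t v)"
    have mMB: "?m w t \<in> MB" "loop_of (clique_of w) t \<in> MB" if "w \<in> loops" for w t
      using that trunc_in_MB[OF loopsD(2)] loop_of_in_MB[OF clique_of_in_MC] by auto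
    have nz: "?m w t v \<noteq> 0" if "w \<in> loops" "loop_of (clique_of w) t v \<noteq> 0" for w t v
      using loop_of_clique_of_le[OF that(1), of t v] MB_D(1)[OF mMB(2)[OF that(1)], of t v] that(2) by linarith
    have "continuous_map ?Z LB (\<lambda>z. ?H (fst z) (snd z))"
    proof (rule continuous_map_into_loop_space)
      show "(\<lambda>v. ?H (fst z) (snd z) t v) = bpt" if "z \<in> topspace ?Z" "t \<le> 0 \<or> 1 \<le> t" for z t
      proof -
        have z: "snd z \<in> loops" "0 \<le> fst z" "fst z \<le> 1" using that(1) by auto
        show ?thesis by (rule ext) (simp add: wend[OF z(1) that(2)] trunc_bpt loop_of_ends[OF that(2)] trop_bpt z)
      qed
      have "continuous_map ?ZI TB (\<lambda>p. ?H (fst (fst p)) (snd (fst p)) (snd p))"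
      proof (rule continuous_map_into_weak_top)
        fix p assume p: "p \<in> topspace ?ZI"
        obtain l w t where lwt: "p = ((l, w), t)" "0 \<le> l" "l \<le> 1" "w \<in> loops" using ZI[OF p] by blast
        show "?H (fst (fst p)) (snd (fst p)) (snd p) \<in> MB"
          unfolding lwt fst_conv snd_conv
          by (rule trop_in_MB[OF mMB(2)[OF lwt(4)] mMB(1)[OF lwt(4)] lwt(2,3)])
            (rule MB_D(5)[OF mMB(1)[OF lwt(4)]], erule nz[OF lwt(4)])
        \<comment> \<open>The cut at 1/4 again: near \<open>p\<close> the truncated loop vanishes
          outside this finite set, and by domination so does the reconstructed one.\<close>
        let ?A = "{v. w (eta w t) v \<noteq> 0}"
        let ?U = "{q \<in> MB. \<forall>v\<in>-?A. \<bar>q v - 0\<bar> < 1/4}"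
        let ?N = "{p \<in> topspace ?ZI. snd (fst p) (eta (snd (fst p)) (snd p)) \<in> ?U}"
        have U: "openin TB ?U" by (rule openin_weak_top_bound[OF finite_support_MB]) simp_all
        have N: "openin ?ZI ?N" by (rule openin_continuous_map_preimage[OF we U])
        have pN: "p \<in> ?N" using p loopsD(2)[OF lwt(4)] by (simp add: lwt(1))
        have fin: "finite ?A" by (rule MB_D(3)[OF loopsD(2)[OF lwt(4)]])
        have lc: "continuous_map LB LB (\<lambda>w. loop_of (clique_of w))"
          using continuous_map_compose[OF continuous_map_clique_of continuous_map_loop_of] by (simp add: o_def)
        have "continuous_map ?ZI LB (\<lambda>p. loop_of (clique_of (snd (fst p))))"
          using continuous_map_compose[OF w lc] by (simp add: o_def)
        from continuous_map_loop_eval_compose[OF this t]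
        have "continuous_map ?ZI TB (\<lambda>p. loop_of (clique_of (snd (fst p))) (snd p))" .
        from continuous_map_compose[OF this continuous_map_weak_top_coord[OF finite_support_MB]]
        have c1: "continuous_map ?ZI euclideanreal (\<lambda>p. loop_of (clique_of (snd (fst p))) (snd p) v)" for v by (simp add: o_def)
        from continuous_map_compose[OF we continuous_map_weak_top_coord[OF finite_support_MB]]
        have c2: "continuous_map ?ZI euclideanreal (\<lambda>p. snd (fst p) (eta (snd (fst p)) (snd p)) v)" for v by (simp add: o_def)
        have cont: "continuous_map (subtopology ?ZI ?N) euclideanreal (\<lambda>p. ?H (fst (fst p)) (snd (fst p)) (snd p) v)" for v
          by (intro continuous_map_from_subtopology continuous_map_trop continuous_map_trunc lr c1 c2)
        have supp: "?H (fst (fst y)) (snd (fst y)) (snd y) v = 0" if "y \<in> ?N" "v \<notin> ?A" for y v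
        proof -
          have y: "snd (fst y) \<in> loops" using that(1) by auto
          have "\<bar>snd (fst y) (eta (snd (fst y)) (snd y)) v - 0\<bar> < 1/4" using that by blast
          then have 0: "?m (snd (fst y)) (snd y) v = 0" by (simp add: trunc_def abs_less_iff)
          then have "loop_of (clique_of (snd (fst y))) (snd y) v = 0" using nz[OF y] by blast
          then show ?thesis using 0 by (simp add: trop_zero)
        qed
        show "\<exists>N A. openin ?ZI N \<and> p \<in> N \<and> finite A \<and>
           (\<forall>y\<in>N. \<forall>v. v \<notin> A \<longrightarrow> ?H (fst (fst y)) (snd (fst y)) (snd y) v = 0) \<and>
           (\<forall>v\<in>A. continuous_map (subtopology ?ZI N) euclideanreal (\<lambda>y. ?H (fst (fst y)) (snd (fst y)) (snd y) v))"
        proof (intro exI[of _ ?N] exI[of _ ?A] conjI N pN fin ballI allI impI)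
          show "?H (fst (fst y)) (snd (fst y)) (snd y) v = 0" if "y \<in> ?N" "v \<notin> ?A" for y v by (rule supp[OF that])
        qed (rule cont)
      qed
      then show "continuous_map ?ZI TB (\<lambda>(z, t). ?H (fst z) (snd z) t)" by (simp add: case_prod_beta')
    qed
    then show "continuous_map ?Z LB (\<lambda>(l, w). ?H l w)" by (simp add: case_prod_beta')
    show "?H 0 w = (loop_of \<circ> clique_of) w" if "w \<in> topspace LB" for w
      using that MB_D(1)[OF mMB(1)] MB_D(1)[OF mMB(2)] by (simp add: trop_0)
    show "?H 1 w = ?m w" if "w \<in> topspace LB" for w
      using that MB_D(1)[OF mMB(1)] MB_D(1)[OF mMB(2)] by (simp add: trop_1)
  qed
  \<comment> \<open>This homotopy acts pointwise in \<open>MB\<close> and is composed with the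
    continuous \<open>w (eta w t)\<close>, so supports need control only on finite parts of
    \<open>MB\<close>.\<close>
  moreover have "homotopic_with (\<lambda>_. True) LB LB ?m (\<lambda>w t. w (eta w t))"
  proof (rule homotopic_withI)
    let ?H = "\<lambda>l w t v. trop l (?m w t v) (w (eta w t) v)"
    have "continuous_map ?Z LB (\<lambda>z. ?H (fst z) (snd z))"
    proof (rule continuous_map_into_loop_space)
      show "(\<lambda>v. ?H (fst z) (snd z) t v) = bpt" if "z \<in> topspace ?Z" "t \<le> 0 \<or> 1 \<le> t" for z t
      proof -
        have z: "snd z \<in> loops" "0 \<le> fst z" "fst z \<le> 1" using that(1) by auto
        show ?thesis by (rule ext) (simp add: wend[OF z(1) that(2)] trunc_bpt trop_bpt z)
      qed
      have "continuous_map ?ZI TB ((\<lambda>(l, q). (\<lambda>v. trop l (trunc (q v)) (q v))) \<circ> (\<lambda>p. (fst (fst p), snd (fst p) (eta (snd (fst p)) (snd p)))))"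
        by (rule continuous_map_compose[OF _ continuous_map_trunc_homotopy]) (intro continuous_map_pairedI l we)
      then show "continuous_map ?ZI TB (\<lambda>(z, t). ?H (fst z) (snd z) t)" by (simp add: o_def case_prod_beta')
    qed
    then show "continuous_map ?Z LB (\<lambda>(l, w). ?H l w)" by (simp add: case_prod_beta')
    show "?H 0 w = ?m w" "?H 1 w = (\<lambda>t. w (eta w t))" if "w \<in> topspace LB" for w
      using that MB_D(1)[OF loopsD(2)] trunc_bounds(1) by (simp_all add: trop_0 trop_1)
  qed
  moreover have "homotopic_with (\<lambda>_. True) LB LB (\<lambda>w t. w (eta w t)) id"
  proof (rule homotopic_withI)
    let ?H = "\<lambda>l w t. w ((1 - l) * eta w t + l * t)"
    have "continuous_map ?Z LB (\<lambda>z. ?H (fst z) (snd z))"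
    proof (rule continuous_map_into_loop_space)
      \<comment> \<open>For such \<open>t\<close> both \<open>t\<close> and \<open>eta w t\<close>
        lie in the same closed tail, hence so does their convex combination.\<close>
      show "?H (fst z) (snd z) t = bpt" if "z \<in> topspace ?Z" "t \<le> 0 \<or> 1 \<le> t" for z t
      proof -
        have z: "snd z \<in> loops" "0 \<le> fst z" "fst z \<le> 1" using that(1) by auto
        have "(1 - fst z) * eta (snd z) t + fst z * t \<le> 0" if "t \<le> 0"
          using that z by (simp add: eta_ends mult_nonneg_nonpos)
        moreover have "1 \<le> (1 - fst z) * eta (snd z) t + fst z * t" if "1 \<le> t"
          using that z mult_left_mono[of 1 t "fst z"] by (simp add: eta_ends)
        ultimately show ?thesis using loopsD(3)[OF z(1)] that(2) by blast
      qed
      let ?s = "\<lambda>p. (1 - fst (fst p)) * eta (snd (fst p)) (snd p) + fst (fst p) * snd p"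
      have "continuous_map ?ZI euclideanreal ?s"
        by (intro continuous_map_add continuous_map_real_mult continuous_map_diff lr er tr) simp
      moreover have "?s p \<in> {0..1}" if p: "p \<in> topspace ?ZI" for p
      proof -
        obtain l w t where lwt: "p = ((l, w), t)" "0 \<le> l" "l \<le> 1" "t \<in> {0..1}" using ZI[OF p] by blast
        then show ?thesis using eta_bounds[of w t] convex_bound_le[of "eta w t" 1 t "1 - l" l] by simp
      qed
      ultimately have "continuous_map ?ZI unit_interval ?s" by (auto simp: continuous_map_in_subtopology)
      from continuous_map_loop_eval_compose[OF w this]
      show "continuous_map ?ZI TB (\<lambda>(z, t). ?H (fst z) (snd z) t)" by (simp add: case_prod_beta')
    qed
    then show "continuous_map ?Z LB (\<lambda>(l, w). ?H l w)" by (simp add: case_prod_beta')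
  qed auto
  ultimately show ?thesis by (blast intro: homotopic_with_trans)
qed

theorem homotopy_equivalent_models: "TC homotopy_equivalent_space LB"
  unfolding homotopy_equivalent_space_def
  using continuous_map_loop_of continuous_map_clique_of homotopic_clique_of_loop_of homotopic_loop_of_clique_of by blast

end

section \<open>Components of the graph of bi-infinite paths\<close>

lemma path_component_of_continuous_image:
  assumes "path_component_of X x y" "continuous_map X Y f"
  shows "path_component_of Y (f x) (f y)"
proof -
  obtain g where "pathin X g" "g 0 = x" "g 1 = y" using assms(1) unfolding path_component_of_def by blast
  then show ?thesis
    using pathin_compose[OF _ assms(2), of g] unfolding path_component_of_def by (intro exI[of _ "f \<circ> g"]) auto
qed

lemma homotopic_with_imp_path_component:
  assumes "homotopic_with P X Y f g" "x \<in> topspace X"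
  shows "path_component_of Y (f x) (g x)"
proof -
  obtain h where h: "continuous_map (prod_topology unit_interval X) Y h" "\<forall>x. h (0, x) = f x" "\<forall>x. h (1, x) = g x"
    using assms(1) unfolding homotopic_with_def by blast
  have "continuous_map unit_interval Y (h \<circ> (\<lambda>l. (l, x)))"
    by (rule continuous_map_compose[OF _ h(1)]) (use assms(2) in \<open>simp add: continuous_map_pairedI\<close>)
  then show ?thesis
    using h(2,3) unfolding path_component_of_def pathin_def by (intro exI[of _ "h \<circ> (\<lambda>l. (l, x))"]) simp
qed

context based_bigraph
begin

lemma Ed_refl: "\<gamma> \<in> Om \<Longrightarrow> (\<gamma>, \<gamma>) \<in> Ed"
  by (auto simp: Ed_iff Om_iff)

lemma Ed_sym: "(\<gamma>, \<gamma>') \<in> Ed \<Longrightarrow> (\<gamma>', \<gamma>) \<in> Ed"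
  by (auto simp: Ed_iff)

lemma Ed_star_sym: "(\<gamma>, \<gamma>') \<in> Ed\<^sup>* \<Longrightarrow> (\<gamma>', \<gamma>) \<in> Ed\<^sup>*"
  by (rule symD[OF sym_rtrancl]) (auto intro: symI Ed_sym)

lemma vertex_pt_in_MC: "\<gamma> \<in> Om \<Longrightarrow> vertex_pt \<gamma> \<in> MC"
  using Ed_refl by (auto simp: MC_def vertex_pt_def)

text \<open>The union of two mutually adjacent supports is a finite clique, so the whole
  \<open>trop\<close> path stays in \<open>MC\<close> with one finite support.\<close>

lemma trop_path:
  assumes u: "u \<in> MC" "r \<in> MC" and cross: "\<And>\<gamma> \<gamma>'. u \<gamma> \<noteq> 0 \<Longrightarrow> r \<gamma>' \<noteq> 0 \<Longrightarrow> (\<gamma>, \<gamma>') \<in> Ed"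
  shows "path_component_of TC u r"
proof -
  let ?h = "\<lambda>l \<gamma>. trop l (u \<gamma>) (r \<gamma>)"
  let ?B = "{\<gamma>. u \<gamma> \<noteq> 0} \<union> {\<gamma>. r \<gamma> \<noteq> 0}"
  have "continuous_map unit_interval TC ?h"
  proof (rule continuous_map_into_weak_top_finite)
    show "?h l \<in> MC" if "l \<in> topspace unit_interval" for l
      using that by (intro trop_in_MC u cross) auto
    show "finite ?B" using MC_D(3)[OF u(1)] MC_D(3)[OF u(2)] by simp
    show "?h l \<gamma> = 0" if "\<gamma> \<notin> ?B" for l \<gamma> using that by (simp add: trop_zero)
    have "continuous_map unit_interval euclideanreal (\<lambda>l. l)"
      by (rule continuous_map_from_subtopology) simp
    then show "continuous_map unit_interval euclideanreal (\<lambda>l. ?h l \<gamma>)" for \<gamma>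
      by (intro continuous_map_trop) simp_all
  qed
  moreover have "?h 0 = u" "?h 1 = r"
    using MC_D(1)[OF u(1)] MC_D(1)[OF u(2)] by (simp_all add: trop_0 trop_1)
  ultimately show ?thesis unfolding path_component_of_def pathin_def by blast
qed

lemma path_to_vertex:
  assumes u: "u \<in> MC" and g: "u \<gamma> \<noteq> 0"
  shows "path_component_of TC u (vertex_pt \<gamma>)"
proof (rule trop_path[OF u vertex_pt_in_MC[OF MC_D(4)[OF u g]]])
  fix \<gamma>1 \<gamma>2 assume "u \<gamma>1 \<noteq> 0" "vertex_pt \<gamma> \<gamma>2 \<noteq> 0"
  then show "(\<gamma>1, \<gamma>2) \<in> Ed" using MC_D(5)[OF u _ g] by (simp add: vertex_pt_def split: if_splits)
qed

lemma Ed_star_imp_path: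
  assumes "(\<gamma>, \<gamma>') \<in> Ed\<^sup>*" "\<gamma> \<in> Om"
  shows "path_component_of TC (vertex_pt \<gamma>) (vertex_pt \<gamma>')"
  using assms
proof (induction rule: rtrancl_induct)
  case base
  then show ?case using vertex_pt_in_MC by (simp add: path_component_of_refl)
next
  case (step y z)
  then have yz: "y \<in> Om" "z \<in> Om" by (auto simp: Ed_iff)
  have "path_component_of TC (vertex_pt y) (vertex_pt z)"
    by (rule trop_path[OF vertex_pt_in_MC[OF yz(1)] vertex_pt_in_MC[OF yz(2)]])
      (use step in \<open>simp add: vertex_pt_def split: if_splits\<close>)
  then show ?case using step path_component_of_trans by metis
qed

lemma openin_nonzero: "openin TC {u \<in> MC. u \<gamma> \<noteq> 0}"
proof -
  have "openin TC {u \<in> topspace TC. u \<gamma> \<in> - {0}}"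
  proof (rule openin_continuous_map_preimage[OF continuous_map_weak_top_coord[OF finite_support_MC]])
    have "open (- {0::real})" by (intro open_Compl closed_singleton)
    then show "openin euclideanreal (- {0})" by (meson open_openin)
  qed
  then show ?thesis by simp
qed

text \<open>Supports are cliques, so each point of \<open>MC\<close> has its support in one
  component of the graph. Having it in a given component is an open condition with open complement,
  and paths are connected.\<close>

lemma path_imp_Ed_star:
  assumes p: "path_component_of TC (vertex_pt \<gamma>) (vertex_pt \<gamma>')"
  shows "(\<gamma>, \<gamma>') \<in> Ed\<^sup>*"
proof (rule ccontr)
  assume n: "(\<gamma>, \<gamma>') \<notin> Ed\<^sup>*"
  let ?K = "\<Union>\<delta>\<in>{\<delta>. (\<gamma>, \<delta>) \<in> Ed\<^sup>*}. {u \<in> MC. u \<delta> \<noteq> 0}"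
  let ?K' = "\<Union>\<delta>\<in>{\<delta>. (\<gamma>, \<delta>) \<notin> Ed\<^sup>*}. {u \<in> MC. u \<delta> \<noteq> 0}"
  have o: "openin TC ?K" "openin TC ?K'" using openin_nonzero by blast+
  have disj: "u \<notin> ?K'" if u: "u \<in> ?K" for u
  proof
    assume "u \<in> ?K'"
    then obtain \<delta> \<delta>' where "u \<in> MC" "(\<gamma>, \<delta>) \<in> Ed\<^sup>*" "u \<delta> \<noteq> 0" "(\<gamma>, \<delta>') \<notin> Ed\<^sup>*" "u \<delta>' \<noteq> 0" using u by blast
    then show False using MC_D(5)[of u \<delta> \<delta>'] by (meson rtrancl.rtrancl_into_rtrancl)
  qed
  have cover: "u \<in> ?K \<or> u \<in> ?K'" if u: "u \<in> MC" for u
  proof -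
    obtain \<delta> where "u \<delta> = 1" using MC_D(6)[OF u] by blast
    then have "u \<delta> \<noteq> 0" by simp
    then show ?thesis using u by blast
  qed
  have "topspace TC - ?K = ?K'"
  proof (intro equalityI subsetI)
    fix u assume "u \<in> topspace TC - ?K"
    then have u: "u \<in> MC" "u \<notin> ?K" by (simp, blast)
    show "u \<in> ?K'"
    proof (rule disjE[OF cover[OF u(1)]])
      assume "u \<in> ?K"
      with u(2) show ?thesis by (rule notE)
    qed
  next
    fix u assume u: "u \<in> ?K'"
    have "u \<notin> ?K"
    proof
      assume "u \<in> ?K"
      from disj[OF this] u show False by (rule notE)
    qed
    moreover have "u \<in> topspace TC" using u by auto
    ultimately show "u \<in> topspace TC - ?K" by blast
  qed
  then have "closedin TC ?K" using o by (auto simp: closedin_def)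
  obtain h where h: "pathin TC h" "h 0 = vertex_pt \<gamma>" "h 1 = vertex_pt \<gamma>'"
    using p unfolding path_component_of_def by blast
  define C where "C = h ` {0..1}"
  have C: "connectedin TC C" "vertex_pt \<gamma> \<in> C" "vertex_pt \<gamma>' \<in> C"
    using connectedin_path_image[OF h(1)] h(2,3) by (auto simp: C_def image_iff intro: bexI[of _ 0] bexI[of _ 1])
  have top: "vertex_pt \<gamma> \<in> MC" "vertex_pt \<gamma>' \<in> MC" using connectedin_subset_topspace[OF C(1)] C by auto
  have vK: "vertex_pt \<gamma> \<in> ?K" using top(1) by (intro UN_I[of \<gamma>]) (simp_all add: vertex_pt_def)
  have vK': "vertex_pt \<gamma>' \<in> ?K'" using top(2) n by (intro UN_I[of \<gamma>']) (simp_all add: vertex_pt_def)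
  show False
  proof (rule disjE[OF connectedin_clopen_cases[OF C(1) \<open>closedin TC ?K\<close> o(1)]])
    assume "C \<subseteq> ?K"
    from disj[OF subsetD[OF this C(3)]] vK' show False by (rule notE)
  next
    assume "disjnt C ?K"
    then have "vertex_pt \<gamma> \<notin> ?K" using C(2) by (simp only: disjnt_iff) blast
    then show False using vK by (rule notE)
  qed
qed

definition vloop :: "(int \<Rightarrow> 'v) \<Rightarrow> real \<Rightarrow> 'v \<Rightarrow> real" where
  "vloop \<gamma> = loop_of (vertex_pt \<gamma>)"

lemma vloop_in_loops: "\<gamma> \<in> Om \<Longrightarrow> vloop \<gamma> \<in> loops"
  unfolding vloop_def by (intro loop_of_in_loops vertex_pt_in_MC)

text \<open>Homotopy classes of loops are path components of the loop space, and the two homotopy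
  inverse maps match these with the path components of \<open>TC\<close>.\<close>

lemma vloop_homotopic_iff:
  assumes "\<gamma> \<in> Om" "\<gamma>' \<in> Om"
  shows "loop_homotopic TB bpt (vloop \<gamma>) (vloop \<gamma>') \<longleftrightarrow> (\<gamma>, \<gamma>') \<in> Ed\<^sup>*"
proof
  have lp: "loop_homotopic TB bpt (vloop \<gamma>) (vloop \<gamma>') \<longleftrightarrow> path_component_of LB (vloop \<gamma>) (vloop \<gamma>')"
    by (rule loop_homotopic_iff_path_component[OF vloop_in_loops[OF assms(1)] vloop_in_loops[OF assms(2)]])
  have pth: "path_component_of TC (clique_of (vloop \<gamma>)) (vertex_pt \<gamma>)" if "\<gamma> \<in> Om" for \<gamma>
    using homotopic_with_imp_path_component[OF homotopic_clique_of_loop_of, of "vertex_pt \<gamma>"] vertex_pt_in_MC[OF that]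
    by (simp add: vloop_def)
  assume "loop_homotopic TB bpt (vloop \<gamma>) (vloop \<gamma>')"
  then have "path_component_of LB (vloop \<gamma>) (vloop \<gamma>')" by (simp only: lp)
  then have "path_component_of TC (clique_of (vloop \<gamma>)) (clique_of (vloop \<gamma>'))"
    by (rule path_component_of_continuous_image[OF _ continuous_map_clique_of])
  then have "path_component_of TC (vertex_pt \<gamma>) (vertex_pt \<gamma>')"
    using pth[OF assms(1)] pth[OF assms(2)] by (meson path_component_of_sym path_component_of_trans)
  then show "(\<gamma>, \<gamma>') \<in> Ed\<^sup>*" by (rule path_imp_Ed_star)
next
  have lp: "loop_homotopic TB bpt (vloop \<gamma>) (vloop \<gamma>') \<longleftrightarrow> path_component_of LB (vloop \<gamma>) (vloop \<gamma>')"
    by (rule loop_homotopic_iff_path_component[OF vloop_in_loops[OF assms(1)] vloop_in_loops[OF assms(2)]])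
  assume "(\<gamma>, \<gamma>') \<in> Ed\<^sup>*"
  then have "path_component_of TC (vertex_pt \<gamma>) (vertex_pt \<gamma>')" by (rule Ed_star_imp_path) (rule assms(1))
  then have "path_component_of LB (vloop \<gamma>) (vloop \<gamma>')"
    unfolding vloop_def by (rule path_component_of_continuous_image[OF _ continuous_map_loop_of])
  then show "loop_homotopic TB bpt (vloop \<gamma>) (vloop \<gamma>')" by (simp only: lp)
qed

text \<open>The clique point of a loop slides to any vertex of its support, and the homotopy
  equivalence carries this path back to the loop space.\<close>

lemma loop_homotopic_vloop:
  assumes w: "w \<in> loops_at TB bpt"
  obtains \<gamma> where "\<gamma> \<in> Om" "loop_homotopic TB bpt w (vloop \<gamma>)"
proof -
  \<comment> \<open>Members of \<open>loops_at\<close> are arbitrary outside the unit interval;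
    resetting them there gives a based loop.\<close>
  let ?w = "\<lambda>t. if t \<in> {0..1} then w t else bpt"
  have ww: "loop_homotopic TB bpt w ?w" by (rule loop_homotopic_equal[OF w]) simp
  then have l: "?w \<in> loops"
    using loop_homotopic_imp_loops_at(2)[OF ww] by (simp add: based_loops_def loops_at_def pathin_def)
  obtain \<gamma> where g: "clique_of ?w \<gamma> = 1" using MC_D(6)[OF clique_of_in_MC[OF l]] by blast
  then have gO: "\<gamma> \<in> Om" using MC_D(4)[OF clique_of_in_MC[OF l], of \<gamma>] by (metis zero_neq_one)
  have "path_component_of LB (loop_of (clique_of ?w)) ?w"
    using homotopic_with_imp_path_component[OF homotopic_loop_of_clique_of, of ?w] l by simp
  moreover have "path_component_of TC (clique_of ?w) (vertex_pt \<gamma>)"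
    using g by (intro path_to_vertex[OF clique_of_in_MC[OF l]]) linarith
  then have "path_component_of LB (loop_of (clique_of ?w)) (vloop \<gamma>)"
    unfolding vloop_def by (rule path_component_of_continuous_image[OF _ continuous_map_loop_of])
  ultimately have "path_component_of LB ?w (vloop \<gamma>)"
    by (meson path_component_of_sym path_component_of_trans)
  then have "loop_homotopic TB bpt ?w (vloop \<gamma>)"
    using loop_homotopic_iff_path_component[OF l vloop_in_loops[OF gO]] by blast
  then show ?thesis using that[OF gO] loop_homotopic_trans[OF ww] by blast
qed

section \<open>Paths in the graph as lists\<close>

text \<open>The list occupies the indices from 0 on and the base path continues it on both sides.
  The colours fit on the right because a closed list at \<open>x0\<close> has an even number of
  edges.\<close>

definition ext :: "'v list \<Rightarrow> int \<Rightarrow> 'v" where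
  "ext g k = (if 0 \<le> k \<and> k < int (length g) then g ! nat k else base k)"

definition win :: "(int \<Rightarrow> 'v) \<Rightarrow> int \<Rightarrow> int \<Rightarrow> 'v list" where
  "win \<gamma> a b = map \<gamma> [a..b]"

abbreviation "Lp \<equiv> loop2 V E x0"
abbreviation "Eq \<equiv> loop2_equiv V E x0"

lemma Eq_sym: "(g, h) \<in> Eq \<Longrightarrow> (h, g) \<in> Eq"
  unfolding loop2_equiv_def Let_def by (rule symD[OF sym_rtrancl]) (auto intro: symI)

lemma Eq_trans: "(g, h) \<in> Eq \<Longrightarrow> (h, k) \<in> Eq \<Longrightarrow> (g, k) \<in> Eq"
  unfolding loop2_equiv_def Let_def by (rule rtrancl_trans)

lemma Eq_refl [simp]: "(g, g) \<in> Eq"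
  by (simp add: loop2_equiv_def Let_def)

lemma Eq_step: "(g, h) \<in> loop2_step1 V E x0 \<or> (g, h) \<in> loop2_step2 V E x0 \<Longrightarrow> (g, h) \<in> Eq"
  unfolding loop2_equiv_def Let_def by blast

lemma Eq_induct [consumes 2, case_names refl step]:
  assumes "(g, h) \<in> Eq" "P g"
    and "\<And>h k. P h \<Longrightarrow> (h, k) \<in> loop2_step1 V E x0 \<or> (h, k) \<in> loop2_step2 V E x0 \<or>
        (k, h) \<in> loop2_step1 V E x0 \<or> (k, h) \<in> loop2_step2 V E x0 \<Longrightarrow> P k"
  shows "P h"
  using assms(1)[unfolded loop2_equiv_def Let_def] assms(2)
  by (induction rule: rtrancl_induct) (use assms(3) in blast)+

lemma Eq_Lp: "(g, h) \<in> Eq \<Longrightarrow> Lp g \<Longrightarrow> Lp h"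
  by (induction rule: Eq_induct) (auto simp: loop2_step1_def loop2_step2_def)

lemma Lp_nth:
  assumes g: "Lp g" and i: "i < length g"
  shows "g ! i \<in> V" "c (g ! i) = i mod 2"
proof -
  show V: "g ! i \<in> V" using g i by (auto simp: loop2_def)
  show "c (g ! i) = i mod 2"
    using i
  proof (induction i)
    case 0
    then show ?case using g x01 by (simp add: loop2_def)
  next
    case (Suc i)
    have "(g ! i, g ! Suc i) \<in> E" using g Suc(2) by (auto simp: loop2_def)
    then have "c (g ! Suc i) \<noteq> c (g ! i)" "g ! Suc i \<in> V" using E_col E_V by fastforce+
    moreover have "c (g ! i) = i mod 2" using Suc by simp
    ultimately show ?case using col[of "g ! Suc i"] by (auto simp: mod_Suc)
  qed
qed

text \<open>Colours alternate along the list and both ends have colour 0, so the number of edges is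
  even.\<close>

lemma Lp_length:
  assumes g: "Lp g" obtains m where "length g = 2 * m + 1"
proof -
  have n: "length g - 1 < length g" using g by (simp add: loop2_def)
  have "c (g ! (length g - 1)) = 0" using g x01 by (simp add: loop2_def)
  then have "(length g - 1) mod 2 = 0" using Lp_nth(2)[OF g n] by simp
  then obtain m where "length g - 1 = 2 * m" by auto
  then show ?thesis using that[of m] n by simp
qed

lemma ext_base:
  assumes g: "Lp g" and k: "k \<le> 0 \<or> int (length g) - 1 \<le> k"
  shows "ext g k = base k"
proof -
  obtain m where m: "length g = 2 * m + 1" by (rule Lp_length[OF g])
  have "g ! 0 = x0" "g ! (2 * m) = x0" using g m by (auto simp: loop2_def)
  moreover have "k = 0 \<or> k = 2 * int m \<or> k < 0 \<or> 2 * int m < k" using k m by linarith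
  ultimately show ?thesis using m by (auto simp: ext_def base_def nat_mult_distrib)
qed

lemma ext_in_Om:
  assumes g: "Lp g" shows "ext g \<in> Om"
  unfolding Om_iff
proof (intro conjI allI)
  fix k
  have "ext g k \<in> V \<and> c (ext g k) = par k"
  proof (cases "0 \<le> k \<and> k < int (length g)")
    case True
    then have "nat k < length g" by auto
    moreover have "nat k mod 2 = par k" using True by (simp add: par_def nat_mod_distrib)
    ultimately show ?thesis using Lp_nth[OF g, of "nat k"] True by (simp add: ext_def)
  next
    case False
    then have "ext g k = base k" by (auto simp: ext_def)
    then show ?thesis using base_props by simp
  qed
  then show "ext g k \<in> V" "c (ext g k) = par k" by auto
  show "(ext g k, ext g (k + 1)) \<in> E"
  proof (cases "0 \<le> k \<and> k + 1 < int (length g)")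
    case True
    then have "nat k + 1 < length g" "nat (k + 1) = nat k + 1" by auto
    then show ?thesis using g True by (auto simp: ext_def loop2_def)
  next
    case False
    then have "ext g k = base k" "ext g (k + 1) = base (k + 1)"
      using ext_base[OF g, of k] ext_base[OF g, of "k + 1"] by auto
    then show ?thesis using base_props by simp
  qed
next
  have "ext g k = base k" if "int (length g) \<le> \<bar>k\<bar>" for k
    by (rule ext_base[OF g]) (use that in linarith)
  then show "\<exists>N. \<forall>k. N \<le> \<bar>k\<bar> \<longrightarrow> ext g k = base k" by blast
qed

text \<open>Of two consecutive indices at most one is \<open>i\<close>, so each mixed pair is
  already an edge of one of the two paths.\<close>

lemma Ed_single:
  assumes "\<gamma> \<in> Om" "\<gamma>' \<in> Om" "\<And>k. k \<noteq> i \<Longrightarrow> \<gamma> k = \<gamma>' k"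
  shows "(\<gamma>, \<gamma>') \<in> Ed"
  unfolding Ed_iff
proof (intro conjI assms allI)
  fix k
  have "(\<gamma> k, \<gamma> (k + 1)) \<in> E" "(\<gamma>' k, \<gamma>' (k + 1)) \<in> E" using assms(1,2) by (auto simp: Om_iff)
  then show "(\<gamma> k, \<gamma>' (k + 1)) \<in> E" "(\<gamma>' k, \<gamma> (k + 1)) \<in> E"
    using assms(3)[of k] assms(3)[of "k + 1"] by (cases "k = i"; force)+
qed

section \<open>Backtracking spurs and the generating moves\<close>

text \<open>After index \<open>j\<close> the path steps back to \<open>\<gamma> (j - 1)\<close> and
  returns to \<open>\<gamma> j\<close>; the remainder is delayed by 2.\<close>

definition spur :: "int \<Rightarrow> (int \<Rightarrow> 'v) \<Rightarrow> int \<Rightarrow> 'v" where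
  "spur j \<gamma> k = (if k \<le> j then \<gamma> k else \<gamma> (k - 2))"

lemma par_minus_2: "par (k - 2) = par k" "base (k - 2) = base k"
  by (auto simp: par_eq base_def)

lemma spur_in_Om:
  assumes g: "\<gamma> \<in> Om" shows "spur j \<gamma> \<in> Om"
  unfolding Om_iff
proof (intro conjI allI)
  fix k
  show "spur j \<gamma> k \<in> V" "c (spur j \<gamma> k) = par k"
    using g par_minus_2(1)[of k] unfolding Om_iff spur_def by metis+
  have e: "(\<gamma> i, \<gamma> (i + 1)) \<in> E" for i using g by (simp add: Om_iff)
  consider "k + 1 \<le> j" | "k = j" | "j < k" by linarith
  then show "(spur j \<gamma> k, spur j \<gamma> (k + 1)) \<in> E"
  proof cases
    case 2
    then show ?thesis using E_sym[OF e[of "j - 1"]] by (simp add: spur_def)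
  qed (use e[of k] e[of "k - 2"] in \<open>auto simp: spur_def algebra_simps\<close>)
next
  obtain N where N: "\<forall>k. N \<le> \<bar>k\<bar> \<longrightarrow> \<gamma> k = base k" using g Om_iff by blast
  have "spur j \<gamma> k = base k" if "N + 2 \<le> \<bar>k\<bar>" for k
    using N[rule_format, of k] N[rule_format, of "k - 2"] that par_minus_2(2)[of k] unfolding spur_def by (auto; linarith)
  then show "\<exists>N. \<forall>k. N \<le> \<bar>k\<bar> \<longrightarrow> spur j \<gamma> k = base k" by blast
qed

text \<open>Moving a backtracking spur in from \<open>+\<infinity>\<close>: each step changes a single value.\<close>
lemma Ed_star_spur:
  assumes g: "\<gamma> \<in> Om" shows "(\<gamma>, spur j \<gamma>) \<in> Ed\<^sup>*"
proof -
  obtain N where N: "\<forall>k. N \<le> \<bar>k\<bar> \<longrightarrow> \<gamma> k = base k" using g Om_iff by blast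
  \<comment> \<open>Far out on the right the path has period 2, so a spur at \<open>J\<close>
    changes nothing.\<close>
  define J where "J = max j (\<bar>N\<bar> + 2)"
  have eq: "spur J \<gamma> = \<gamma>"
  proof
    fix k
    show "spur J \<gamma> k = \<gamma> k"
      using N[rule_format, of k] N[rule_format, of "k - 2"] par_minus_2(2)[of k] unfolding spur_def J_def by auto
  qed
  \<comment> \<open>The two paths differ only at index \<open>i + 1\<close>, in
    \<open>\<gamma> (i + 1)\<close> against \<open>\<gamma> (i - 1)\<close>.\<close>
  have step: "(spur (i + 1) \<gamma>, spur i \<gamma>) \<in> Ed" for i
    by (rule Ed_single[where i="i + 1"]) (auto intro: spur_in_Om g simp: spur_def)
  have "(spur (j + int n) \<gamma>, spur j \<gamma>) \<in> Ed\<^sup>*" for n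
  proof (induction n)
    case (Suc n)
    have "(spur (j + int (Suc n)) \<gamma>, spur (j + int n) \<gamma>) \<in> Ed" using step[of "j + int n"] by (simp add: algebra_simps)
    then show ?case using Suc by (rule converse_rtrancl_into_rtrancl)
  qed simp
  from this[of "nat (J - j)"] show ?thesis using eq by (simp add: J_def)
qed

text \<open>A spur inserted on the left tail, where the path has period 2, amounts to a shift by
  2.\<close>

lemma Ed_star_shift:
  assumes g: "\<gamma> \<in> Om"
  shows "(\<lambda>k. \<gamma> (k - 2 * int n)) \<in> Om \<and> (\<gamma>, \<lambda>k. \<gamma> (k - 2 * int n)) \<in> Ed\<^sup>*"
proof (induction n)
  case (Suc n)
  let ?d = "\<lambda>k. \<gamma> (k - 2 * int n)"
  have "?d \<in> Om" using Suc by simp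
  then obtain N where N: "\<forall>k. N \<le> \<bar>k\<bar> \<longrightarrow> ?d k = base k" unfolding Om_iff by blast
  have "spur (- \<bar>N\<bar>) ?d = (\<lambda>k. \<gamma> (k - 2 * int (Suc n)))"
  proof
    fix k
    show "spur (- \<bar>N\<bar>) ?d k = \<gamma> (k - 2 * int (Suc n))"
    proof (cases "k \<le> - \<bar>N\<bar>")
      case True
      then have "?d k = base k" "?d (k - 2) = base (k - 2)" using N by auto
      then show ?thesis using True par_minus_2(2)[of k] by (simp add: spur_def algebra_simps)
    qed (simp add: spur_def algebra_simps)
  qed
  then show ?case
    using Suc Ed_star_spur[of ?d "- \<bar>N\<bar>"] spur_in_Om[of ?d "- \<bar>N\<bar>"] by (auto intro: rtrancl_trans)
qed (use g in simp)

text \<open>The first move inserts two steps after index \<open>x\<close>. The spur at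
  \<open>x\<close> does so with one particular detour vertex, and the actual detour differs from it
  at most at index \<open>x + 1\<close>.\<close>

lemma step1_imp_Ed_star:
  assumes "(g, g') \<in> loop2_step1 V E x0" shows "(ext g, ext g') \<in> Ed\<^sup>*"
proof -
  have L: "Lp g" "Lp g'" and len1: "length g' - 1 = (length g - 1) + 2"
    using assms by (auto simp: loop2_step1_def)
  have "g \<noteq> []" "g' \<noteq> []" using L by (auto simp: loop2_def)
  then have len: "length g' = length g + 2" using len1 by (cases g; cases g') auto
  obtain x where x: "x \<le> length g - 1" "\<And>i. i \<le> x \<Longrightarrow> g ! i = g' ! i"
      "\<And>i. x \<le> i \<Longrightarrow> i \<le> length g - 1 \<Longrightarrow> g' ! (i + 2) = g ! i"
    using assms by (auto simp: loop2_step1_def)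
  have ne: "0 < length g" using L by (simp add: loop2_def)
  then have xl: "x < length g" using x(1) by linarith
  have "spur (int x) (ext g) k = ext g' k" if kx: "k \<noteq> int x + 1" for k
  proof -
    consider "k < 0" | "0 \<le> k" "k \<le> int x" | "int x + 2 \<le> k" "k < int (length g')" | "int (length g') \<le> k"
      using kx by linarith
    then show ?thesis
    proof cases
      case 1
      then show ?thesis by (simp add: spur_def ext_def)
    next
      case 2
      then have "nat k \<le> x" "k < int (length g)" "k < int (length g')" using xl len by auto
      then show ?thesis using 2 x(2)[of "nat k"] by (simp add: spur_def ext_def)
    next
      case 3
      then have "x \<le> nat (k - 2)" "nat (k - 2) \<le> length g - 1" "nat (k - 2) + 2 = nat k" "k - 2 < int (length g)"
        using len by auto
      then show ?thesis using 3 x(3)[of "nat (k - 2)"] by (simp add: spur_def ext_def)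
    next
      case 4
      then have "spur (int x) (ext g) k = base (k - 2)" using xl len by (simp add: spur_def ext_def)
      then show ?thesis using 4 par_minus_2(2)[of k] by (simp add: ext_def)
    qed
  qed
  then have "(spur (int x) (ext g), ext g') \<in> Ed"
    by (intro Ed_single[where i="int x + 1"] spur_in_Om ext_in_Om L)
  then show ?thesis using Ed_star_spur[OF ext_in_Om[OF L(1)]] by (rule rtrancl_into_rtrancl[rotated])
qed

lemma step2_imp_Ed:
  assumes "(g, g') \<in> loop2_step2 V E x0" shows "(ext g, ext g') \<in> Ed"
proof -
  have L: "Lp g" "Lp g'" and len: "length g' = length g"
    and e: "\<And>i j. i \<le> length g - 1 \<Longrightarrow> j \<le> length g - 1 \<Longrightarrow> i = j + 1 \<or> j = i + 1 \<Longrightarrow> (g ! i, g' ! j) \<in> E"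
    using assms by (auto simp: loop2_step2_def)
  show ?thesis
    unfolding Ed_iff
  proof (intro conjI ext_in_Om L allI)
    fix k
    consider "0 \<le> k" "k + 1 < int (length g)" | "k + 1 \<le> 0 \<or> int (length g) - 1 \<le> k" by linarith
    then have "(ext g k, ext g' (k + 1)) \<in> E \<and> (ext g' k, ext g (k + 1)) \<in> E"
    proof cases
      case 1
      then have "nat k \<le> length g - 1" "nat k + 1 \<le> length g - 1" "nat (k + 1) = nat k + 1" by auto
      then show ?thesis
        using 1 e[of "nat k" "nat k + 1"] E_sym[OF e[of "nat k + 1" "nat k"]] len by (simp add: ext_def)
    next
      case 2
      then have "ext g k = base k" "ext g (k + 1) = base (k + 1)" "ext g' k = base k" "ext g' (k + 1) = base (k + 1)"
        using ext_base[OF L(1), of k] ext_base[OF L(1), of "k + 1"] ext_base[OF L(2), of k] ext_base[OF L(2), of "k + 1"] len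
        by auto
      then show ?thesis using base_props by simp
    qed
    then show "(ext g k, ext g' (k + 1)) \<in> E" "(ext g' k, ext g (k + 1)) \<in> E" by auto
  qed
qed

lemma Eq_imp_Ed_star:
  assumes "(g, g') \<in> Eq" shows "(ext g, ext g') \<in> Ed\<^sup>*"
proof (rule Eq_induct[where P="\<lambda>h. (ext g, ext h) \<in> Ed\<^sup>*", OF assms])
  fix h k assume h: "(ext g, ext h) \<in> Ed\<^sup>*"
    and "(h, k) \<in> loop2_step1 V E x0 \<or> (h, k) \<in> loop2_step2 V E x0 \<or>
        (k, h) \<in> loop2_step1 V E x0 \<or> (k, h) \<in> loop2_step2 V E x0"
  then have "(ext h, ext k) \<in> Ed\<^sup>*"
    using step1_imp_Ed_star step2_imp_Ed Ed_star_sym by (metis r_into_rtrancl)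
  with h show "(ext g, ext k) \<in> Ed\<^sup>*" by (rule rtrancl_trans)
qed simp

section \<open>Restriction of bi-infinite paths to finite windows\<close>

text \<open>Even ends make the window begin and end at \<open>x0\<close>, so that it cuts out a
  closed list.\<close>

definition covers :: "(int \<Rightarrow> 'v) \<Rightarrow> int \<Rightarrow> int \<Rightarrow> bool" where
  "covers \<gamma> a b \<longleftrightarrow> even a \<and> even b \<and> a \<le> b \<and> (\<forall>k. k \<le> a \<or> b \<le> k \<longrightarrow> \<gamma> k = base k)"

lemma win_nth: "i < nat (b - a + 1) \<Longrightarrow> win \<gamma> a b ! i = \<gamma> (a + int i)"
  by (simp add: win_def)

lemma length_win: "length (win \<gamma> a b) = nat (b - a + 1)"
  by (simp add: win_def)

lemma length_win_minus: "a \<le> b \<Longrightarrow> length (win \<gamma> a b) - 1 = nat (b - a)"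
  by (simp add: length_win)

lemma win_Lp:
  assumes g: "\<gamma> \<in> Om" and cv: "covers \<gamma> a b" shows "Lp (win \<gamma> a b)"
  unfolding loop2_def
proof (intro conjI allI impI)
  have ab: "a \<le> b" "\<gamma> a = x0" "\<gamma> b = x0" using cv by (auto simp: covers_def base_def)
  show "win \<gamma> a b \<noteq> []" using ab by (simp add: win_def)
  show "set (win \<gamma> a b) \<subseteq> V" using g by (auto simp: win_def Om_iff)
  show "win \<gamma> a b ! 0 = x0" "win \<gamma> a b ! (length (win \<gamma> a b) - 1) = x0"
    using ab win_nth[of 0 b a \<gamma>] win_nth[of "nat (b - a)" b a \<gamma>] length_win_minus[OF ab(1)] by simp_all
  fix i assume "i + 1 < length (win \<gamma> a b)"
  then have "i + 1 < nat (b - a + 1)" by (simp add: length_win)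
  then show "(win \<gamma> a b ! i, win \<gamma> a b ! (i + 1)) \<in> E"
    using win_nth[of i b a \<gamma>] win_nth[of "i + 1" b a \<gamma>] g[unfolded Om_iff, THEN conjunct1, rule_format, of "a + int i"]
    by (simp add: algebra_simps)
qed

lemma covers_mono:
  assumes "covers \<gamma> a b" "a' \<le> a" "b \<le> b'" "even a'" "even b'"
  shows "covers \<gamma> a' b'"
  using assms unfolding covers_def by auto

text \<open>The wider window begins with \<open>x0\<close>, \<open>x1\<close>, \<open>x0\<close>,
  which is the first move at position 0; \<open>win_right\<close> uses the last position in the same
  way.\<close>

lemma win_left:
  assumes g: "\<gamma> \<in> Om" and cv: "covers \<gamma> a b"
  shows "(win \<gamma> a b, win \<gamma> (a - 2) b) \<in> Eq"
proof (rule Eq_step, rule disjI1)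
  have cv': "covers \<gamma> (a - 2) b" by (rule covers_mono[OF cv]) (use cv in \<open>auto simp: covers_def\<close>)
  have ab: "a \<le> b" "\<gamma> a = \<gamma> (a - 2)" using cv by (auto simp: covers_def base_def)
  have e: "win \<gamma> (a - 2) b = \<gamma> (a - 2) # \<gamma> (a - 1) # win \<gamma> a b"
    using ab by (simp add: win_def upto_rec1[of "a - 2"] upto_rec1[of "a - 1"])
  have w0: "win \<gamma> a b ! 0 = \<gamma> a" using ab win_nth[of 0 b a \<gamma>] by simp
  have ne: "win \<gamma> a b \<noteq> []" using ab by (simp add: win_def)
  show "(win \<gamma> a b, win \<gamma> (a - 2) b) \<in> loop2_step1 V E x0"
    unfolding loop2_step1_def mem_Collect_eq prod.case
  proof (intro conjI win_Lp g cv cv' exI[of _ 0])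
    show "length (win \<gamma> (a - 2) b) - 1 = length (win \<gamma> a b) - 1 + 2" using ab by (simp add: length_win)
    show "\<forall>i\<le>0. win \<gamma> a b ! i = win \<gamma> (a - 2) b ! i" using w0 ab by (simp add: e)
    show "\<forall>i. 0 \<le> i \<and> i \<le> length (win \<gamma> a b) - 1 \<longrightarrow> win \<gamma> (a - 2) b ! (i + 2) = win \<gamma> a b ! i"
      by (simp add: e)
  qed simp
qed

lemma win_right:
  assumes g: "\<gamma> \<in> Om" and cv: "covers \<gamma> a b"
  shows "(win \<gamma> a b, win \<gamma> a (b + 2)) \<in> Eq"
proof (rule Eq_step, rule disjI1)
  have cv': "covers \<gamma> a (b + 2)" by (rule covers_mono[OF cv]) (use cv in \<open>auto simp: covers_def\<close>)
  have ab: "a \<le> b" "\<gamma> b = \<gamma> (b + 2)" using cv by (auto simp: covers_def base_def)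
  show "(win \<gamma> a b, win \<gamma> a (b + 2)) \<in> loop2_step1 V E x0"
    unfolding loop2_step1_def mem_Collect_eq prod.case
  proof (intro conjI win_Lp g cv cv' exI[of _ "length (win \<gamma> a b) - 1"] allI impI)
    show "length (win \<gamma> a (b + 2)) - 1 = length (win \<gamma> a b) - 1 + 2" using ab by (simp add: length_win)
    show "win \<gamma> a b ! i = win \<gamma> a (b + 2) ! i" if "i \<le> length (win \<gamma> a b) - 1" for i
      using that ab win_nth[of i b a \<gamma>] win_nth[of i "b + 2" a \<gamma>] by (simp add: length_win)
    fix i assume i: "length (win \<gamma> a b) - 1 \<le> i \<and> i \<le> length (win \<gamma> a b) - 1"
    then have "i = nat (b - a)" using length_win_minus[OF ab(1)] by simp
    then show "win \<gamma> a (b + 2) ! (i + 2) = win \<gamma> a b ! i"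
      using ab win_nth[of i b a \<gamma>] win_nth[of "i + 2" "b + 2" a \<gamma>] by (simp add: algebra_simps)
  qed simp
qed

text \<open>Both windows are widened, two indices at a time, to a common one.\<close>

lemma win_Eq:
  assumes g: "\<gamma> \<in> Om" and cv: "covers \<gamma> a b" "covers \<gamma> a' b'"
  shows "(win \<gamma> a b, win \<gamma> a' b') \<in> Eq"
proof -
  have left: "(win \<gamma> a b, win \<gamma> (a - 2 * int n) b) \<in> Eq" if "covers \<gamma> a b" for a b n
  proof (induction n)
    case (Suc n)
    have "covers \<gamma> (a - 2 * int n) b"
      using covers_mono[OF that, of "a - 2 * int n" b] that by (auto simp: covers_def)
    from Eq_trans[OF Suc win_left[OF g this]] show ?case by (simp add: algebra_simps)
  qed simp
  have right: "(win \<gamma> a b, win \<gamma> a (b + 2 * int n)) \<in> Eq" if "covers \<gamma> a b" for a b n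
  proof (induction n)
    case (Suc n)
    have "covers \<gamma> a (b + 2 * int n)"
      using covers_mono[OF that, of a "b + 2 * int n"] that by (auto simp: covers_def)
    from Eq_trans[OF Suc win_right[OF g this]] show ?case by (simp add: algebra_simps)
  qed simp
  have half: "\<exists>i. k = 2 * int i" if "even k" "0 \<le> k" for k :: int
    using that by (metis evenE nonneg_int_cases zero_le_mult_iff zero_le_numeral not_numeral_le_zero)
  have both: "(win \<gamma> a b, win \<gamma> a0 b0) \<in> Eq" if c: "covers \<gamma> a b" and le: "a0 \<le> a" "b \<le> b0" "even a0" "even b0" for a b a0 b0
  proof -
    have ev: "even a" "even b" using c by (auto simp: covers_def)
    obtain i where i: "a - a0 = 2 * int i" using half[of "a - a0"] le ev by auto
    obtain j where j: "b0 - b = 2 * int j" using half[of "b0 - b"] le ev by auto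
    have "covers \<gamma> a0 b" by (rule covers_mono[OF c]) (use le ev in auto)
    then have "(win \<gamma> a0 b, win \<gamma> a0 b0) \<in> Eq" using right[of a0 b j] j by (simp add: algebra_simps)
    moreover have "(win \<gamma> a b, win \<gamma> a0 b) \<in> Eq" using left[OF c, of i] i by (simp add: algebra_simps)
    ultimately show ?thesis using Eq_trans by blast
  qed
  have ev: "even (min a a')" "even (max b b')" using cv by (auto simp: covers_def min_def max_def)
  show ?thesis
    using both[OF cv(1) _ _ ev] both[OF cv(2) _ _ ev] Eq_sym Eq_trans by (meson max.cobounded1 max.cobounded2 min.cobounded1 min.cobounded2)
qed

lemma ex_covers:
  assumes "\<gamma> \<in> Om" "\<gamma>' \<in> Om"
  obtains n where "covers \<gamma> (- 2 * int n) (2 * int n)" "covers \<gamma>' (- 2 * int n) (2 * int n)"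
proof -
  obtain N where N: "0 \<le> N" "\<forall>\<gamma>\<in>{\<gamma>, \<gamma>'} \<inter> Om. \<forall>k. N \<le> \<bar>k\<bar> \<longrightarrow> \<gamma> k = base k"
    using Om_uniform_bound[of "{\<gamma>, \<gamma>'}"] by auto
  then have "covers \<delta> (- 2 * int (nat N)) (2 * int (nat N))" if "\<delta> \<in> {\<gamma>, \<gamma>'}" for \<delta>
    using that assms unfolding covers_def by auto
  then show ?thesis using that by blast
qed

lemma Ed_imp_win_Eq:
  assumes "(\<gamma>, \<gamma>') \<in> Ed" "covers \<gamma> a b" "covers \<gamma>' a b"
  shows "(win \<gamma> a b, win \<gamma>' a b) \<in> Eq"
proof (rule Eq_step, rule disjI2)
  have O: "\<gamma> \<in> Om" "\<gamma>' \<in> Om" "\<And>k. (\<gamma> k, \<gamma>' (k + 1)) \<in> E" "\<And>k. (\<gamma>' k, \<gamma> (k + 1)) \<in> E"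
    using assms(1) by (auto simp: Ed_iff)
  have ab: "a \<le> b" using assms(2) by (simp add: covers_def)
  show "(win \<gamma> a b, win \<gamma>' a b) \<in> loop2_step2 V E x0"
    unfolding loop2_step2_def mem_Collect_eq prod.case
  proof (intro conjI win_Lp O assms allI impI)
    show "length (win \<gamma> a b) = length (win \<gamma>' a b)" by (simp add: length_win)
    fix i j assume ij: "i \<le> length (win \<gamma> a b) - 1 \<and> j \<le> length (win \<gamma> a b) - 1 \<and> (i = j + 1 \<or> j = i + 1)"
    then have "i < nat (b - a + 1)" "j < nat (b - a + 1)" using ab by (auto simp: length_win)
    then show "(win \<gamma> a b ! i, win \<gamma>' a b ! j) \<in> E"
      using ij win_nth[of i b a \<gamma>] win_nth[of j b a \<gamma>'] O(3)[of "a + int i"] E_sym[OF O(4)[of "a + int j"]]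
      by (auto simp: algebra_simps)
  qed
qed

text \<open>Each pair of adjacent paths has a common window, on which adjacency is the second move.
  The windows vary along the chain, and \<open>win_Eq\<close> accounts for the changes.\<close>

lemma Ed_star_imp_win_Eq:
  assumes "(\<gamma>, \<gamma>') \<in> Ed\<^sup>*" "\<gamma> \<in> Om" "covers \<gamma> a b" "covers \<gamma>' a' b'"
  shows "(win \<gamma> a b, win \<gamma>' a' b') \<in> Eq"
  using assms(1,4)
proof (induction arbitrary: a' b' rule: rtrancl_induct)
  case base
  then show ?case using win_Eq[OF assms(2,3)] by blast
next
  case (step \<delta> \<delta>')
  have O: "\<delta> \<in> Om" "\<delta>' \<in> Om" using step(2) by (auto simp: Ed_iff)
  obtain n where n: "covers \<delta> (- 2 * int n) (2 * int n)" "covers \<delta>' (- 2 * int n) (2 * int n)" by (rule ex_covers[OF O])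
  have "(win \<gamma> a b, win \<delta> (- 2 * int n) (2 * int n)) \<in> Eq" by (rule step(3)[OF n(1)])
  moreover have "(win \<delta> (- 2 * int n) (2 * int n), win \<delta>' (- 2 * int n) (2 * int n)) \<in> Eq"
    by (rule Ed_imp_win_Eq[OF step(2) n])
  moreover have "(win \<delta>' (- 2 * int n) (2 * int n), win \<delta>' a' b') \<in> Eq" by (rule win_Eq[OF O(2) n(2) step(4)])
  ultimately show ?case using Eq_trans by blast
qed

lemma win_ext:
  assumes g: "Lp g"
  shows "covers (ext g) 0 (int (length g) - 1)" "win (ext g) 0 (int (length g) - 1) = g"
proof -
  obtain m where m: "length g = 2 * m + 1" by (rule Lp_length[OF g])
  show "covers (ext g) 0 (int (length g) - 1)"
    using ext_base[OF g] m by (auto simp: covers_def)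
  show "win (ext g) 0 (int (length g) - 1) = g"
    by (rule nth_equalityI) (auto simp: length_win win_nth ext_def)
qed

lemma Ed_star_ext_iff:
  assumes "Lp g" "Lp g'" shows "(ext g, ext g') \<in> Ed\<^sup>* \<longleftrightarrow> (g, g') \<in> Eq"
  using Ed_star_imp_win_Eq[OF _ ext_in_Om[OF assms(1)] win_ext(1)[OF assms(1)] win_ext(1)[OF assms(2)]]
    Eq_imp_Ed_star win_ext(2)[OF assms(1)] win_ext(2)[OF assms(2)] by metis

text \<open>A window starting at \<open>- 2 * n\<close> is placed by \<open>ext\<close> at index 0.
  The outcome is the path shifted by \<open>2 * n\<close>, which lies in the same component.\<close>

lemma Om_ext:
  assumes g: "\<gamma> \<in> Om" obtains h where "Lp h" "(\<gamma>, ext h) \<in> Ed\<^sup>*"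
proof -
  obtain n where n: "covers \<gamma> (- 2 * int n) (2 * int n)" by (rule ex_covers[OF g g])
  let ?h = "win \<gamma> (- 2 * int n) (2 * int n)"
  have "ext ?h = (\<lambda>k. \<gamma> (k - 2 * int n))"
  proof
    fix k
    show "ext ?h k = \<gamma> (k - 2 * int n)"
    proof (cases "0 \<le> k \<and> k < int (length ?h)")
      case True
      then show ?thesis using win_nth[of "nat k" "2 * int n" "- 2 * int n" \<gamma>] by (simp add: ext_def length_win)
    next
      case False
      then have "k - 2 * int n \<le> - 2 * int n \<or> 2 * int n \<le> k - 2 * int n" by (auto simp: length_win)
      then have "\<gamma> (k - 2 * int n) = base (k - 2 * int n)" using n by (auto simp: covers_def)
      moreover have "ext ?h k = base k" using False by (auto simp: ext_def)
      ultimately show ?thesis by (simp add: base_def)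
    qed
  qed
  then show ?thesis using that[OF win_Lp[OF g n]] Ed_star_shift[OF g, of n] by simp
qed

section \<open>The isomorphism of fundamental groups\<close>


text \<open>The lists share the vertex \<open>x0\<close> at the junction, of which \<open>tl\<close>
  removes one copy; at that index both descriptions agree.\<close>

lemma Lp_append_nth:
  assumes "Lp g" "Lp h" "length g - 1 \<le> i" "i < length (g @ tl h)"
  shows "(g @ tl h) ! i = h ! (i - (length g - 1))"
proof (cases "i < length g")
  case True
  then have "i = length g - 1" using assms(3) by linarith
  moreover have "g ! (length g - 1) = x0" "h ! 0 = x0" using assms by (auto simp: loop2_def)
  ultimately show ?thesis using True by (simp add: nth_append)
next
  case False
  have "g \<noteq> []" "h \<noteq> []" using assms by (auto simp: loop2_def)
  then have "i - (length g - 1) = Suc (i - length g)" using False by (cases g) auto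
  then show ?thesis using False assms(4) \<open>h \<noteq> []\<close> by (simp add: nth_append nth_tl)
qed

lemma length_Lp_append: "Lp g \<Longrightarrow> Lp h \<Longrightarrow> length (g @ tl h) = (length g - 1) + length h"
  by (cases g; cases h) (auto simp: loop2_def)

lemma Lp_append:
  assumes "Lp g" "Lp h" shows "Lp (g @ tl h)"
  unfolding loop2_def
proof (intro conjI allI impI)
  have ne: "g \<noteq> []" "h \<noteq> []" using assms by (auto simp: loop2_def)
  then have pos: "0 < length g" "0 < length h" by auto
  note len = length_Lp_append[OF assms]
  note nth = Lp_append_nth[OF assms]
  show "g @ tl h \<noteq> []" using ne by simp
  show "set (g @ tl h) \<subseteq> V" using assms list.set_sel(2)[OF ne(2)] by (auto simp: loop2_def)
  show "(g @ tl h) ! 0 = x0" using assms ne by (simp add: loop2_def nth_append)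
  have "(g @ tl h) ! (length (g @ tl h) - 1) = h ! (length h - 1)"
    by (subst nth) (use len pos in simp_all)
  then show "(g @ tl h) ! (length (g @ tl h) - 1) = x0" using assms by (simp add: loop2_def)
  fix i assume i: "i + 1 < length (g @ tl h)"
  show "((g @ tl h) ! i, (g @ tl h) ! (i + 1)) \<in> E"
  proof (cases "i + 1 < length g")
    case True
    then show ?thesis using assms by (simp add: loop2_def nth_append)
  next
    case False
    then have li: "length g - 1 \<le> i" by linarith
    have "(g @ tl h) ! i = h ! (i - (length g - 1))" by (rule nth) (use li i in linarith)+
    moreover have "(g @ tl h) ! (i + 1) = h ! (i + 1 - (length g - 1))" by (rule nth) (use li i in linarith)+
    moreover have "i + 1 - (length g - 1) = i - (length g - 1) + 1" using li by linarith
    moreover have "i - (length g - 1) + 1 < length h" using i False len pos by linarith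
    ultimately show ?thesis using assms(2) by (simp only: loop2_def)
  qed
qed

lemma ext_append:
  assumes "Lp g" "Lp h"
  shows "k \<le> int (length g) - 1 \<Longrightarrow> ext (g @ tl h) k = ext g k"
    and "int (length g) - 1 \<le> k \<Longrightarrow> ext (g @ tl h) k = ext h (k - (int (length g) - 1))"
proof -
  have pos: "0 < length g" "0 < length h" using assms by (auto simp: loop2_def)
  obtain m where m: "length g = 2 * m + 1" by (rule Lp_length[OF assms(1)])
  note len = length_Lp_append[OF assms]
  show "ext (g @ tl h) k = ext g k" if "k \<le> int (length g) - 1"
    using that pos by (auto simp: ext_def nth_append)
  show "ext (g @ tl h) k = ext h (k - (int (length g) - 1))" if k: "int (length g) - 1 \<le> k"
  proof (cases "k < int (length (g @ tl h))")
    case True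
    then have "length g - 1 \<le> nat k" "nat k < length (g @ tl h)" "nat k - (length g - 1) = nat (k - (int (length g) - 1))"
      using k pos by linarith+
    moreover have "0 \<le> k" "0 \<le> k - (int (length g) - 1)" "k - (int (length g) - 1) < int (length h)"
      using k True len pos by linarith+
    ultimately show ?thesis using Lp_append_nth[OF assms, of "nat k"] True by (simp add: ext_def)
  next
    case False
    then have "\<not> k - (int (length g) - 1) < int (length h)" using len pos by auto
    then have "ext h (k - (int (length g) - 1)) = base (k - 2 * int m)" "ext (g @ tl h) k = base k"
      using False m by (simp_all add: ext_def)
    then show ?thesis by (simp add: base_def)
  qed
qed

lemma Lp_base_spur: "Lp [x0, x1, x0]"
  using x01 by (auto simp: loop2_def less_Suc_eq nth_Cons')

lemma Eq_append_spur:
  assumes "Lp g" "Lp h" shows "(g @ tl h, (g @ [x1, x0]) @ tl h) \<in> Eq"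
proof (rule Eq_step, rule disjI1)
  have L: "Lp (g @ [x1, x0])" using Lp_append[OF assms(1) Lp_base_spur] by simp
  have pos: "0 < length g" "g ! (length g - 1) = x0" using assms by (auto simp: loop2_def)
  show "(g @ tl h, (g @ [x1, x0]) @ tl h) \<in> loop2_step1 V E x0"
    unfolding loop2_step1_def mem_Collect_eq prod.case
  proof (intro conjI Lp_append assms L exI[of _ "length g - 1"] allI impI)
    show "length ((g @ [x1, x0]) @ tl h) - 1 = length (g @ tl h) - 1 + 2" using pos by simp
    show "length g - 1 \<le> length (g @ tl h) - 1" by simp
    show "(g @ tl h) ! i = ((g @ [x1, x0]) @ tl h) ! i" if "i \<le> length g - 1" for i
    proof -
      have "i < length g" using that pos(1) by linarith
      then show ?thesis by (simp add: nth_append)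
    qed
    show "((g @ [x1, x0]) @ tl h) ! (i + 2) = (g @ tl h) ! i" if i: "length g - 1 \<le> i \<and> i \<le> length (g @ tl h) - 1" for i
    proof (cases "i = length g - 1")
      case True
      then have "i + 2 = Suc (length g)" using pos by simp
      then show ?thesis using True pos by (simp add: nth_append)
    next
      case False
      then have "length g \<le> i" using i by linarith
      then show ?thesis by (simp add: nth_append)
    qed
  qed
qed

text \<open>The two descriptions overlap on \<open>n\<close>, \<open>n + 1\<close>,
  \<open>n + 2\<close>, where the path is \<open>base\<close>. These are all the indices within
  reach of \<open>kap\<close> around \<open>n + 1\<close>, which is what splits the track
  there.\<close>

lemma ext_append_spur:
  assumes "Lp g" "Lp h" defines "n \<equiv> int (length g) - 1"
  shows "k \<le> n + 2 \<Longrightarrow> ext ((g @ [x1, x0]) @ tl h) k = ext g k"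
    and "n \<le> k \<Longrightarrow> ext ((g @ [x1, x0]) @ tl h) k = ext h (k - (n + 2))"
proof -
  have L: "Lp (g @ [x1, x0])" using Lp_append[OF assms(1) Lp_base_spur] by simp
  obtain m where m: "length g = 2 * m + 1" by (rule Lp_length[OF assms(1)])
  have sp: "ext [x0, x1, x0] k = base k" for k
  proof -
    consider "k = 0" | "k = 1" | "k = 2" | "k < 0 \<or> 3 \<le> k" by linarith
    then show ?thesis by cases (auto simp: ext_def base_def)
  qed
  have e: "ext (g @ [x1, x0]) k = ext g k" for k
  proof (cases "k \<le> int (length g) - 1")
    case True
    then show ?thesis using ext_append(1)[OF assms(1) Lp_base_spur] by simp
  next
    case False
    then have "ext (g @ [x1, x0]) k = base (k - 2 * int m)"
      using ext_append(2)[OF assms(1) Lp_base_spur, of k] m by (simp add: sp)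
    moreover have "ext g k = base k" using False ext_base[OF assms(1)] by simp
    ultimately show ?thesis by (simp add: base_def)
  qed
  note a = ext_append[OF L assms(2), unfolded e]
  show l: "ext ((g @ [x1, x0]) @ tl h) k = ext g k" if "k \<le> n + 2" for k
    using a(1)[of k] that by (simp add: n_def)
  show "ext ((g @ [x1, x0]) @ tl h) k = ext h (k - (n + 2))" if "n \<le> k"
  proof (cases "n + 2 \<le> k")
    case True
    then show ?thesis using a(2)[of k] by (simp add: n_def)
  next
    case False
    then have "ext ((g @ [x1, x0]) @ tl h) k = base k" using l[of k] ext_base[OF assms(1), of k] that by (simp add: n_def)
    moreover have "ext h (k - (n + 2)) = base (k - (n + 2))" using False by (intro ext_base[OF assms(2)]) simp
    ultimately show ?thesis using m by (simp add: base_def n_def)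
  qed
qed

section \<open>Tracks of single paths\<close>

lemma marg_vertex_pt: "marg (vertex_pt \<gamma>) k v = (if v = \<gamma> k then 1 else 0)"
proof -
  have "marg (vertex_pt \<gamma>) k v = Max (insert 0 ((\<lambda>\<gamma>'. if \<gamma>' k = v then vertex_pt \<gamma> \<gamma>' else 0) ` {\<gamma>}))"
    unfolding marg_def by (rule fmax_eq) (simp add: vertex_pt_def)
  then show ?thesis by (auto simp: vertex_pt_def)
qed

text \<open>Kept on the real line instead of the unit interval, so that a shift of the path is a
  translation of time.\<close>

definition track :: "(int \<Rightarrow> 'v) \<Rightarrow> real \<Rightarrow> 'v \<Rightarrow> real" where
  "track \<gamma> = line (\<lambda>k v. if v = \<gamma> k then 1 else 0)"

lemma track_cong:
  assumes "\<And>k. \<bar>s - of_int k\<bar> < 3/2 \<Longrightarrow> \<gamma> k = \<gamma>' k" shows "track \<gamma> s = track \<gamma>' s"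
proof
  fix v
  have "(\<lambda>k. kap (s - of_int k) * (if v = \<gamma> k then 1 else 0)) = (\<lambda>k. kap (s - of_int k) * (if v = \<gamma>' k then 1 else 0))"
    using assms kap_nonzero by (intro ext) (metis mult_zero_left)
  then show "track \<gamma> s v = track \<gamma>' s v" unfolding track_def line_def by (rule arg_cong)
qed

lemma track_shift: "track (\<lambda>k. \<gamma> (k - m)) s = track \<gamma> (s - of_int m)"
proof
  fix v
  let ?f = "\<lambda>k. kap (s - of_int m - of_int k) * (if v = \<gamma> k then 1 else 0)"
  \<comment> \<open>Translation by \<open>m\<close> permutes the integers, so both families have the
    same range and hence the same maximum.\<close>
  have "range (\<lambda>k. kap (s - of_int k) * (if v = \<gamma> (k - m) then 1 else 0)) = range ?f"
  proof (intro equalityI subsetI)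
    fix y assume "y \<in> range (\<lambda>k. kap (s - of_int k) * (if v = \<gamma> (k - m) then 1 else 0))"
    then obtain k where "y = kap (s - of_int k) * (if v = \<gamma> (k - m) then 1 else 0)" by blast
    then have "y = ?f (k - m)" by simp
    then show "y \<in> range ?f" by blast
  next
    fix y assume "y \<in> range ?f"
    then obtain k where "y = ?f k" by blast
    then have "y = kap (s - of_int (k + m)) * (if v = \<gamma> (k + m - m) then 1 else 0)" by (simp add: algebra_simps)
    then show "y \<in> range (\<lambda>k. kap (s - of_int k) * (if v = \<gamma> (k - m) then 1 else 0))" by blast
  qed
  then show "track (\<lambda>k. \<gamma> (k - m)) s v = track \<gamma> (s - of_int m) v"
    unfolding track_def line_def fmax_def by simp
qed

lemma line_marg_vertex: "line (marg (vertex_pt \<gamma>)) s = track \<gamma> s"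
  by (simp add: track_def marg_vertex_pt[abs_def])

lemma track_base:
  assumes "\<gamma> \<in> Om" "\<And>k. \<bar>s - of_int k\<bar> < 3/2 \<Longrightarrow> \<gamma> k = base k"
  shows "track \<gamma> s = bpt"
  unfolding line_marg_vertex[symmetric]
  by (rule line_base[OF marg_in_SQ[OF vertex_pt_in_MC[OF assms(1)]]]) (simp add: marg_vertex_pt assms(2))

lemma continuous_map_track:
  assumes g: "\<gamma> \<in> Om" shows "continuous_map euclideanreal TB (track \<gamma>)"
proof (rule continuous_map_into_weak_top_finite)
  show "track \<gamma> s \<in> MB" for s
    unfolding line_marg_vertex[symmetric] by (rule line_in_MB[OF marg_in_SQ[OF vertex_pt_in_MC[OF g]]])
  show "finite (range \<gamma>)" by (rule finite_range_Om[OF g])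
  show "track \<gamma> s v = 0" if v: "v \<notin> range \<gamma>" for s v
  proof (rule ccontr)
    assume "track \<gamma> s v \<noteq> 0"
    then obtain k where "(if v = \<gamma> k then 1 else 0) \<noteq> (0::real)" unfolding track_def by (rule line_nonzero)
    then show False using v by (auto split: if_splits)
  qed
  show "continuous_map euclideanreal euclideanreal (\<lambda>s. track \<gamma> s v)" for v
    unfolding track_def by (rule continuous_map_line) simp_all
qed

lemma vloop_track:
  assumes g: "\<gamma> \<in> Om" and N: "\<And>k. N \<le> \<bar>k\<bar> \<Longrightarrow> \<gamma> k = base k" "0 \<le> N"
  shows "vloop \<gamma> t = track \<gamma> (rho (clip (tau (- of_int (N + 2))) (tau (of_int (N + 2))) t))"
  unfolding vloop_def line_marg_vertex[symmetric]
proof (rule loop_of_clip[OF vertex_pt_in_MC[OF g] _ N(2)])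
  fix \<gamma>' k assume "vertex_pt \<gamma> \<gamma>' \<noteq> 0" "N \<le> \<bar>k\<bar>"
  then show "\<gamma>' k = base k" using N(1) by (auto simp: vertex_pt_def split: if_splits)
qed

lemma track_ext_base:
  assumes "Lp g" "s \<le> - 1 \<or> of_int (int (length g)) \<le> s"
  shows "track (ext g) s = bpt"
proof (rule track_base[OF ext_in_Om[OF assms(1)]])
  fix k assume k: "\<bar>s - of_int k\<bar> < 3/2"
  show "ext g k = base k"
  proof (rule ext_base[OF assms(1)])
    have "real_of_int k < 1 \<or> real_of_int (int (length g) - 2) < real_of_int k"
      using assms(2) k unfolding abs_less_iff of_int_diff of_int_numeral by linarith
    then have "k < 1 \<or> int (length g) - 2 < k" by (simp only: of_int_less_iff of_int_less_1_iff)
    then show "k \<le> 0 \<or> int (length g) - 1 \<le> k" by linarith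
  qed
qed

text \<open>A spur inserted between the two lists makes the track pass through the base point, where it
  splits into the tracks of the two lists.\<close>
lemma join_vloop:
  assumes g: "Lp g" and h: "Lp h"
  shows "loop_homotopic TB bpt (join_loops (vloop (ext g)) (vloop (ext h))) (vloop (ext (g @ tl h)))"
proof -
  let ?gh = "(g @ [x1, x0]) @ tl h"
  have L: "Lp (g @ tl h)" "Lp ?gh"
    using Lp_append[OF g h] Lp_append[OF Lp_append[OF g Lp_base_spur] h] by simp_all
  have pos: "0 < length g" "0 < length h" using g h by (auto simp: loop2_def)
  define n where "n = int (length g) - 1"
  \<comment> \<open>Large enough for all three lists, so that their loops arise from their tracks
    through one time function \<open>?z\<close>.\<close>
  define N where "N = int (length g) + int (length h) + 3"
  let ?M = "real_of_int (N + 2)"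
  let ?z = "\<lambda>t. rho (clip (tau (- ?M)) (tau ?M) t)"
  let ?D = "track (ext ?gh)"
  have N0: "0 \<le> N" by (simp add: N_def)
  have M: "- ?M \<le> ?M" "tau (- ?M) \<le> tau ?M" using N0 by simp_all
  have far: "ext k i = base i" if "Lp k" "int (length k) \<le> N" "N \<le> \<bar>i\<bar>" for k i
    by (rule ext_base[OF that(1)]) (use that(2,3) in linarith)
  have vl: "vloop (ext k) t = track (ext k) (?z t)" if "Lp k" "int (length k) \<le> N" for k t
    by (rule vloop_track[OF ext_in_Om[OF that(1)] far[OF that] N0])
  have len: "int (length g) \<le> N" "int (length h) \<le> N" "int (length ?gh) \<le> N" by (simp_all add: N_def)
  \<comment> \<open>From \<open>s \<le> n + 1\<close> only indices up to \<open>n + 2\<close> are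
    seen, and from \<open>s \<ge> n + 1\<close> only indices from \<open>n\<close> on.\<close>
  have DA: "?D s = track (ext g) s" if "s \<le> of_int (n + 1)" for s
  proof (rule track_cong)
    fix k assume "\<bar>s - of_int k\<bar> < 3/2"
    then have "real_of_int k < of_int (n + 3)" using that unfolding abs_less_iff of_int_add of_int_numeral of_int_1 by linarith
    then have "k \<le> n + 2" by (simp only: of_int_less_iff)
    then show "ext ?gh k = ext g k" using ext_append_spur(1)[OF g h] by (simp add: n_def)
  qed
  have DB: "?D s = track (ext h) (s - of_int (n + 2))" if "of_int (n + 1) \<le> s" for s
  proof -
    have "?D s = track (\<lambda>k. ext h (k - (n + 2))) s"
    proof (rule track_cong)
      fix k assume "\<bar>s - of_int k\<bar> < 3/2"
      then have "real_of_int (n - 1) < of_int k" using that unfolding abs_less_iff of_int_add of_int_diff of_int_1 by linarith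
      then have "n \<le> k" by (simp only: of_int_less_iff)
      then show "ext ?gh k = ext h (k - (n + 2))" using ext_append_spur(2)[OF g h] by (simp add: n_def)
    qed
    also have "\<dots> = track (ext h) (s - of_int (n + 2))" by (rule track_shift)
    finally show ?thesis .
  qed
  have Dn: "?D (of_int (n + 1)) = bpt"
    unfolding DA[OF order_refl] by (rule track_ext_base[OF g]) (simp add: n_def)
  have zlo: "?z t = - ?M" if "t \<le> 0" for t
  proof -
    have "clip (tau (- ?M)) (tau ?M) t = tau (- ?M)"
      using that M(2) tau_bounds[of "- ?M"] tau_bounds[of ?M] unfolding clip_def by linarith
    then show ?thesis by (simp only: rho_tau)
  qed
  have zhi: "?z t = ?M" if "1 \<le> t" for t
  proof -
    have "clip (tau (- ?M)) (tau ?M) t = tau ?M"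
      using that M(2) tau_bounds[of "- ?M"] tau_bounds[of ?M] unfolding clip_def by linarith
    then show ?thesis by (simp only: rho_tau)
  qed
  \<comment> \<open>In each half of the time interval one of the first two summands equals
    \<open>n + 1\<close> and is cancelled by the last term. At \<open>n + 1\<close>, the middle of
    the spur, the track is at the base point.\<close>
  let ?x = "\<lambda>t. min (of_int (n + 1)) (?z (2 * t)) + max (of_int (n + 1)) (?z (2 * t - 1) + of_int (n + 2)) - of_int (n + 1)"
  have nM: "of_int (n + 1) \<le> ?M" "- ?M + of_int (n + 2) \<le> of_int (n + 1)" "0 \<le> n"
    using pos by (simp_all add: n_def N_def)
  have x1: "?x t = min (of_int (n + 1)) (?z (2 * t))" if "t \<le> 1/2" for t
  proof -
    have "?z (2 * t - 1) = - ?M" by (rule zlo) (use that in simp)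
    then show ?thesis using nM by linarith
  qed
  have x2: "?x t = max (of_int (n + 1)) (?z (2 * t - 1) + of_int (n + 2))" if "1/2 \<le> t" for t
  proof -
    have "?z (2 * t) = ?M" by (rule zhi) (use that in simp)
    then show ?thesis using nM by linarith
  qed
  \<comment> \<open>Where the minimum or maximum cuts off, the original loop is in a tail and rests
    at the base point as well.\<close>
  have join: "(?D \<circ> ?x) t = join_loops (vloop (ext g)) (vloop (ext h)) t" for t
  proof (cases "t \<le> 1/2")
    case True
    have "?D (?x t) = track (ext g) (?z (2 * t))"
    proof (cases "?z (2 * t) \<le> of_int (n + 1)")
      case True
      then show ?thesis unfolding x1[OF \<open>t \<le> 1/2\<close>] using DA[OF True] by (simp only: min_absorb2)
    next
      case False
      then have m: "min (of_int (n + 1)) (?z (2 * t)) = of_int (n + 1)" by linarith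
      have "track (ext g) (?z (2 * t)) = bpt" by (rule track_ext_base[OF g]) (use False in \<open>simp add: n_def\<close>)
      then show ?thesis unfolding x1[OF \<open>t \<le> 1/2\<close>] unfolding m using Dn by simp
    qed
    then show ?thesis using True vl[OF g len(1)] by (simp add: join_loops_def)
  next
    case False
    then have t: "1/2 \<le> t" by simp
    have "?D (?x t) = track (ext h) (?z (2 * t - 1))"
    proof (cases "of_int (n + 1) \<le> ?z (2 * t - 1) + of_int (n + 2)")
      case True
      then have m: "max (of_int (n + 1)) (?z (2 * t - 1) + of_int (n + 2)) = ?z (2 * t - 1) + of_int (n + 2)" by (rule max_absorb2)
      show ?thesis unfolding x2[OF t] unfolding m DB[OF True] by simp
    next
      case False
      then have m: "max (of_int (n + 1)) (?z (2 * t - 1) + of_int (n + 2)) = of_int (n + 1)" by linarith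
      have "track (ext h) (?z (2 * t - 1)) = bpt" by (rule track_ext_base[OF h]) (use False in simp)
      then show ?thesis unfolding x2[OF t] unfolding m using Dn by simp
    qed
    then show ?thesis using False vl[OF h len(2)] by (simp add: join_loops_def)
  qed
  have id: "continuous_map unit_interval euclideanreal (\<lambda>t. t)" by (rule continuous_map_from_subtopology) simp
  have cz: "continuous_map unit_interval euclideanreal (\<lambda>t. ?z (f t))" if "continuous_map unit_interval euclideanreal f" for f
    by (rule continuous_map_rho_clip[OF that M(1)])
  \<comment> \<open>Both time functions begin at or below -1 and end at or above the length of the
    list, where the track is constant.\<close>
  have hom: "loop_homotopic TB bpt (?D \<circ> ?x) (?D \<circ> ?z)"
  proof (rule loop_homotopic_reparametrize[OF continuous_map_track[OF ext_in_Om[OF L(2)]]])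
    show "?D s = bpt" if "s \<le> - 1" for s by (rule track_ext_base[OF L(2)]) (use that in simp)
    show "?D s = bpt" if "of_int (int (length ?gh)) \<le> s" for s by (rule track_ext_base[OF L(2)]) (use that in blast)
    show "continuous_map unit_interval euclideanreal ?x"
      by (intro continuous_map_diff continuous_map_add continuous_map_real_min continuous_map_real_max cz
          continuous_map_real_mult_left id) simp_all
    show "continuous_map unit_interval euclideanreal ?z" by (rule cz[OF id])
    have M1: "- ?M \<le> - 1" using N0 by simp
    show "?z 0 \<le> - 1" using zlo[of 0] M1 by (simp only: order_refl)
    have "?x 0 = min (of_int (n + 1)) (?z (2 * 0))" by (rule x1) simp
    moreover have "?z (2 * 0) = - ?M" by (rule zlo) simp
    ultimately have "?x 0 \<le> - ?M" by linarith
    then show "?x 0 \<le> - 1" using M1 by linarith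
    have lM: "real_of_int (int (length ?gh)) \<le> ?M" using len(3) by simp
    then show "of_int (int (length ?gh)) \<le> ?z 1" using zhi[of 1] by (simp only: order_refl)
    have "?x 1 = max (of_int (n + 1)) (?z (2 * 1 - 1) + of_int (n + 2))" by (rule x2) simp
    moreover have "?z (2 * 1 - 1) = ?M" by (rule zhi) simp
    ultimately have "?M + of_int (n + 2) \<le> ?x 1" by linarith
    moreover have "0 \<le> real_of_int (n + 2)" using nM(3) by simp
    ultimately show "of_int (int (length ?gh)) \<le> ?x 1" using lM by linarith
  qed
  have a: "loop_homotopic TB bpt (?D \<circ> ?x) (join_loops (vloop (ext g)) (vloop (ext h)))"
    by (rule loop_homotopic_equal[OF loop_homotopic_imp_loops_at(1)[OF hom]]) (rule join)
  have b: "?D \<circ> ?z = vloop (ext ?gh)" using vl[OF L(2) len(3)] by (simp add: fun_eq_iff)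
  have c: "loop_homotopic TB bpt (vloop (ext ?gh)) (vloop (ext (g @ tl h)))"
    unfolding vloop_homotopic_iff[OF ext_in_Om[OF L(2)] ext_in_Om[OF L(1)]] Ed_star_ext_iff[OF L(2,1)]
    by (rule Eq_sym[OF Eq_append_spur[OF g h]])
  show ?thesis
    by (rule loop_homotopic_trans[OF loop_homotopic_trans[OF loop_homotopic_sym[OF a] hom[unfolded b]] c])
qed

section \<open>From lists to the fundamental group\<close>

lemma loop_class_eq:
  assumes "loop_homotopic T p a b" shows "loop_class T p a = loop_class T p b"
  unfolding loop_class_def
  using loop_homotopic_trans[OF assms] loop_homotopic_trans[OF loop_homotopic_sym[OF assms]] by (intro Collect_cong) auto

text \<open>The isomorphism takes a class of loops to the set of lists whose loops belong to it.
  \<open>surj\<close> represents every class by a list, \<open>eq\<close> identifies the resulting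
  sets with classes of lists, and \<open>join\<close> computes products on representatives.\<close>

lemma fundamental_group_iso_pi1_2:
  assumes L: "\<And>g. Lp g \<Longrightarrow> L g \<in> loops_at T p"
    and surj: "\<And>w. w \<in> loops_at T p \<Longrightarrow> \<exists>g. Lp g \<and> loop_homotopic T p w (L g)"
    and eq: "\<And>g h. Lp g \<Longrightarrow> Lp h \<Longrightarrow> loop_homotopic T p (L g) (L h) \<longleftrightarrow> (g, h) \<in> Eq"
    and join: "\<And>g h. Lp g \<Longrightarrow> Lp h \<Longrightarrow> loop_homotopic T p (join_loops (L g) (L h)) (L (g @ tl h))"
  shows "fundamental_group T p \<cong> pi1_2 V E x0"
proof (rule is_isoI)
  let ?F = "\<lambda>A. {h. Lp h \<and> L h \<in> A}"
  let ?cl = "\<lambda>g. loop_class T p (L g)"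
  have cls: "\<exists>g. Lp g \<and> A = ?cl g" if A: "A \<in> carrier (fundamental_group T p)" for A
  proof -
    obtain w where w: "w \<in> loops_at T p" "A = loop_class T p w" using A by (auto simp: fundamental_group_def)
    obtain g where g: "Lp g" "loop_homotopic T p w (L g)" using surj[OF w(1)] by blast
    have "loop_class T p w = ?cl g"
      using g(2) by (rule loop_class_eq)
    then show ?thesis using w g by blast
  qed
  have F: "?F (?cl g) = Eq `` {g}" if "Lp g" for g
    using that L eq Eq_Lp by (auto simp: loop_class_def)
  have mult: "?cl g \<otimes>\<^bsub>fundamental_group T p\<^esub> ?cl h = ?cl (g @ tl h)" if gh: "Lp g" "Lp h" for g h
  proof (intro equalityI subsetI)
    fix e assume "e \<in> ?cl g \<otimes>\<^bsub>fundamental_group T p\<^esub> ?cl h"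
    then obtain a b where ab: "e \<in> loops_at T p" "loop_homotopic T p (L g) a" "loop_homotopic T p (L h) b"
        "loop_homotopic T p (join_loops a b) e"
      by (auto simp: fundamental_group_def loop_class_def)
    have "loop_homotopic T p (L (g @ tl h)) e"
      using loop_homotopic_trans[OF loop_homotopic_trans[OF loop_homotopic_sym[OF join[OF gh]] loop_homotopic_join[OF ab(2,3)]] ab(4)] .
    then show "e \<in> ?cl (g @ tl h)" using ab(1) by (simp add: loop_class_def)
  next
    fix e assume "e \<in> ?cl (g @ tl h)"
    then have e: "e \<in> loops_at T p" "loop_homotopic T p (L (g @ tl h)) e" by (auto simp: loop_class_def)
    have "L g \<in> ?cl g" "L h \<in> ?cl h"
      using L[OF gh(1)] L[OF gh(2)] loop_homotopic_refl[OF L[OF gh(1)]] loop_homotopic_refl[OF L[OF gh(2)]]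
      by (simp_all add: loop_class_def)
    then show "e \<in> ?cl g \<otimes>\<^bsub>fundamental_group T p\<^esub> ?cl h"
      using e loop_homotopic_trans[OF join[OF gh] e(2)] by (auto simp: fundamental_group_def)
  qed
  have mult2: "Eq `` {g} \<otimes>\<^bsub>pi1_2 V E x0\<^esub> Eq `` {h} = Eq `` {g @ tl h}" if gh: "Lp g" "Lp h" for g h
  proof (intro equalityI subsetI)
    fix e assume "e \<in> Eq `` {g} \<otimes>\<^bsub>pi1_2 V E x0\<^esub> Eq `` {h}"
    then obtain a b where ab: "(g, a) \<in> Eq" "(h, b) \<in> Eq" "(a @ tl b, e) \<in> Eq" by (auto simp: pi1_2_def)
    have Lab: "Lp a" "Lp b" using Eq_Lp ab(1,2) gh by blast+
    have "loop_homotopic T p (L g) (L a)" "loop_homotopic T p (L h) (L b)" using eq gh Lab ab by blast+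
    then have "loop_homotopic T p (L (g @ tl h)) (L (a @ tl b))"
      using loop_homotopic_trans[OF loop_homotopic_sym[OF join[OF gh]] loop_homotopic_trans[OF loop_homotopic_join join[OF Lab]]] by blast
    then have "(g @ tl h, a @ tl b) \<in> Eq" using eq Lp_append gh Lab by blast
    then show "e \<in> Eq `` {g @ tl h}" using ab(3) Eq_trans by blast
  next
    fix e assume "e \<in> Eq `` {g @ tl h}"
    then have "(g @ tl h, e) \<in> Eq" by simp
    moreover have "g \<in> Eq `` {g}" "h \<in> Eq `` {h}" by auto
    ultimately show "e \<in> Eq `` {g} \<otimes>\<^bsub>pi1_2 V E x0\<^esub> Eq `` {h}"
      unfolding pi1_2_def monoid.simps mem_Collect_eq by blast
  qed
  have car2: "carrier (pi1_2 V E x0) = {Eq `` {g} | g. Lp g}" by (simp add: pi1_2_def)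
  have clin: "?cl g \<in> carrier (fundamental_group T p)" if "Lp g" for g
    using L[OF that] by (simp add: fundamental_group_def)
  show "?F \<in> Group.iso (fundamental_group T p) (pi1_2 V E x0)"
    unfolding Group.iso_iff
  proof (intro conjI)
    show "?F \<in> hom (fundamental_group T p) (pi1_2 V E x0)"
    proof (rule homI)
      fix A B assume A: "A \<in> carrier (fundamental_group T p)" and B: "B \<in> carrier (fundamental_group T p)"
      obtain g h where gh: "Lp g" "A = ?cl g" "Lp h" "B = ?cl h" using cls[OF A] cls[OF B] by blast
      show "?F A \<in> carrier (pi1_2 V E x0)" unfolding gh(2) F[OF gh(1)] car2 using gh(1) by blast
      show "?F (A \<otimes>\<^bsub>fundamental_group T p\<^esub> B) = ?F A \<otimes>\<^bsub>pi1_2 V E x0\<^esub> ?F B"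
        unfolding gh(2,4) mult[OF gh(1,3)] F[OF gh(1)] F[OF gh(3)] F[OF Lp_append[OF gh(1,3)]] mult2[OF gh(1,3)] ..
    qed
    show "?F ` carrier (fundamental_group T p) = carrier (pi1_2 V E x0)"
    proof (intro equalityI subsetI)
      fix X assume "X \<in> ?F ` carrier (fundamental_group T p)"
      then obtain A where A: "A \<in> carrier (fundamental_group T p)" "X = ?F A" by blast
      obtain g where g: "Lp g" "A = ?cl g" using cls[OF A(1)] by blast
      show "X \<in> carrier (pi1_2 V E x0)" unfolding A(2) g(2) F[OF g(1)] car2 using g(1) by blast
    next
      fix X assume "X \<in> carrier (pi1_2 V E x0)"
      then obtain g where g: "Lp g" "X = Eq `` {g}" unfolding car2 by blast
      show "X \<in> ?F ` carrier (fundamental_group T p)"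
        unfolding g(2) F[OF g(1), symmetric] by (rule imageI[OF clin[OF g(1)]])
    qed
    show "inj_on ?F (carrier (fundamental_group T p))"
    proof (rule inj_onI)
      fix A B assume A: "A \<in> carrier (fundamental_group T p)" and B: "B \<in> carrier (fundamental_group T p)" and AB: "?F A = ?F B"
      obtain g h where gh: "Lp g" "A = ?cl g" "Lp h" "B = ?cl h" using cls[OF A] cls[OF B] by blast
      have "Eq `` {g} = Eq `` {h}" using AB unfolding gh(2,4) F[OF gh(1)] F[OF gh(3)] .
      then have "(g, h) \<in> Eq" by (metis Eq_refl Image_singleton_iff)
      then have "loop_homotopic T p (L g) (L h)" using eq gh by blast
      then show "A = B" unfolding gh(2,4) by (rule loop_class_eq)
    qed
  qed
qed

text \<open>Lists become loops in \<open>T\<close> through the inverse \<open>g\<close>; homotopies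
  are carried over by \<open>f\<close> and \<open>g\<close>, and \<open>f p = bpt\<close> keeps them
  based.\<close>

lemma fundamental_group_iso_of_homeomorphic:
  assumes fg: "homeomorphic_maps T TB f g" and p: "p \<in> topspace T" "f p = bpt"
  shows "fundamental_group T p \<cong> pi1_2 V E x0"
proof (rule fundamental_group_iso_pi1_2[where L="\<lambda>k. g \<circ> vloop (ext k)"])
  have cf: "continuous_map T TB f" and cg: "continuous_map TB T g" and gf: "\<And>x. x \<in> topspace T \<Longrightarrow> g (f x) = x"
    and fg': "\<And>x. x \<in> MB \<Longrightarrow> f (g x) = x"
    using fg by (auto simp: homeomorphic_maps_def)
  have gp: "g bpt = p" using gf[OF p(1)] p(2) by simp
  have vl: "vloop (ext k) \<in> loops_at TB bpt" if "Lp k" for k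
    by (rule subsetD[OF based_loops_subset_loops_at vloop_in_loops[OF ext_in_Om[OF that]]])
  have push: "loop_homotopic T p (g \<circ> a) (g \<circ> b)" if "loop_homotopic TB bpt a b" for a b
    using loop_homotopic_compose[OF that cg] gp by simp
  have f_vl: "f \<circ> (g \<circ> vloop (ext k)) = vloop (ext k)" if "Lp k" for k
    using fg' loopsD(2)[OF vloop_in_loops[OF ext_in_Om[OF that]]] by (simp add: fun_eq_iff)
  show "g \<circ> vloop (ext k) \<in> loops_at T p" if "Lp k" for k
    by (rule loop_homotopic_imp_loops_at(1)[OF push[OF loop_homotopic_refl[OF vl[OF that]]]])
  show "\<exists>k. Lp k \<and> loop_homotopic T p w (g \<circ> vloop (ext k))" if w: "w \<in> loops_at T p" for w
  proof -
    have "f \<circ> w \<in> loops_at TB bpt"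
      using loop_homotopic_imp_loops_at(1)[OF loop_homotopic_compose[OF loop_homotopic_refl[OF w] cf]] p(2) by simp
    then obtain \<gamma> where g1: "\<gamma> \<in> Om" "loop_homotopic TB bpt (f \<circ> w) (vloop \<gamma>)" by (rule loop_homotopic_vloop)
    obtain k where k: "Lp k" "(\<gamma>, ext k) \<in> Ed\<^sup>*" by (rule Om_ext[OF g1(1)])
    have "loop_homotopic TB bpt (vloop \<gamma>) (vloop (ext k))"
      using k(2) vloop_homotopic_iff[OF g1(1) ext_in_Om[OF k(1)]] by blast
    then have 1: "loop_homotopic T p (g \<circ> (f \<circ> w)) (g \<circ> vloop (ext k))"
      by (rule push[OF loop_homotopic_trans[OF g1(2)]])
    have "loop_homotopic T p w (g \<circ> (f \<circ> w))"
    proof (rule loop_homotopic_equal[OF w])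
      fix t :: real assume "t \<in> {0..1}"
      then have "w t \<in> topspace T"
        using w continuous_map_image_subset_topspace[of unit_interval T w] by (auto simp: loops_at_def pathin_def)
      then show "w t = (g \<circ> (f \<circ> w)) t" by (simp add: gf)
    qed
    then show ?thesis using k(1) loop_homotopic_trans[OF _ 1] by blast
  qed
  show "loop_homotopic T p (g \<circ> vloop (ext a)) (g \<circ> vloop (ext b)) \<longleftrightarrow> (a, b) \<in> Eq" if ab: "Lp a" "Lp b" for a b
  proof -
    have e: "loop_homotopic TB bpt (vloop (ext a)) (vloop (ext b)) \<longleftrightarrow> (a, b) \<in> Eq"
      using vloop_homotopic_iff[OF ext_in_Om[OF ab(1)] ext_in_Om[OF ab(2)]] Ed_star_ext_iff[OF ab] by blast
    have "loop_homotopic TB bpt (vloop (ext a)) (vloop (ext b))" if "loop_homotopic T p (g \<circ> vloop (ext a)) (g \<circ> vloop (ext b))"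
      using loop_homotopic_compose[OF that cf] unfolding f_vl[OF ab(1)] f_vl[OF ab(2)] p(2) .
    then show ?thesis using e push by blast
  qed
  show "loop_homotopic T p (join_loops (g \<circ> vloop (ext a)) (g \<circ> vloop (ext b))) (g \<circ> vloop (ext (a @ tl b)))"
    if ab: "Lp a" "Lp b" for a b
  proof -
    have "g \<circ> join_loops (vloop (ext a)) (vloop (ext b)) = join_loops (g \<circ> vloop (ext a)) (g \<circ> vloop (ext b))"
      by (auto simp: join_loops_def fun_eq_iff)
    then show ?thesis using push[OF join_vloop[OF ab]] by simp
  qed
qed

section \<open>Return to the realizations\<close>

lemma set_poset_clique: "set_poset (clique_poset Om Ed) (\<subseteq>) (\<lambda>\<sigma>. \<sigma>)"
  by unfold_locales (auto simp: clique_poset_def)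

lemma set_poset_box: "set_poset (box_complex V E c) box_le join_box"
proof
  \<comment> \<open>The colours recover both components from the union, which gives injectivity and
    the comparison of orders.\<close>
  have d: "fst p = {v \<in> join_box p. c v = 0}" "snd p = {v \<in> join_box p. c v = 1}" if "p \<in> box_complex V E c" for p
    using that by (auto simp: box_complex_def join_box_def)
  show "finite (join_box p)" "join_box p \<noteq> {}" if "p \<in> box_complex V E c" for p
    using that by (auto simp: box_complex_def join_box_def)
  show "inj_on join_box (box_complex V E c)"
    by (rule inj_onI) (metis d prod_eqI)
  show "box_le p q \<longleftrightarrow> join_box p \<subseteq> join_box q" if "p \<in> box_complex V E c" "q \<in> box_complex V E c" for p q
  proof
    show "join_box p \<subseteq> join_box q" if "box_le p q" using that by (auto simp: box_le_def join_box_def)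
    show "box_le p q" if "join_box p \<subseteq> join_box q"
      unfolding box_le_def d[OF \<open>p \<in> _\<close>] d[OF \<open>q \<in> _\<close>] using that by auto
  qed
qed

text \<open>Both realizations are exchanged for their models. For loops this needs a homeomorphism
  taking the vertex \<open>({x0}, {x1})\<close> to \<open>bpt\<close>, which the distribution
  function provides.\<close>

theorem loop_space_and_fundamental_group:
  "realization (clique_poset Om Ed) (\<subseteq>) homotopy_equivalent_space
     loop_space (realization (box_complex V E c) box_le) (vertex_pt ({x0}, {x1})) \<and>
   fundamental_group (realization (box_complex V E c) box_le) (vertex_pt ({x0}, {x1})) \<cong> pi1_2 V E x0"
proof
  let ?T = "realization (box_complex V E c) box_le" and ?p = "vertex_pt ({x0}, {x1})"
  interpret C: set_poset "clique_poset Om Ed" "(\<subseteq>)" "\<lambda>\<sigma>. \<sigma>" by (rule set_poset_clique)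
  interpret B: set_poset "box_complex V E c" box_le join_box by (rule set_poset_box)
  have hC: "realization (clique_poset Om Ed) (\<subseteq>) homeomorphic_space TC"
    using C.homeomorphic_maps_level_model unfolding MC_eq_level_model homeomorphic_space_def image_ident by blast
  have hB: "homeomorphic_maps ?T TB B.height B.coef"
    using B.homeomorphic_maps_level_model unfolding MB_eq_level_model .
  have box: "({x0}, {x1}) \<in> box_complex V E c" using x01 by (auto simp: box_complex_def)
  have hp: "B.height ?p = bpt"
    unfolding B.height_vertex_pt[OF box] by (auto simp: join_box_def bpt_def fun_eq_iff)
  have "bpt \<in> topspace TB" using bpt_in_MB by simp
  then have "B.coef bpt \<in> topspace ?T" "B.coef (B.height ?p) \<in> topspace ?T"
    using hB hp by (auto simp: homeomorphic_maps_def continuous_map_def)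
  have chain: "{({x0}, {x1})} \<in> chains_of (box_complex V E c) box_le"
    using box by (simp add: chains_of_def box_le_def)
  have "?p \<in> simplex_of {({x0}, {x1})}" by (auto simp: simplex_of_def vertex_pt_def)
  then have p: "?p \<in> topspace ?T"
    unfolding realization_eq_weak_top topspace_weak_top realization_carrier_def using chain by blast
  have "loop_space ?T ?p homeomorphic_space LB"
    using homeomorphic_maps_imp_loop_spaces[OF hB p] unfolding hp .
  then have "LB homotopy_equivalent_space loop_space ?T ?p"
    using homeomorphic_imp_homotopy_equivalent_space homotopy_equivalent_space_sym by blast
  then show "realization (clique_poset Om Ed) (\<subseteq>) homotopy_equivalent_space loop_space ?T ?p"
    using homotopy_eqv_trans[OF homeomorphic_imp_homotopy_equivalent_space[OF hC]
        homotopy_eqv_trans[OF homotopy_equivalent_models]] by blast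
  show "fundamental_group ?T ?p \<cong> pi1_2 V E x0"
    by (rule fundamental_group_iso_of_homeomorphic[of ?T B.height B.coef ?p]) (fact hB p hp)+
qed

end

theorem theorem1p1:
  fixes V :: "'v set" and E :: "('v \<times> 'v) set" and c :: "'v \<Rightarrow> nat" and x0 x1 :: 'v
  assumes "is_based_bigraph V E c x0 x1"
  shows "realization (clique_poset (omega_vertices V E c x0 x1) (omega_edges V E c x0 x1)) (\<subseteq>)
           homotopy_equivalent_space
         loop_space (realization (box_complex V E c) box_le) (vertex_pt ({x0}, {x1}))
       \<and> fundamental_group (realization (box_complex V E c) box_le) (vertex_pt ({x0}, {x1}))
           \<cong> pi1_2 V E x0"
  by (rule based_bigraph.loop_space_and_fundamental_group[OF based_bigraph.intro[OF assms]])

end
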